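(* Let $\beta>0$, $\beta'=\beta/2$, $0<\tau<1$, and for each $N$ let $\mu_{\tt w}^{(N)}$ be the random spectral measure of the $\beta$-Laguerre ensemble $L\beta E(N,m(N))$ with $m(N)=\lfloor\tau N\rfloor$. Then the sequence $(\mu_{\tt w}^{(N)})_N$ satisfies in $\mathcal M^1_{m,d}((0,\infty))$ (equipped with the topology of convergence of moments) a Large Deviation Principle with speed $\beta' N$ and good rate function $I^{\tt w}$ defined as follows. $I^{\tt w}(\nu)$ is finite if and only if there exist sequences $(d_k)_{k\ge1}\in[0,\infty)^{\mathbb N}$ and $(s_k)_{k\ge1}\in[0,\infty)^{\mathbb N}$ (necessarily unique) satisfying $$\sum_{k\ge1}G(d_k)+\tau\sum_{k\ge1}G(s_k/\sqrt\tau)<\infty$$ and such that $m_r(\nu)=\langle e_1,A^re_1\rangle$ for every $r\ge1$, where $A$ is the infinite symmetric tridiagonal matrix with diagonal entries $b_0,b_1,\dots$ and off-diagonal entries $a_0,a_1,\dots$ given by $$b_0=d_1^2,\qquad b_k=s_k^2+d_{k+1}^2\ (k\ge1),\qquad a_k=s_{k+1}d_{k+1}\ (k\ge0).$$ In that case $$I^{\tt w}(\nu)=\sum_{k\ge1}G(d_k)+\tau\sum_{k\ge1}G(s_k/\sqrt\tau).$$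
   Context: **Function $G$.** $g(x)=x-1-\log x$ if $x>0$ and $g(x)=+\infty$ otherwise; $G(x)=g(x^2)$ if $x>0$ and $G(x)=+\infty$ otherwise. **Ensemble and random spectral measure.** $\gamma(a,b)$ denotes the distribution on $(0,\infty)$ with density $e^{-x/b}x^{a-1}/(b^a\Gamma(a))$. The ensemble $L\beta E(N,m)$, with $\beta'=\beta/2$, is represented by the $m\times m$ symmetric tridiagonal matrix $L_\beta^{(N)}=B_\beta^{(N)}(B_\beta^{(N)})^T$, where $B_\beta^{(N)}$ is lower bidiagonal with diagonal entries $d_1^{(N)},\dots,d_m^{(N)}>0$ and subdiagonal entries $s_1^{(N)},\dots,s_{m-1}^{(N)}>0$ (so the $(j,j)$ entry is $d_j^{(N)}$ and the $(j+1,j)$ entry is $s_j^{(N)}$), all these variables being independent with $$(d_j^{(N)})^2\sim\gamma\big(\beta'(N+1-j),(\beta'N)^{-1}\big),\qquad (s_j^{(N)})^2\sim\gamma\big(\beta'(m-j),(\beta'N)^{-1}\big).$$ The random spectral measure $\mu_{\tt w}^{(N)}$ is the spectral measure of the pair $(L_\beta^{(N)},e_1)$, $e_1$ being the first vector of the canonical basis: $\int x^r d\mu_{\tt w}^{(N)}(x)=\langle e_1,(L_\beta^{(N)})^re_1\rangle$ for all $r\ge 1$; i.e. $\mu_{\tt w}^{(N)}=\sum_{k=1}^m\pi_k\delta_{\lambda_k}$ with $\lambda_k$ the eigenvalues and $\pi_k=|\langle\psi_k,e_1\rangle|^2$ for unit eigenvectors $\psi_k$. **Space and topology.** $\mathcal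 M^1_{m,d}((0,\infty))$ is the set of probability measures on $(0,\infty)$ with all moments $m_k(\mu)=\int x^kd\mu(x)$ finite and which are determined by their moments, endowed with the distance of convergence of moments $$d(\mu,\nu)=\sum_{k\ge1}2^{-k}\frac{|m_k(\mu)-m_k(\nu)|}{1+|m_k(\mu)-m_k(\nu)|}.$$ In $\langle e_1,A^re_1\rangle$, $e_1$ is the first canonical basis vector; since $A$ is tridiagonal, this is a finite sum depending only on finitely many entries. *)

theory Defs
  imports "HOL-Probability.Probability" "Jordan_Normal_Form.Char_Poly"
begin

section \<open>The function G\<close>

definition g_fun :: "real \<Rightarrow> ereal" where
  "g_fun x = (if x > 0 then ereal (x - 1 - ln x) else \<infinity>)"

definition G_fun :: "real \<Rightarrow> ereal" where
  "G_fun x = (if x > 0 then g_fun (x\<^sup>2) else \<infinity>)"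


section \<open>The Laguerre ensemble\<close>

definition gamma_density :: "real \<Rightarrow> real \<Rightarrow> real \<Rightarrow> real" where
  "gamma_density a b x =
     (if x > 0 then exp (- x / b) * x powr (a - 1) / (b powr a * Gamma a) else 0)"

text \<open>
  The families \<open>d\<close> and \<open>s\<close> are indexed from 1: \<open>d 1, \<dots>, d m\<close> and \<open>s 1, \<dots>, s (m - 1)\<close>.
  Independence of all these variables together is expressed over the disjoint union
  of the two index sets.
\<close>

definition laguerre_entries ::
    "real \<Rightarrow> nat \<Rightarrow> nat \<Rightarrow> 'a measure \<Rightarrow> (nat \<Rightarrow> 'a \<Rightarrow> real) \<Rightarrow> (nat \<Rightarrow> 'a \<Rightarrow> real) \<Rightarrow> bool" where
  "laguerre_entries \<beta> N m P d s \<longleftrightarrow>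
     prob_space P \<and>
     (\<forall>\<omega>\<in>space P. (\<forall>j\<in>{1..m}. d j \<omega> > 0) \<and> (\<forall>j\<in>{1..<m}. s j \<omega> > 0)) \<and>
     prob_space.indep_vars P (\<lambda>_. borel) (case_sum d s) ({1..m} <+> {1..<m}) \<and>
     (\<forall>j\<in>{1..m}. distributed P lborel (\<lambda>\<omega>. (d j \<omega>)\<^sup>2)
        (\<lambda>x. ennreal (gamma_density (\<beta> / 2 * (real N + 1 - real j)) (inverse (\<beta> / 2 * real N)) x))) \<and>
     (\<forall>j\<in>{1..<m}. distributed P lborel (\<lambda>\<omega>. (s j \<omega>)\<^sup>2)
        (\<lambda>x. ennreal (gamma_density (\<beta> / 2 * (real m - real j)) (inverse (\<beta> / 2 * real N)) x)))"

text \<open>Matrix indices start at 0, hence the shifts.\<close>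

definition lower_bidiagonal :: "nat \<Rightarrow> (nat \<Rightarrow> real) \<Rightarrow> (nat \<Rightarrow> real) \<Rightarrow> real mat" where
  "lower_bidiagonal m d s = mat m m (\<lambda>(i, j).
     if i = j then d (Suc j) else if i = Suc j then s (Suc j) else 0)"

definition laguerre_matrix :: "nat \<Rightarrow> (nat \<Rightarrow> real) \<Rightarrow> (nat \<Rightarrow> real) \<Rightarrow> real mat" where
  "laguerre_matrix m d s = lower_bidiagonal m d s * transpose_mat (lower_bidiagonal m d s)"

text \<open>
  \<open>is_spectral_measure L v \<mu>\<close>: \<open>\<mu>\<close> is the sum of the point masses \<open>\<langle>\<psi>\<^sub>k, v\<rangle>\<^sup>2\<close> at \<open>\<lambda>\<^sub>k\<close>, for an
  orthonormal basis of eigenvectors \<open>\<psi>\<^sub>k\<close> of the symmetric matrix \<open>L\<close> with eigenvalues \<open>\<lambda>\<^sub>k\<close>.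
  The measure does not depend on the choice of the basis.
\<close>

definition is_spectral_measure :: "real mat \<Rightarrow> real vec \<Rightarrow> real measure \<Rightarrow> bool" where
  "is_spectral_measure L v \<mu> \<longleftrightarrow>
     sets \<mu> = sets borel \<and>
     (\<exists>(ev :: nat \<Rightarrow> real) (\<psi> :: nat \<Rightarrow> real vec).
        (\<forall>k<dim_row L. eigenvector L (\<psi> k) (ev k)) \<and>
        (\<forall>j<dim_row L. \<forall>k<dim_row L. scalar_prod (\<psi> j) (\<psi> k) = (if j = k then 1 else 0)) \<and>
        (\<forall>A\<in>sets borel. emeasure \<mu> A =
           (\<Sum>k<dim_row L. ennreal ((scalar_prod (\<psi> k) v)\<^sup>2) * indicator A (ev k))))"


section \<open>The space of measures and the topology of convergence of moments\<close>

definition moment :: "real measure \<Rightarrow> nat \<Rightarrow> real" where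
  "moment \<mu> k = (\<integral>x. x ^ k \<partial>\<mu>)"

definition moments_finite :: "real measure \<Rightarrow> bool" where
  "moments_finite \<mu> \<longleftrightarrow> (\<forall>k. integrable \<mu> (\<lambda>x. x ^ k))"

definition borel_prob :: "real measure \<Rightarrow> bool" where
  "borel_prob \<mu> \<longleftrightarrow> prob_space \<mu> \<and> sets \<mu> = sets borel"

definition moment_determinate :: "real measure \<Rightarrow> bool" where
  "moment_determinate \<mu> \<longleftrightarrow>
     (\<forall>\<nu>. borel_prob \<nu> \<and> moments_finite \<nu> \<and> (\<forall>k\<ge>1. moment \<nu> k = moment \<mu> k) \<longrightarrow> \<nu> = \<mu>)"

text \<open>
  Probability measures on \<open>(0,\<infinity>)\<close> are rendered as Borel probability measures on the real line
  giving full mass to \<open>(0,\<infinity>)\<close>.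
\<close>

definition M_md :: "real measure set" where
  "M_md = {\<mu>. borel_prob \<mu> \<and> measure \<mu> {0<..} = 1 \<and> moments_finite \<mu> \<and> moment_determinate \<mu>}"

definition moment_dist :: "real measure \<Rightarrow> real measure \<Rightarrow> real" where
  "moment_dist \<mu> \<nu> = (\<Sum>k. (1/2) ^ Suc k *
     (\<bar>moment \<mu> (Suc k) - moment \<nu> (Suc k)\<bar> / (1 + \<bar>moment \<mu> (Suc k) - moment \<nu> (Suc k)\<bar>)))"

definition moment_topology :: "real measure topology" where
  "moment_topology = Metric_space.mtopology M_md moment_dist"

lemma frac_abs_triangle:
  fixes x y :: real
  shows "\<bar>x + y\<bar> / (1 + \<bar>x + y\<bar>) \<le> \<bar>x\<bar> / (1 + \<bar>x\<bar>) + \<bar>y\<bar> / (1 + \<bar>y\<bar>)"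
proof -
  have mono: "a / (1 + a) \<le> b / (1 + b)" if "0 \<le> a" "a \<le> b" for a b :: real
    using that by (simp add: divide_simps algebra_simps)
  have "\<bar>x + y\<bar> / (1 + \<bar>x + y\<bar>) \<le> (\<bar>x\<bar> + \<bar>y\<bar>) / (1 + (\<bar>x\<bar> + \<bar>y\<bar>))"
    by (rule mono) auto
  also have "\<dots> = \<bar>x\<bar> / (1 + (\<bar>x\<bar> + \<bar>y\<bar>)) + \<bar>y\<bar> / (1 + (\<bar>x\<bar> + \<bar>y\<bar>))"
    by (simp add: add_divide_distrib)
  also have "\<dots> \<le> \<bar>x\<bar> / (1 + \<bar>x\<bar>) + \<bar>y\<bar> / (1 + \<bar>y\<bar>)"
    by (intro add_mono divide_left_mono) (auto intro!: mult_pos_pos add_pos_nonneg)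
  finally show ?thesis .
qed

lemma summable_moment_dist:
  "summable (\<lambda>k. (1/2) ^ Suc k * (\<bar>x k :: real\<bar> / (1 + \<bar>x k\<bar>)))"
proof (rule summable_comparison_test')
  show "summable (\<lambda>k. (1/2 :: real) ^ Suc k)"
    by (simp only: summable_Suc_iff) (simp add: summable_geometric)
  show "norm ((1/2) ^ Suc k * (\<bar>x k\<bar> / (1 + \<bar>x k\<bar>))) \<le> (1/2) ^ Suc k" for k
    by (simp add: abs_mult divide_simps)
qed

lemma Metric_space_moment_dist: "Metric_space M_md moment_dist"
proof
  show "0 \<le> moment_dist \<mu> \<nu>" for \<mu> \<nu>
    unfolding moment_dist_def by (intro suminf_nonneg summable_moment_dist) auto
  show "moment_dist \<mu> \<nu> = moment_dist \<nu> \<mu>" for \<mu> \<nu>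
    unfolding moment_dist_def by (simp only: abs_minus_commute)
  show "moment_dist \<mu> \<nu> = 0 \<longleftrightarrow> \<mu> = \<nu>" if "\<mu> \<in> M_md" "\<nu> \<in> M_md" for \<mu> \<nu>
  proof
    assume "moment_dist \<mu> \<nu> = 0"
    then have *: "(1/2) ^ Suc k *
       (\<bar>moment \<mu> (Suc k) - moment \<nu> (Suc k)\<bar> / (1 + \<bar>moment \<mu> (Suc k) - moment \<nu> (Suc k)\<bar>)) = 0" for k
      unfolding moment_dist_def
      using suminf_eq_zero_iff[OF summable_moment_dist[of "\<lambda>k. moment \<mu> (Suc k) - moment \<nu> (Suc k)"]]
      by (simp del: power_Suc)
    have "moment \<mu> (Suc k) = moment \<nu> (Suc k)" for k
      using *[of k] by (simp add: add_nonneg_eq_0_iff)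
    then have "moment \<mu> k = moment \<nu> k" if "k \<ge> 1" for k
      using that by (cases k) auto
    then show "\<mu> = \<nu>"
      using that unfolding M_md_def moment_determinate_def by blast
  qed (simp add: moment_dist_def)
  show "moment_dist \<mu> \<rho> \<le> moment_dist \<mu> \<nu> + moment_dist \<nu> \<rho>" for \<mu> \<nu> \<rho>
  proof -
    let ?f = "\<lambda>x y k. (1/2) ^ Suc k *
       (\<bar>moment x (Suc k) - moment y (Suc k)\<bar> / (1 + \<bar>moment x (Suc k) - moment y (Suc k)\<bar>))"
    have "?f \<mu> \<rho> k \<le> ?f \<mu> \<nu> k + ?f \<nu> \<rho> k" for k
      using mult_left_mono[OF frac_abs_triangle[of "moment \<mu> (Suc k) - moment \<nu> (Suc k)"
            "moment \<nu> (Suc k) - moment \<rho> (Suc k)"], of "(1/2) ^ Suc k"]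
      by (simp add: distrib_left)
    then have "(\<Sum>k. ?f \<mu> \<rho> k) \<le> (\<Sum>k. ?f \<mu> \<nu> k + ?f \<nu> \<rho> k)"
      by (intro suminf_le summable_add summable_moment_dist)
    also have "\<dots> = (\<Sum>k. ?f \<mu> \<nu> k) + (\<Sum>k. ?f \<nu> \<rho> k)"
      by (intro suminf_add[symmetric] summable_moment_dist)
    finally show ?thesis unfolding moment_dist_def .
  qed
qed


section \<open>Large deviation principles\<close>

definition log_prob :: "real \<Rightarrow> ereal" where
  "log_prob p = (if p > 0 then ereal (ln p) else - \<infinity>)"

definition good_rate_function :: "'x topology \<Rightarrow> ('x \<Rightarrow> ereal) \<Rightarrow> bool" where
  "good_rate_function T I \<longleftrightarrow>
     (\<forall>x\<in>topspace T. 0 \<le> I x) \<and>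
     (\<forall>c::real. closedin T {x \<in> topspace T. I x \<le> ereal c} \<and>
                compactin T {x \<in> topspace T. I x \<le> ereal c})"

text \<open>
  The variables \<open>Y N\<close>, each defined on its own probability space \<open>P N\<close>, need only be random
  elements of the topological space \<open>T\<close> (with its Borel sigma-algebra) for all large \<open>N\<close>.
\<close>

definition LDP_good ::
    "'x topology \<Rightarrow> (nat \<Rightarrow> real) \<Rightarrow> (nat \<Rightarrow> 'a measure) \<Rightarrow> (nat \<Rightarrow> 'a \<Rightarrow> 'x) \<Rightarrow> ('x \<Rightarrow> ereal) \<Rightarrow> bool" where
  "LDP_good T speed P Y I \<longleftrightarrow>
     good_rate_function T I \<and>
     (\<forall>\<^sub>F N in sequentially. Y N \<in> measurable (P N) (sigma (topspace T) {U. openin T U})) \<and>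
     (\<forall>F. closedin T F \<longrightarrow>
        limsup (\<lambda>N. ereal (1 / speed N) * log_prob (measure (P N) {\<omega> \<in> space (P N). Y N \<omega> \<in> F}))
          \<le> - (INF x\<in>F. I x)) \<and>
     (\<forall>U. openin T U \<longrightarrow>
        - (INF x\<in>U. I x) \<le>
        liminf (\<lambda>N. ereal (1 / speed N) * log_prob (measure (P N) {\<omega> \<in> space (P N). Y N \<omega> \<in> U})))"


section \<open>The rate function\<close>

definition tridiag :: "(nat \<Rightarrow> real) \<Rightarrow> (nat \<Rightarrow> real) \<Rightarrow> nat \<Rightarrow> nat \<Rightarrow> real" where
  "tridiag a b i j =
     (if i = j then b i else if j = Suc i then a i else if i = Suc j then a j else 0)"

text \<open>
  Action of an infinite tridiagonal matrix on a sequence; row \<open>i\<close> vanishes beyond column \<open>i + 1\<close>.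
\<close>

definition tridiag_apply :: "(nat \<Rightarrow> nat \<Rightarrow> real) \<Rightarrow> (nat \<Rightarrow> real) \<Rightarrow> nat \<Rightarrow> real" where
  "tridiag_apply A v i = (\<Sum>j\<le>Suc i. A i j * v j)"

text \<open>\<open>tridiag_moment A r\<close> is \<open>\<langle>e\<^sub>1, A\<^sup>r e\<^sub>1\<rangle>\<close>.\<close>

definition tridiag_moment :: "(nat \<Rightarrow> nat \<Rightarrow> real) \<Rightarrow> nat \<Rightarrow> real" where
  "tridiag_moment A r = ((tridiag_apply A ^^ r) (\<lambda>i. if i = 0 then 1 else 0)) 0"

definition diag_coeff :: "(nat \<Rightarrow> real) \<Rightarrow> (nat \<Rightarrow> real) \<Rightarrow> nat \<Rightarrow> real" where
  "diag_coeff d s k = (if k = 0 then (d 1)\<^sup>2 else (s k)\<^sup>2 + (d (Suc k))\<^sup>2)"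

definition offdiag_coeff :: "(nat \<Rightarrow> real) \<Rightarrow> (nat \<Rightarrow> real) \<Rightarrow> nat \<Rightarrow> real" where
  "offdiag_coeff d s k = s (Suc k) * d (Suc k)"

definition cost :: "real \<Rightarrow> (nat \<Rightarrow> real) \<Rightarrow> (nat \<Rightarrow> real) \<Rightarrow> ereal" where
  "cost \<tau> d s = (\<Sum>k. G_fun (d (Suc k))) + ereal \<tau> * (\<Sum>k. G_fun (s (Suc k) / sqrt \<tau>))"

text \<open>
  Sequences \<open>(d\<^sub>k)\<close>, \<open>(s\<^sub>k)\<close> with \<open>k \<ge> 1\<close> are extensional functions on \<open>{1..}\<close>, so that equality of
  functions is equality of sequences.
\<close>

definition encodes :: "real \<Rightarrow> real measure \<Rightarrow> (nat \<Rightarrow> real) \<Rightarrow> (nat \<Rightarrow> real) \<Rightarrow> bool" where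
  "encodes \<tau> \<nu> d s \<longleftrightarrow>
     d \<in> {1..} \<rightarrow>\<^sub>E {0..} \<and> s \<in> {1..} \<rightarrow>\<^sub>E {0..} \<and> cost \<tau> d s < \<infinity> \<and>
     (\<forall>r\<ge>1. moment \<nu> r = tridiag_moment (tridiag (offdiag_coeff d s) (diag_coeff d s)) r)"

definition rate_w :: "real \<Rightarrow> real measure \<Rightarrow> ereal" where
  "rate_w \<tau> \<nu> =
     (if \<exists>d s. encodes \<tau> \<nu> d s
      then THE c. \<exists>d s. encodes \<tau> \<nu> d s \<and> c = cost \<tau> d s
      else \<infinity>)"

end

theory Submission
  imports Defs "HOL-Real_Asymp.Real_Asymp"
begin

text \<open>
  The idea is to work with the matrix entries rather than with the measures. The squares of the
  entries are independent gamma variables with scale \<open>1 / n\<close>, where \<open>n = \<beta> N / 2\<close> is the speed, and with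
  a shape parameter that is asymptotic to \<open>\<kappa> n\<close>: here \<open>\<kappa> = 1\<close> for the entries \<open>d\<^sub>j\<close>, and \<open>\<kappa> = \<tau>\<close> for
  the entries \<open>s\<^sub>j\<close>. Stirling's formula shows that such a variable satisfies a large deviation
  principle with speed \<open>n\<close> and rate \<open>y - \<kappa> - \<kappa> ln (y / \<kappa>)\<close>, called \<open>gamma_rate\<close> below. At \<open>y = d\<^sup>2\<close>
  and \<open>\<kappa> = 1\<close> this is \<open>G d\<close>, and at \<open>y = s\<^sup>2\<close> and \<open>\<kappa> = \<tau>\<close> it is \<open>\<tau> G (s / sqrt \<tau>)\<close>; the cost of a
  sequence of entries is the sum of the rates of its members. Two estimates suffice
  (\<open>gamma_exp_rate_subexponential\<close>, \<open>gamma_interval_prob_exp_ge\<close>): for \<open>\<theta> < 1\<close> the exponential moment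
  of \<open>\<theta> n\<close> times the rate grows subexponentially, and an interval has at least the probability that the
  rate of its left end predicts, up to the length of the interval.

  The passage from entries to measures is continuous: a moment of the spectral measure is a polynomial
  in finitely many entries, and the topology is that of convergence of moments. So the lower bound on
  an open set \<open>U\<close> holds because, around a point of \<open>U\<close> with finite rate, finitely many entries being
  close to those of the point force the spectral measure into \<open>U\<close>. The upper bound on a closed set \<open>F\<close>
  is a Chernoff bound. If \<open>\<alpha>\<close> is below the infimum of the rate on \<open>F\<close>, then there is a \<open>k\<close>, the same for
  all large \<open>N\<close>, such that a spectral measure in \<open>F\<close> has first \<open>k\<close> pairs of entries of total cost above
  \<open>\<alpha>\<close> (\<open>closedin_imp_partial_cost_gt\<close>), and the exponential moments bound the probability of that.

  The existence of \<open>k\<close> and the compactness of the level sets of the rate function both rest on two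
  facts. Sequences of entries of bounded cost are sequentially compact coordinatewise
  (\<open>sublevel_subsequence\<close>). If the entries converge coordinatewise to a sequence of finite cost, then
  the measures converge in the moment topology to an element of the space
  (\<open>laguerre_limit_measure\<close>). For the latter, a limit measure on \<open>[0, \<infinity>)\<close> with the limiting moments exists by
  Helly selection (\<open>moment_sequence_limit\<close>). It is determined by its moments, since finite cost makes
  the Jacobi matrix bounded. Finally it has no atom at \<open>0\<close>: its orthonormal polynomials \<open>p\<^sub>k\<close> satisfy
  \<open>\<bar>p\<^sub>k(0)\<bar> = (d\<^sub>1 \<cdots> d\<^sub>k) / (s\<^sub>1 \<cdots> s\<^sub>k)\<close>, and finite cost forces \<open>d\<^sub>k \<rightarrow> 1\<close> and \<open>s\<^sub>k \<rightarrow> sqrt \<tau>\<close>, where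
  \<open>sqrt \<tau> < 1\<close>, so the sum of \<open>p\<^sub>k(0)\<^sup>2\<close> diverges. The same polynomials recover the entries from the moments,
  which gives the uniqueness of the sequences (\<open>encodes_unique\<close>).
\<close>

section \<open>Large deviations of gamma variables\<close>

text \<open>
  Crude two-sided Stirling bounds, by induction from \<open>1 / (n + 1) \<le> ln (1 + 1 / n) \<le> 1 / n\<close>. The gap
  of order \<open>ln n\<close> is harmless on the scale of large deviations.
\<close>

lemma ln_fact_bounds:
  assumes "n \<ge> 1"
  shows "real n * ln n - n \<le> ln (fact n)" and "ln (fact n) \<le> (real n + 1) * ln n - n + 1"
proof -
  have "real n * ln n - n \<le> ln (fact n) \<and> ln (fact n) \<le> (real n + 1) * ln n - n + 1"
    using assms
  proof (induction n rule: nat_induct_at_least)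
    case base
    show ?case by simp
  next
    case (Suc n)
    have "1 + 1 / real n = real (Suc n) / n"
      using Suc.hyps by (simp add: field_simps)
    then have ratio: "ln (real (Suc n)) = ln n + ln (1 + 1 / n)"
      using Suc.hyps by (simp add: ln_div)
    have "ln (1 + 1 / real n) \<le> 1 / n"
      by (rule ln_add_one_self_le_self) simp
    then have up: "n * ln (1 + 1 / real n) \<le> 1"
      using Suc.hyps by (simp add: field_simps)
    have "ln (real n / Suc n) \<le> real n / Suc n - 1"
      using Suc.hyps by (intro ln_le_minus_one) auto
    moreover have "ln (real n / Suc n) = - ln (1 + 1 / real n)"
      using Suc.hyps ratio by (simp add: ln_div)
    ultimately have lo: "1 \<le> (real n + 1) * ln (1 + 1 / real n)"
      by (simp add: field_simps)
    have "ln (fact (Suc n)) = ln (real (Suc n)) + ln (fact n)"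
      using fact_gt_zero[of n, where 'a = real] unfolding fact_Suc
      by (subst ln_mult_pos) auto
    then show ?case
      using Suc.IH up lo unfolding ratio by (simp add: algebra_simps)
  qed
  then show "real n * ln n - n \<le> ln (fact n)" "ln (fact n) \<le> (real n + 1) * ln n - n + 1"
    by auto
qed

lemma xlnx_mono:
  fixes x y :: real
  assumes "1 \<le> x" "x \<le> y"
  shows "x * ln x - x \<le> y * ln y - y"
proof -
  have "\<exists>d. ((\<lambda>x. x * ln x - x) has_real_derivative d) (at z) \<and> 0 \<le> d" if "x \<le> z" "z \<le> y" for z
    using that assms by (intro exI[of _ "ln z"]) (auto intro!: derivative_eq_intros)
  from DERIV_nonneg_imp_nondecreasing[OF assms(2), of "\<lambda>x. x * ln x - x"] this
  show ?thesis by auto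
qed

text \<open>
  Stirling's formula to leading order. The Gamma function is increasing on \<open>[3/2, \<infinity>)\<close>, so it lies
  between consecutive factorials.
\<close>

lemma ln_Gamma_asymp: "((\<lambda>x::real. ln (Gamma x) / x - ln x) \<longlongrightarrow> -1) at_top"
proof (rule tendsto_sandwich)
  show "((\<lambda>x::real. ((x - 2) * ln (x - 2) - (x - 2)) / x - ln x) \<longlongrightarrow> -1) at_top"
    by real_asymp
  show "((\<lambda>x::real. ((x + 1) * ln x - x + 2) / x - ln x) \<longlongrightarrow> -1) at_top"
    by real_asymp
  have bounds: "(x - 2) * ln (x - 2) - (x - 2) \<le> ln (Gamma x) \<and>
      ln (Gamma x) \<le> (x + 1) * ln x - x + 2" if x: "x \<ge> 3" for x :: real
  proof -
    define n where "n = nat \<lfloor>x\<rfloor>"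
    have n: "real n \<le> x" "x < real n + 1" "n \<ge> 3"
      using x by (auto simp: n_def le_nat_iff le_floor_iff)
    have mono: "Gamma y \<le> Gamma z" if "3/2 \<le> y" "y \<le> z" for y z :: real
      using Gamma_real_strict_mono[of y z] that by (cases "y = z") auto
    have G: "Gamma (real k) = fact (k - 1)" if "k \<ge> 1" for k
      using that Gamma_fact[of "k - 1", where 'a = real] by (simp add: of_nat_diff)
    have "fact (n - 1) \<le> Gamma x"
      using mono[of n x] G[of n] n by auto
    then have "ln (fact (n - 1)) \<le> ln (Gamma x)"
      by (intro ln_mono) auto
    moreover have "(x - 2) * ln (x - 2) - (x - 2) \<le> real (n - 1) * ln (real (n - 1)) - real (n - 1)"
      using n x by (intro xlnx_mono) auto
    moreover have "real (n - 1) * ln (real (n - 1)) - real (n - 1) \<le> ln (fact (n - 1))"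
      using n by (intro ln_fact_bounds) auto
    ultimately have lower: "(x - 2) * ln (x - 2) - (x - 2) \<le> ln (Gamma x)"
      by linarith
    have "Gamma x \<le> fact n"
      using mono[of x "Suc n"] G[of "Suc n"] n x by auto
    then have "ln (Gamma x) \<le> ln (fact n)"
      using Gamma_real_pos[of x] x by (intro ln_mono) auto
    also have "\<dots> \<le> (real n + 1) * ln n - n + 1"
      using n by (intro ln_fact_bounds) auto
    also have "\<dots> \<le> (x + 1) * ln x - x + 2"
    proof -
      have "(real n + 1) * ln n \<le> (x + 1) * ln x"
        using n x by (intro mult_mono ln_mono) auto
      then show ?thesis using n by linarith
    qed
    finally show ?thesis using lower by simp
  qed
  show "\<forall>\<^sub>F x::real in at_top. ((x - 2) * ln (x - 2) - (x - 2)) / x - ln x \<le> ln (Gamma x) / x - ln x"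
    using eventually_ge_at_top[of 3] by eventually_elim (use bounds in \<open>simp add: divide_right_mono\<close>)
  show "\<forall>\<^sub>F x::real in at_top. ln (Gamma x) / x - ln x \<le> ((x + 1) * ln x - x + 2) / x - ln x"
    using eventually_ge_at_top[of 3] by eventually_elim (use bounds in \<open>simp add: divide_right_mono\<close>)
qed

text \<open>
  The form in which Stirling's formula is used: it gives the exponential rate of the normalising
  constant of a gamma density with scale \<open>1 / n\<close> and shape \<open>a \<sim> \<kappa> n\<close>.
\<close>

lemma ln_Gamma_scaled_asymp:
  fixes a n :: "nat \<Rightarrow> real"
  assumes n: "filterlim n at_top sequentially" and lim: "(\<lambda>N. a N / n N) \<longlonglongrightarrow> \<kappa>" and "\<kappa> > 0"
  shows "(\<lambda>N. (ln (Gamma (a N)) - a N * ln (n N)) / n N) \<longlonglongrightarrow> \<kappa> * ln \<kappa> - \<kappa>"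
proof -
  have n_pos: "\<forall>\<^sub>F N in sequentially. n N > 0"
    using n by (rule filterlim_at_top_dense[THEN iffD1, rule_format])
  have ratio_pos: "\<forall>\<^sub>F N in sequentially. a N / n N > 0"
    using order_tendstoD(1)[OF lim \<open>\<kappa> > 0\<close>] .
  have "filterlim (\<lambda>N. a N / n N * n N) at_top sequentially"
    using filterlim_tendsto_pos_mult_at_top[OF lim \<open>\<kappa> > 0\<close> n] .
  then have a: "filterlim a at_top sequentially"
    by (rule filterlim_cong[THEN iffD1, rotated -1])
       (use n_pos in \<open>auto elim: eventually_mono\<close>)
  have "(\<lambda>N. a N / n N * (ln (Gamma (a N)) / a N - ln (a N)) + a N / n N * ln (a N / n N))
          \<longlonglongrightarrow> \<kappa> * -1 + \<kappa> * ln \<kappa>"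
    using \<open>\<kappa> > 0\<close> by (intro tendsto_intros lim filterlim_compose[OF ln_Gamma_asymp a]) auto
  then have "(\<lambda>N. a N / n N * (ln (Gamma (a N)) / a N - ln (a N)) + a N / n N * ln (a N / n N))
          \<longlonglongrightarrow> \<kappa> * ln \<kappa> - \<kappa>"
    by (simp add: add.commute)
  then show ?thesis
  proof (rule Lim_transform_eventually)
    show "\<forall>\<^sub>F N in sequentially. a N / n N * (ln (Gamma (a N)) / a N - ln (a N))
        + a N / n N * ln (a N / n N) = (ln (Gamma (a N)) - a N * ln (n N)) / n N"
      using n_pos ratio_pos
    proof eventually_elim
      case (elim N)
      then have "a N > 0" by (simp add: zero_less_divide_iff)
      then show ?case using elim by (simp add: ln_div field_simps)
    qed
  qed
qed

lemma nn_integral_gamma_kernel: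
  fixes a c :: real
  assumes "a > 0" "c > 0"
  shows "(\<integral>\<^sup>+y. ennreal (indicator {0<..} y * (exp (- c * y) * y powr (a - 1))) \<partial>lborel)
         = ennreal (Gamma a / c powr a)"
proof -
  let ?f = "\<lambda>t::real. ennreal (indicator {0<..} t * (exp (- t) * t powr (a - 1)))"
  have "ennreal (Gamma a) = (\<integral>\<^sup>+t. ennreal (indicator {0..} t * t powr (a - 1) / exp t) \<partial>lborel)"
    by (rule Gamma_conv_nn_integral_real) fact
  also have "\<dots> = integral\<^sup>N lborel ?f"
    by (intro nn_integral_cong_AE AE_I[of _ _ "{0}"])
       (auto simp: indicator_def exp_minus field_simps)
  also have "\<dots> = ennreal c * (\<integral>\<^sup>+y. ?f (0 + c * y) \<partial>lborel)"
    using assms by (subst nn_integral_real_affine[of _ c 0]) auto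
  also have "(\<integral>\<^sup>+y. ?f (0 + c * y) \<partial>lborel) = (\<integral>\<^sup>+y. ennreal (c powr (a - 1)) *
      ennreal (indicator {0<..} y * (exp (- c * y) * y powr (a - 1))) \<partial>lborel)"
    using assms by (intro nn_integral_cong)
      (auto simp: indicator_def zero_less_mult_iff powr_mult ennreal_mult[symmetric] mult_ac)
  also have "\<dots> = ennreal (c powr (a - 1)) *
      (\<integral>\<^sup>+y. ennreal (indicator {0<..} y * (exp (- c * y) * y powr (a - 1))) \<partial>lborel)"
    (is "_ = _ * ?I") by (intro nn_integral_cmult) auto
  also have "ennreal c * (ennreal (c powr (a - 1)) * ?I) = ennreal (c powr a) * ?I"
  proof -
    have "c * c powr (a - 1) = c powr a"
      using assms by (simp add: powr_diff)
    then show ?thesis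
      using assms by (simp add: mult.assoc[symmetric] ennreal_mult[symmetric])
  qed
  finally have "ennreal (1 / c powr a) * ennreal (Gamma a) = ennreal (1 / c powr a) * (ennreal (c powr a) * ?I)"
    by simp
  moreover have "ennreal (1 / c powr a) * ennreal (c powr a) = 1"
    using assms by (subst ennreal_mult[symmetric]) auto
  ultimately show ?thesis
    using assms by (simp add: mult.assoc[symmetric] ennreal_mult[symmetric])
qed


text \<open>
  This is \<open>\<kappa>\<close> times the function \<open>g\<close> at \<open>y / \<kappa>\<close>, as a real number for positive \<open>y\<close>.
\<close>

definition gamma_rate :: "real \<Rightarrow> real \<Rightarrow> real" where
  "gamma_rate \<kappa> y = y - \<kappa> - \<kappa> * ln (y / \<kappa>)"

lemma measurable_gamma_rate [measurable]: "gamma_rate \<kappa> \<in> borel_measurable borel"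
  unfolding gamma_rate_def by measurable

lemma gamma_density_inverse_scale:
  assumes "n > 0" "y > 0"
  shows "gamma_density a (inverse n) y = n powr a / Gamma a * (exp (- n * y) * y powr (a - 1))"
proof -
  have "inverse n powr a = 1 / n powr a"
    using assms by (simp add: powr_def ln_inverse exp_minus) (simp add: inverse_eq_divide)
  moreover have "- y / inverse n = - n * y"
    using assms by (simp add: field_simps)
  ultimately show ?thesis
    using assms by (simp add: gamma_density_def)
qed

text \<open>
  Multiplying a gamma density by the exponential of \<open>\<theta> n\<close> times the rate gives, up to a constant,
  another gamma kernel, whose scale is \<open>1 / ((1 - \<theta>) n)\<close> and whose shape is \<open>a - \<theta> n \<kappa>\<close>.
\<close>

lemma nn_integral_exp_gamma_rate:
  fixes a n \<kappa> \<theta> :: real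
  assumes Y: "distributed P lborel Y (\<lambda>y. ennreal (gamma_density a (inverse n) y))"
    and pos: "a > 0" "n > 0" "\<kappa> > 0" and \<theta>: "\<theta> < 1" "a - \<theta> * n * \<kappa> > 0"
  shows "(\<integral>\<^sup>+\<omega>. ennreal (exp (\<theta> * n * gamma_rate \<kappa> (Y \<omega>))) \<partial>P) =
    ennreal (exp (- \<theta> * n * \<kappa> * (1 - ln \<kappa>)) * n powr a / Gamma a *
      (Gamma (a - \<theta> * n * \<kappa>) / ((1 - \<theta>) * n) powr (a - \<theta> * n * \<kappa>)))"
proof -
  define A where "A = a - \<theta> * n * \<kappa>"
  define C where "C = exp (- \<theta> * n * \<kappa> * (1 - ln \<kappa>)) * n powr a / Gamma a"
  have C: "C \<ge> 0"
    using pos by (auto simp: C_def intro!: divide_nonneg_nonneg Gamma_real_nonneg)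
  have meas: "(\<lambda>y. ennreal (exp (\<theta> * n * gamma_rate \<kappa> y))) \<in> borel_measurable lborel"
    by measurable
  have density: "gamma_density a (inverse n) y * exp (\<theta> * n * gamma_rate \<kappa> y) =
      C * (indicator {0<..} y * (exp (- ((1 - \<theta>) * n) * y) * y powr (A - 1)))" for y
  proof (cases "y > 0")
    case True
    have e: "exp (- n * y) * exp (\<theta> * n * gamma_rate \<kappa> y) =
        exp (- \<theta> * n * \<kappa> * (1 - ln \<kappa>)) * exp (- ((1 - \<theta>) * n) * y) * exp (- (\<theta> * n * \<kappa>) * ln y)"
      using True pos by (simp add: gamma_rate_def ln_div exp_add[symmetric] algebra_simps)
    have Y': "y powr (A - 1) = y powr (a - 1) * exp (- (\<theta> * n * \<kappa>) * ln y)"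
      using True by (simp add: powr_def exp_add[symmetric] A_def algebra_simps)
    have "(exp (- n * y) * y powr (a - 1)) * exp (\<theta> * n * gamma_rate \<kappa> y) =
        y powr (a - 1) * (exp (- n * y) * exp (\<theta> * n * gamma_rate \<kappa> y))"
      by (simp only: mult_ac)
    also have "\<dots> = exp (- \<theta> * n * \<kappa> * (1 - ln \<kappa>)) * (exp (- ((1 - \<theta>) * n) * y) * y powr (A - 1))"
      unfolding e Y' by (simp only: mult_ac)
    finally have "(exp (- n * y) * y powr (a - 1)) * exp (\<theta> * n * gamma_rate \<kappa> y) = \<dots>" .
    then show ?thesis
      using True pos by (simp add: gamma_density_inverse_scale C_def)
  qed (simp add: gamma_density_def)
  have "(\<integral>\<^sup>+\<omega>. ennreal (exp (\<theta> * n * gamma_rate \<kappa> (Y \<omega>))) \<partial>P) =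
      (\<integral>\<^sup>+y. ennreal (gamma_density a (inverse n) y) * ennreal (exp (\<theta> * n * gamma_rate \<kappa> y)) \<partial>lborel)"
    by (rule distributed_nn_integral[OF Y meas, symmetric])
  also have "\<dots> = (\<integral>\<^sup>+y. ennreal C *
      ennreal (indicator {0<..} y * (exp (- ((1 - \<theta>) * n) * y) * y powr (A - 1))) \<partial>lborel)"
    using C by (intro nn_integral_cong) (simp add: ennreal_mult''[symmetric] density)
  also have "\<dots> = ennreal C * ennreal (Gamma A / ((1 - \<theta>) * n) powr A)"
    using \<theta> pos by (subst nn_integral_cmult, measurable, subst nn_integral_gamma_kernel) (auto simp: A_def)
  also have "\<dots> = ennreal (C * (Gamma A / ((1 - \<theta>) * n) powr A))"
    using C by (intro ennreal_mult'[symmetric])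
  finally show ?thesis by (simp add: C_def A_def)
qed

text \<open>
  The Chernoff ingredient of the upper bound. In the logarithm of the exact value all terms of
  order \<open>n\<close> cancel by Stirling's formula. The restriction \<open>\<theta> < 1\<close> keeps the tilted gamma kernel
  integrable.
\<close>

lemma gamma_exp_rate_subexponential:
  fixes a n :: "nat \<Rightarrow> real"
  assumes Y: "\<forall>\<^sub>F N in sequentially.
      distributed (P N) lborel (Y N) (\<lambda>y. ennreal (gamma_density (a N) (inverse (n N)) y))"
    and n: "filterlim n at_top sequentially"
    and lim: "(\<lambda>N. a N / n N) \<longlonglongrightarrow> \<kappa>" and \<kappa>: "\<kappa> > 0" and \<theta>: "\<theta> < 1" and "\<epsilon> > 0"
  shows "\<forall>\<^sub>F N in sequentially.
      (\<integral>\<^sup>+\<omega>. ennreal (exp (\<theta> * n N * gamma_rate \<kappa> (Y N \<omega>))) \<partial>P N) \<le> ennreal (exp (n N * \<epsilon>))"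
proof -
  define A where "A N = a N - \<theta> * n N * \<kappa>" for N
  define \<kappa>' where "\<kappa>' = (1 - \<theta>) * \<kappa>"
  have \<kappa>': "\<kappa>' > 0" using \<kappa> \<theta> by (simp add: \<kappa>'_def)
  \<comment> \<open>The logarithm of the exponential moment, divided by \<open>n N\<close>.\<close>
  define L where "L N = - \<theta> * \<kappa> * (1 - ln \<kappa>) - (ln (Gamma (a N)) - a N * ln (n N)) / n N +
     (ln (Gamma (A N)) - A N * ln (n N)) / n N - A N / n N * ln (1 - \<theta>)" for N
  have n_pos: "\<forall>\<^sub>F N in sequentially. n N > 0"
    using n by (rule filterlim_at_top_dense[THEN iffD1, rule_format])
  have "(\<lambda>N. a N / n N - \<theta> * \<kappa>) \<longlonglongrightarrow> \<kappa> - \<theta> * \<kappa>"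
    by (intro tendsto_intros lim)
  then have limA: "(\<lambda>N. A N / n N) \<longlonglongrightarrow> \<kappa>'"
    unfolding \<kappa>'_def left_diff_distrib mult_1
    by (rule Lim_transform_eventually)
       (use n_pos in eventually_elim, simp add: A_def diff_divide_distrib)
  have "L \<longlonglongrightarrow> - \<theta> * \<kappa> * (1 - ln \<kappa>) - (\<kappa> * ln \<kappa> - \<kappa>) + (\<kappa>' * ln \<kappa>' - \<kappa>') - \<kappa>' * ln (1 - \<theta>)"
    unfolding L_def using \<kappa> \<kappa>'
    by (intro tendsto_intros limA ln_Gamma_scaled_asymp[OF n lim] ln_Gamma_scaled_asymp[OF n limA])
  also have "- \<theta> * \<kappa> * (1 - ln \<kappa>) - (\<kappa> * ln \<kappa> - \<kappa>) + (\<kappa>' * ln \<kappa>' - \<kappa>') - \<kappa>' * ln (1 - \<theta>) = 0"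
  proof -
    have "ln \<kappa>' = ln (1 - \<theta>) + ln \<kappa>"
      using \<kappa> \<theta> by (simp add: \<kappa>'_def ln_mult)
    then show ?thesis by (simp add: \<kappa>'_def algebra_simps)
  qed
  finally have "\<forall>\<^sub>F N in sequentially. L N < \<epsilon>"
    using \<open>\<epsilon> > 0\<close> by (rule order_tendstoD(2))
  moreover have "\<forall>\<^sub>F N in sequentially. a N / n N > 0" "\<forall>\<^sub>F N in sequentially. A N / n N > 0"
    using order_tendstoD(1)[OF lim \<kappa>] order_tendstoD(1)[OF limA \<kappa>'] by auto
  ultimately show ?thesis
    using Y n_pos
  proof eventually_elim
    case (elim N)
    then have pos: "n N > 0" "a N > 0" "A N > 0"
      by (auto simp: zero_less_divide_iff)
    have "(\<integral>\<^sup>+\<omega>. ennreal (exp (\<theta> * n N * gamma_rate \<kappa> (Y N \<omega>))) \<partial>P N) =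
      ennreal (exp (- \<theta> * n N * \<kappa> * (1 - ln \<kappa>)) * n N powr a N / Gamma (a N) *
        (Gamma (A N) / ((1 - \<theta>) * n N) powr A N))"
      using elim pos \<kappa> \<theta> unfolding A_def by (intro nn_integral_exp_gamma_rate) auto
    also have "exp (- \<theta> * n N * \<kappa> * (1 - ln \<kappa>)) * n N powr a N / Gamma (a N) *
        (Gamma (A N) / ((1 - \<theta>) * n N) powr A N) = exp (n N * L N)"
    proof -
      have "Gamma (a N) = exp (ln (Gamma (a N)))" "Gamma (A N) = exp (ln (Gamma (A N)))"
        using pos by auto
      moreover have "ln ((1 - \<theta>) * n N) = ln (1 - \<theta>) + ln (n N)"
        using pos \<theta> by (simp add: ln_mult)
      then have "n N * L N = - \<theta> * n N * \<kappa> * (1 - ln \<kappa>) + a N * ln (n N) - ln (Gamma (a N)) +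
          (ln (Gamma (A N)) - A N * ln ((1 - \<theta>) * n N))"
        using pos by (simp add: L_def field_simps)
      ultimately show ?thesis
        using pos \<theta> by (simp only: powr_def exp_add exp_diff) simp
    qed
    finally show ?case
      using elim pos by simp
  qed
qed

lemma gamma_interval_prob_ge:
  fixes a n p q :: real
  assumes "prob_space P"
    and Y: "distributed P lborel Y (\<lambda>y. ennreal (gamma_density a (inverse n) y))"
    and "a \<ge> 1" "n > 0" "0 < p" "p < q"
  shows "(q - p) * (n powr a / Gamma a * exp (- n * q) * p powr (a - 1)) \<le>
         measure P {\<omega> \<in> space P. p \<le> Y \<omega> \<and> Y \<omega> \<le> q}"
proof -
  interpret prob_space P by fact
  define c where "c = n powr a / Gamma a * exp (- n * q) * p powr (a - 1)"
  have c: "c \<ge> 0"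
    using assms by (auto simp: c_def intro!: mult_nonneg_nonneg divide_nonneg_nonneg Gamma_real_nonneg)
  have "ennreal ((q - p) * c) = (\<integral>\<^sup>+y. ennreal c * indicator {p..q} y \<partial>lborel)"
    using assms c by (subst nn_integral_cmult) (auto simp: ennreal_mult'[symmetric] mult.commute)
  also have "\<dots> \<le> (\<integral>\<^sup>+y. ennreal (gamma_density a (inverse n) y) * indicator {p..q} y \<partial>lborel)"
  proof (intro nn_integral_mono)
    fix y
    have "c \<le> gamma_density a (inverse n) y" if "p \<le> y" "y \<le> q"
    proof -
      have "exp (- n * q) * p powr (a - 1) \<le> exp (- n * y) * y powr (a - 1)"
        using that assms by (intro mult_mono powr_mono2) auto
      then have "n powr a / Gamma a * (exp (- n * q) * p powr (a - 1)) \<le>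
          n powr a / Gamma a * (exp (- n * y) * y powr (a - 1))"
        using assms by (intro mult_left_mono divide_nonneg_nonneg Gamma_real_nonneg) auto
      then show ?thesis
        using that assms by (simp only: gamma_density_inverse_scale c_def mult.assoc)
    qed
    then show "ennreal c * indicator {p..q} y \<le> ennreal (gamma_density a (inverse n) y) * indicator {p..q} y"
      by (auto simp: indicator_def ennreal_leI)
  qed
  also have "\<dots> = emeasure P (Y -` {p..q} \<inter> space P)"
    by (rule distributed_emeasure[OF Y, symmetric]) simp
  also have "Y -` {p..q} \<inter> space P = {\<omega> \<in> space P. p \<le> Y \<omega> \<and> Y \<omega> \<le> q}"
    by auto
  finally show ?thesis
    using c assms unfolding c_def[symmetric] by (simp add: emeasure_eq_measure)
qed

text \<open>
  The lower bound in one coordinate: on \<open>[p, q]\<close> the density is at least what the factors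
  \<open>p powr (a - 1)\<close> and \<open>exp (- n q)\<close> give, and the price of using different ends of the interval is
  \<open>n (q - p)\<close> in the exponent.
\<close>

lemma gamma_interval_prob_exp_ge:
  fixes a n :: "nat \<Rightarrow> real"
  assumes P: "\<And>N. prob_space (P N)"
    and Y: "\<forall>\<^sub>F N in sequentially.
      distributed (P N) lborel (Y N) (\<lambda>y. ennreal (gamma_density (a N) (inverse (n N)) y))"
    and n: "filterlim n at_top sequentially"
    and lim: "(\<lambda>N. a N / n N) \<longlonglongrightarrow> \<kappa>" and \<kappa>: "\<kappa> > 0" and pq: "0 < p" "p < q" and "\<epsilon> > 0"
  shows "\<forall>\<^sub>F N in sequentially. exp (- n N * (gamma_rate \<kappa> p + (q - p) + \<epsilon>)) \<le>
           measure (P N) {\<omega> \<in> space (P N). p \<le> Y N \<omega> \<and> Y N \<omega> \<le> q}"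
proof -
  \<comment> \<open>The logarithm of the lower bound for the probability, divided by \<open>n N\<close>.\<close>
  define L where "L N = ln (q - p) / n N - (ln (Gamma (a N)) - a N * ln (n N)) / n N - q +
     (a N / n N - 1 / n N) * ln p" for N
  have n_pos: "\<forall>\<^sub>F N in sequentially. n N > 0"
    using n by (rule filterlim_at_top_dense[THEN iffD1, rule_format])
  have "filterlim (\<lambda>N. a N / n N * n N) at_top sequentially"
    using filterlim_tendsto_pos_mult_at_top[OF lim \<open>\<kappa> > 0\<close> n] .
  then have "filterlim a at_top sequentially"
    by (rule filterlim_cong[THEN iffD1, rotated -1])
       (use n_pos in \<open>auto elim: eventually_mono\<close>)
  then have "\<forall>\<^sub>F N in sequentially. a N \<ge> 1"
    by (rule filterlim_at_top[THEN iffD1, rule_format])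
  moreover have "L \<longlonglongrightarrow> 0 - (\<kappa> * ln \<kappa> - \<kappa>) - q + (\<kappa> - 0) * ln p"
    unfolding L_def using \<kappa>
    by (intro tendsto_intros lim ln_Gamma_scaled_asymp[OF n lim]
        tendsto_divide_0[OF tendsto_const] filterlim_at_top_imp_at_infinity n)
  then have "L \<longlonglongrightarrow> - (gamma_rate \<kappa> p + (q - p))"
    using pq \<kappa> by (simp add: gamma_rate_def ln_div algebra_simps)
  then have "\<forall>\<^sub>F N in sequentially. - (gamma_rate \<kappa> p + (q - p) + \<epsilon>) < L N"
    using \<open>\<epsilon> > 0\<close> by (intro order_tendstoD(1)) auto
  ultimately show ?thesis
    using Y n_pos
  proof eventually_elim
    case (elim N)
    have "exp (n N * - (gamma_rate \<kappa> p + (q - p) + \<epsilon>)) \<le> exp (n N * L N)"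
      unfolding exp_le_cancel_iff using elim by (intro mult_left_mono) auto
    also have "\<dots> = (q - p) * (n N powr a N / Gamma (a N) * exp (- n N * q) * p powr (a N - 1))"
    proof -
      have "Gamma (a N) = exp (ln (Gamma (a N)))" "q - p = exp (ln (q - p))"
        using elim pq by auto
      moreover have "n N * L N = ln (q - p) + (a N * ln (n N) - ln (Gamma (a N)) +
          - n N * q + (a N - 1) * ln p)"
        using elim by (simp add: L_def field_simps)
      ultimately show ?thesis
        using elim pq by (simp only: powr_def exp_add exp_diff) simp
    qed
    also have "\<dots> \<le> measure (P N) {\<omega> \<in> space (P N). p \<le> Y N \<omega> \<and> Y N \<omega> \<le> q}"
      using elim pq P by (intro gamma_interval_prob_ge) auto
    finally show ?case by (simp only: mult_minus_left mult_minus_right)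
  qed
qed

section \<open>Moment sequences and the moment topology\<close>

lemma borel_prob_real_distribution: "borel_prob \<mu> \<Longrightarrow> real_distribution \<mu>"
  by (simp add: borel_prob_def real_distribution_def real_distribution_axioms_def)

lemma moment_0: "borel_prob \<mu> \<Longrightarrow> moment \<mu> 0 = 1"
  by (simp add: moment_def borel_prob_def prob_space.prob_space)

lemma char_moment_expansion_error:
  assumes "borel_prob \<mu>" "moments_finite \<mu>"
  shows "cmod (char \<mu> t - (\<Sum>k\<le>2*j. ((\<i> * t) ^ k / fact k) * moment \<mu> k))
           \<le> 2 * \<bar>t\<bar> ^ (2*j) / fact (2*j) * moment \<mu> (2*j)"
proof -
  interpret real_distribution \<mu>
    by (rule borel_prob_real_distribution) fact
  have "\<bar>x :: real\<bar> ^ (2*j) = x ^ (2*j)" for x by (simp add: power_mult)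
  then show ?thesis
    using char_approx1[of "2*j" t] assms(2) by (simp add: moments_finite_def moment_def)
qed

text \<open>
  Two measures with the same moments have the same Taylor expansion of the characteristic function.
  The growth of the even moments makes the remainders vanish everywhere, so the characteristic
  functions coincide and the uniqueness theorem of Levy applies.
\<close>

lemma moment_determinate_if_moments_le_power:
  assumes \<mu>: "borel_prob \<mu>" "moments_finite \<mu>" and bound: "\<And>j. moment \<mu> (2*j) \<le> C ^ (2*j)"
  shows "moment_determinate \<mu>"
  unfolding moment_determinate_def
proof (intro allI impI)
  fix \<nu>
  assume \<nu>: "borel_prob \<nu> \<and> moments_finite \<nu> \<and> (\<forall>k\<ge>1. moment \<nu> k = moment \<mu> k)"
  have same: "moment \<nu> k = moment \<mu> k" for k
    using \<nu> \<mu> by (cases k) (auto simp: moment_0)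
  have "char \<nu> t = char \<mu> t" for t
  proof -
    have "cmod (char \<nu> t - char \<mu> t) \<le> 4 * ((t * C) ^ (2*j) / fact (2*j))" for j
    proof -
      let ?S = "\<Sum>k\<le>2*j. ((\<i> * t) ^ k / fact k) * moment \<mu> k"
      let ?e = "2 * \<bar>t\<bar> ^ (2*j) / fact (2*j) * moment \<mu> (2*j)"
      have "cmod (char \<nu> t - ?S) \<le> ?e" "cmod (char \<mu> t - ?S) \<le> ?e"
        using char_moment_expansion_error[of \<nu> t j] char_moment_expansion_error[of \<mu> t j] \<nu> \<mu> same
        by auto
      then have "cmod (char \<nu> t - char \<mu> t) \<le> 2 * ?e"
        using norm_triangle_ineq4[of "char \<nu> t - ?S" "char \<mu> t - ?S"] by simp
      also have "\<dots> \<le> 2 * (2 * \<bar>t\<bar> ^ (2*j) / fact (2*j) * C ^ (2*j))"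
        by (intro mult_left_mono bound) auto
      also have "\<dots> = 4 * ((t * C) ^ (2*j) / fact (2*j))"
        by (simp add: power_mult_distrib power_mult)
      finally show ?thesis .
    qed
    moreover have "(\<lambda>j. 4 * ((t * C) ^ (2*j) / fact (2*j))) \<longlonglongrightarrow> 4 * 0"
    proof (intro tendsto_mult tendsto_const)
      have "(\<lambda>n. inverse (fact n) * (t * C) ^ n) \<longlonglongrightarrow> 0"
        using summable_LIMSEQ_zero[OF summable_exp] .
      then have "((\<lambda>n. inverse (fact n) * (t * C) ^ n) \<circ> (\<lambda>j. 2 * j)) \<longlonglongrightarrow> 0"
        by (rule LIMSEQ_subseq_LIMSEQ) (simp add: strict_mono_def)
      then show "(\<lambda>j. (t * C) ^ (2*j) / fact (2*j)) \<longlonglongrightarrow> 0"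
        by (simp add: o_def divide_inverse mult.commute)
    qed
    ultimately have "cmod (char \<nu> t - char \<mu> t) \<le> 4 * 0"
      by (intro LIMSEQ_le_const) auto
    then show ?thesis by simp
  qed
  then show "\<nu> = \<mu>"
    using \<nu> \<mu> by (intro Levy_uniqueness borel_prob_real_distribution) auto
qed

text \<open>
  Since \<open>x \<ge> 0\<close>, cutting \<open>x\<close> at \<open>R\<close> changes \<open>x ^ r\<close> only where \<open>x > R\<close>, where \<open>x ^ r \<le> x ^ (r + 1) / R\<close>. This
  uniform integrability lets moments pass to weak limits.
\<close>

lemma truncated_moment_error:
  fixes R :: real
  assumes \<mu>: "borel_prob \<mu>" "moments_finite \<mu>" and supp: "AE x in \<mu>. 0 \<le> x" and R: "R > 0"
  shows "\<bar>moment \<mu> r - (\<integral>x. (max 0 (min x R)) ^ r \<partial>\<mu>)\<bar> \<le> moment \<mu> (Suc r) / R"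
proof -
  interpret real_distribution \<mu>
    by (rule borel_prob_real_distribution) fact
  have int: "integrable \<mu> (\<lambda>x. x ^ k)" for k
    using \<mu> by (simp add: moments_finite_def)
  have [measurable]: "(\<lambda>x::real. (max 0 (min x R)) ^ r) \<in> borel_measurable borel"
    by measurable
  have int': "integrable \<mu> (\<lambda>x. (max 0 (min x R)) ^ r)"
    by (rule integrable_const_bound[where B = "R ^ r"])
      (use R in \<open>auto intro!: AE_I2 power_mono\<close>)
  have "\<bar>moment \<mu> r - (\<integral>x. (max 0 (min x R)) ^ r \<partial>\<mu>)\<bar> = \<bar>\<integral>x. x ^ r - (max 0 (min x R)) ^ r \<partial>\<mu>\<bar>"
    using int int' by (simp add: moment_def)
  also have "\<dots> \<le> (\<integral>x. x ^ Suc r / R \<partial>\<mu>)"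
  proof (rule order.trans[OF integral_abs_bound], rule integral_mono_AE)
    show "AE x in \<mu>. \<bar>x ^ r - (max 0 (min x R)) ^ r\<bar> \<le> x ^ Suc r / R"
      using supp
    proof eventually_elim
      case (elim x)
      show ?case
      proof (cases "x \<le> R")
        case True
        then show ?thesis using elim R by (simp add: min_absorb1 max_absorb2 del: power_Suc)
      next
        case False
        then have "R ^ r \<le> x ^ r" "x ^ r * R \<le> x ^ r * x" "0 \<le> R ^ r"
          using R elim by (auto intro!: power_mono mult_left_mono)
        then have "\<bar>x ^ r - R ^ r\<bar> \<le> x ^ r" "x ^ r \<le> x ^ r * x / R"
          using R by (linarith, simp add: pos_le_divide_eq)
        then have le: "\<bar>x ^ r - R ^ r\<bar> \<le> x ^ Suc r / R"
          by (simp add: mult.commute)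
        have "max 0 (min x R) = R" using False R by simp
        with le show ?thesis by (simp only:)
      qed
    qed
  qed (use int int' in \<open>auto intro!: integrable_abs integrable_diff simp del: power_Suc\<close>)
  also have "\<dots> = moment \<mu> (Suc r) / R"
    by (simp add: moment_def del: power_Suc)
  finally show ?thesis .
qed

lemma tight_if_bounded_first_moment:
  assumes \<mu>: "\<And>n. borel_prob (\<mu> n)" "\<And>n. moments_finite (\<mu> n)" "\<And>n. AE x in \<mu> n. 0 \<le> x"
    and bound: "\<And>n. moment (\<mu> n) 1 \<le> B"
  shows "tight \<mu>"
  unfolding tight_def
proof (intro conjI allI impI)
  show "real_distribution (\<mu> n)" for n
    by (rule borel_prob_real_distribution) fact
  fix \<epsilon> :: real
  assume \<epsilon>: "\<epsilon> > 0"
  define b where "b = (\<bar>B\<bar> + 1) / \<epsilon>"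
  have b: "b > 0" using \<epsilon> by (auto simp: b_def intro!: divide_pos_pos)
  have "measure (\<mu> n) {-1<..b} > 1 - \<epsilon>" for n
  proof -
    interpret real_distribution "\<mu> n"
      by (rule borel_prob_real_distribution) fact
    have "prob {x \<in> space (\<mu> n). x \<ge> b} \<le> moment (\<mu> n) 1 / b"
      unfolding moment_def power_one_right
      using \<mu>(2)[of n] b \<mu>(3)[of n]
      by (intro integral_Markov_inequality_measure[where A = "{}"]) (auto simp: moments_finite_def dest: spec[of _ 1])
    also have "\<dots> \<le> \<bar>B\<bar> / b"
      using b bound[of n] by (intro divide_right_mono) auto
    also have "\<dots> < \<epsilon>"
      using \<epsilon> by (simp add: b_def field_simps)
    finally have "prob {x \<in> space (\<mu> n). x \<ge> b} < \<epsilon>" .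
    moreover have "prob (space (\<mu> n) - {x \<in> space (\<mu> n). x \<ge> b}) = 1 - prob {x \<in> space (\<mu> n). x \<ge> b}"
      by (rule prob_compl) measurable
    moreover have "prob (space (\<mu> n) - {x \<in> space (\<mu> n). x \<ge> b}) \<le> prob {-1<..b}"
      using \<mu>(3)[of n] by (intro finite_measure_mono_AE) (auto elim!: eventually_mono)
    ultimately show ?thesis by linarith
  qed
  then show "\<exists>a b. a < b \<and> (\<forall>n. measure (\<mu> n) {a<..b} > 1 - \<epsilon>)"
    using b by (intro exI[of _ "-1"] exI[of _ b]) auto
qed

text \<open>
  Bounded first moments give tightness, hence a weakly convergent subsequence. All its moments
  converge to those of the limit because each moment is controlled at infinity by the next one.
\<close>

theorem moment_sequence_limit:
  fixes M :: "nat \<Rightarrow> real"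
  assumes \<mu>: "\<And>n. borel_prob (\<mu> n)" "\<And>n. moments_finite (\<mu> n)" "\<And>n. AE x in \<mu> n. 0 \<le> x"
    and lim: "\<And>r. (\<lambda>n. moment (\<mu> n) r) \<longlonglongrightarrow> M r"
  obtains \<nu> where "borel_prob \<nu>" "moments_finite \<nu>" "AE x in \<nu>. 0 \<le> x" "\<And>r. moment \<nu> r = M r"
proof -
  have "\<exists>B. \<forall>n. moment (\<mu> n) r \<le> B" for r
    using convergent_imp_Bseq[of "\<lambda>n. moment (\<mu> n) r"] lim[of r]
    by (auto simp: convergent_def Bseq_def abs_le_iff)
  then obtain B where B: "\<And>n r. moment (\<mu> n) r \<le> B r"
    by metis
  have "tight \<mu>"
    using \<mu> B[of _ 1] by (rule tight_if_bounded_first_moment)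
  from tight_imp_convergent_subsubsequence[OF this strict_mono_id]
  obtain \<rho> \<nu> where \<rho>: "strict_mono (\<rho> :: nat \<Rightarrow> nat)" and \<nu>: "real_distribution \<nu>"
    and weak: "weak_conv_m (\<mu> \<circ> \<rho>) \<nu>"
    by (auto simp: o_def)
  interpret \<nu>: real_distribution \<nu> by fact
  have rd: "real_distribution ((\<mu> \<circ> \<rho>) n)" for n
    using \<mu>(1) by (simp add: borel_prob_real_distribution)
  have weak_int: "(\<lambda>n. \<integral>x. f x \<partial>\<mu> (\<rho> n)) \<longlonglongrightarrow> (\<integral>x. f x \<partial>\<nu>)"
    if "continuous_on UNIV f" "\<And>x. norm (f x) \<le> K" for f :: "real \<Rightarrow> real" and K
    using weak_conv_imp_integral_bdd_continuous_conv[OF rd \<nu> weak, of f K] that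
    by (auto simp: o_def continuous_on_eq_continuous_at)
  have \<nu>_prob: "borel_prob \<nu>"
    using \<nu> by (simp add: borel_prob_def real_distribution_def real_distribution_axioms_def)
  have supp: "AE x in \<nu>. 0 \<le> x"
  proof -
    let ?f = "\<lambda>x::real. min 1 (max 0 (- x))"
    have cont: "continuous_on UNIV ?f"
      by (intro continuous_intros)
    have "(\<lambda>n. \<integral>x. ?f x \<partial>\<mu> (\<rho> n)) \<longlonglongrightarrow> (\<integral>x. ?f x \<partial>\<nu>)"
      by (rule weak_int[OF cont, of 1]) auto
    moreover have "(\<integral>x. ?f x \<partial>\<mu> n) = 0" for n
      using \<mu>(3)[of n] by (intro integral_eq_zero_AE) (auto elim!: eventually_mono)
    ultimately have "(\<integral>x. ?f x \<partial>\<nu>) = 0"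
      by (simp add: LIMSEQ_const_iff)
    moreover have "integrable \<nu> ?f"
      by (rule \<nu>.integrable_const_bound[where B = 1]) auto
    ultimately have "AE x in \<nu>. ?f x = 0"
      by (subst (asm) integral_nonneg_eq_0_iff_AE) auto
    then show ?thesis by eventually_elim (auto simp: min_def max_def split: if_splits)
  qed
  \<comment> \<open>Bounded continuous truncations of the power functions, which see the weak convergence.\<close>
  define h where "h R r x = (max 0 (min x R)) ^ r" for R x :: real and r :: nat
  have h_cont: "continuous_on UNIV (h R r)" for R r
    unfolding h_def by (intro continuous_intros)
  have h_bound: "norm (h R r x) \<le> R ^ r" if "R > 0" for R r x
    using that by (auto simp: h_def intro!: power_mono)
  have h_meas [measurable]: "h R r \<in> borel_measurable borel" for R r
    using h_cont by (rule borel_measurable_continuous_onI)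
  have h_lim: "(\<lambda>n. \<integral>x. h R r x \<partial>\<mu> (\<rho> n)) \<longlonglongrightarrow> (\<integral>x. h R r x \<partial>\<nu>)" if "R > 0" for R r
    using h_cont h_bound[OF that] by (rule weak_int)
  have lim\<rho>: "(\<lambda>n. moment (\<mu> (\<rho> n)) r) \<longlonglongrightarrow> M r" for r
    using LIMSEQ_subseq_LIMSEQ[OF lim \<rho>] by (simp add: o_def)
  have err: "\<bar>M r - (\<integral>x. h R r x \<partial>\<nu>)\<bar> \<le> M (Suc r) / R" if "R > 0" for R r
  proof (rule LIMSEQ_le)
    show "(\<lambda>n. \<bar>moment (\<mu> (\<rho> n)) r - (\<integral>x. h R r x \<partial>\<mu> (\<rho> n))\<bar>) \<longlonglongrightarrow> \<bar>M r - (\<integral>x. h R r x \<partial>\<nu>)\<bar>"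
      by (intro tendsto_intros lim\<rho> h_lim that)
    show "(\<lambda>n. moment (\<mu> (\<rho> n)) (Suc r) / R) \<longlonglongrightarrow> M (Suc r) / R"
      using that by (intro tendsto_intros lim\<rho>) auto
    show "\<exists>N. \<forall>n\<ge>N. \<bar>moment (\<mu> (\<rho> n)) r - (\<integral>x. h R r x \<partial>\<mu> (\<rho> n))\<bar> \<le> moment (\<mu> (\<rho> n)) (Suc r) / R"
      unfolding h_def using \<mu> that by (intro exI allI impI truncated_moment_error)
  qed
  have int: "integrable \<nu> (\<lambda>x. x ^ r)" for r
  proof (rule integrableI_bounded)
    have hi: "integrable \<nu> (h R r)" if "R > 0" for R
      using h_bound[OF that] by (intro \<nu>.integrable_const_bound[where B = "R ^ r"]) auto
    have "(\<integral>\<^sup>+x. ennreal (norm (x ^ r)) \<partial>\<nu>) = (\<integral>\<^sup>+x. liminf (\<lambda>n. ennreal (h (real (Suc n)) r x)) \<partial>\<nu>)"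
      using supp
    proof (intro nn_integral_cong_AE, eventually_elim)
      case (elim x)
      have "eventually (\<lambda>n. ennreal (h (real (Suc n)) r x) = ennreal (norm (x ^ r))) sequentially"
        using eventually_ge_at_top[of "nat \<lceil>x\<rceil>"]
        by eventually_elim (use elim in \<open>simp add: h_def min_absorb1 max_absorb2\<close>)
      then have "(\<lambda>n. ennreal (h (real (Suc n)) r x)) \<longlonglongrightarrow> ennreal (norm (x ^ r))"
        by (rule tendsto_eventually)
      then show ?case
        by (simp add: lim_imp_Liminf)
    qed
    also have "\<dots> \<le> liminf (\<lambda>n. \<integral>\<^sup>+x. ennreal (h (real (Suc n)) r x) \<partial>\<nu>)"
      by (rule nn_integral_liminf) auto
    also have "\<dots> \<le> liminf (\<lambda>n. ennreal (M r + \<bar>M (Suc r)\<bar>))"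
    proof (intro Liminf_mono always_eventually allI)
      fix n
      have "(\<integral>x. h (real (Suc n)) r x \<partial>\<nu>) \<le> M r + M (Suc r) / real (Suc n)"
        using err[of "real (Suc n)" r] by (simp add: abs_le_iff)
      also have "M (Suc r) / real (Suc n) \<le> \<bar>M (Suc r)\<bar> / 1"
        by (intro frac_le) auto
      finally show "(\<integral>\<^sup>+x. ennreal (h (real (Suc n)) r x) \<partial>\<nu>) \<le> ennreal (M r + \<bar>M (Suc r)\<bar>)"
        by (subst nn_integral_eq_integral) (auto intro!: hi ennreal_leI, auto simp: h_def)
    qed
    also have "\<dots> < \<infinity>"
      by (simp add: Liminf_const)
    finally show "(\<integral>\<^sup>+x. ennreal (norm (x ^ r)) \<partial>\<nu>) < \<infinity>" .
  qed auto
  then have \<nu>_fin: "moments_finite \<nu>"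
    by (simp add: moments_finite_def)
  have "moment \<nu> r = M r" for r
  proof -
    have le: "\<bar>moment \<nu> r - M r\<bar> \<le> (moment \<nu> (Suc r) + M (Suc r)) / real (Suc n)" for n
    proof -
      define I where "I = (\<integral>x. h (real (Suc n)) r x \<partial>\<nu>)"
      have "\<bar>M r - I\<bar> \<le> M (Suc r) / real (Suc n)"
        unfolding I_def by (rule err) simp
      moreover have "\<bar>moment \<nu> r - I\<bar> \<le> moment \<nu> (Suc r) / real (Suc n)"
        unfolding I_def h_def by (rule truncated_moment_error[OF \<nu>_prob \<nu>_fin supp]) simp
      ultimately show ?thesis
        unfolding add_divide_distrib by linarith
    qed
    have "(\<lambda>n. (moment \<nu> (Suc r) + M (Suc r)) / real (Suc n)) \<longlonglongrightarrow> 0"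
      by (rule LIMSEQ_Suc[OF lim_const_over_n])
    then have "\<bar>moment \<nu> r - M r\<bar> \<le> 0"
      by (rule LIMSEQ_le_const) (use le in blast)
    then show ?thesis by simp
  qed
  from that[OF \<nu>_prob \<nu>_fin supp this] show ?thesis .
qed

interpretation M_md: Metric_space M_md moment_dist
  by (rule Metric_space_moment_dist)

lemma topspace_moment_topology [simp]: "topspace moment_topology = M_md"
  by (simp add: moment_topology_def)

text \<open>
  Dominated convergence in the series that defines the distance.
\<close>

lemma limitin_moment_topology:
  assumes "\<And>n. \<sigma> n \<in> M_md" "\<nu> \<in> M_md" "\<And>k. (\<lambda>n. moment (\<sigma> n) k) \<longlonglongrightarrow> moment \<nu> k"
  shows "limitin moment_topology \<sigma> \<nu> sequentially"
proof -
  let ?a = "\<lambda>k n. (1/2) ^ Suc k *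
     (\<bar>moment (\<sigma> n) (Suc k) - moment \<nu> (Suc k)\<bar> / (1 + \<bar>moment (\<sigma> n) (Suc k) - moment \<nu> (Suc k)\<bar>))"
  have "(\<lambda>n. suminf (\<lambda>k. ?a k n)) \<longlonglongrightarrow> (\<Sum>k::nat. 0::real)"
  proof (rule tannerys_theorem[THEN conjunct2, THEN conjunct2])
    fix k
    have "(\<lambda>n. ?a k n) \<longlonglongrightarrow> (1/2) ^ Suc k *
       (\<bar>moment \<nu> (Suc k) - moment \<nu> (Suc k)\<bar> / (1 + \<bar>moment \<nu> (Suc k) - moment \<nu> (Suc k)\<bar>))"
      by (intro tendsto_intros assms) auto
    then show "(\<lambda>n. ?a k n) \<longlonglongrightarrow> 0" by simp
  next
    show "\<forall>\<^sub>F (k, n) in at_top \<times>\<^sub>F sequentially. norm (?a k n) \<le> (1/2) ^ Suc k"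
      by (rule always_eventually) (auto simp: abs_mult divide_simps)
    show "summable (\<lambda>k. (1/2 :: real) ^ Suc k)"
      by (simp only: summable_Suc_iff) (simp add: summable_geometric)
  qed simp
  then have "(\<lambda>n. moment_dist (\<sigma> n) \<nu>) \<longlonglongrightarrow> 0"
    by (simp add: moment_dist_def)
  then show ?thesis
    using assms unfolding moment_topology_def M_md.limitin_metric_dist_null by simp
qed

text \<open>
  Open sets are preimages of open sets in the countable product \<open>nat \<Rightarrow> real\<close>, whose Borel sets are
  generated by the coordinates. This reduces measurability of random measures to measurability of
  their moments.
\<close>

lemma openin_moment_topology_imp_preimage:
  assumes "openin moment_topology U"
  obtains V where "open V" "\<And>\<nu>. \<nu> \<in> M_md \<Longrightarrow> \<nu> \<in> U \<longleftrightarrow> moment \<nu> \<in> V"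
proof
  let ?V = "\<Union>{W. open W \<and> (\<forall>\<nu>\<in>M_md. moment \<nu> \<in> W \<longrightarrow> \<nu> \<in> U)}"
  show "open ?V" by auto
  fix \<nu>
  assume \<nu>: "\<nu> \<in> M_md"
  show "\<nu> \<in> U \<longleftrightarrow> moment \<nu> \<in> ?V"
  proof
    assume "\<nu> \<in> U"
    have "\<exists>n::nat. \<forall>\<rho>\<in>M_md. moment \<rho> \<in> ball (moment \<nu>) (1 / Suc n) \<longrightarrow> \<rho> \<in> U"
    proof (rule ccontr)
      assume "\<not> ?thesis"
      then obtain \<sigma> where \<sigma>: "\<And>n. \<sigma> n \<in> M_md" "\<And>n. moment (\<sigma> n) \<in> ball (moment \<nu>) (1 / Suc n)"
          "\<And>n. \<sigma> n \<notin> U"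
        by metis
      have "(\<lambda>n. dist (moment (\<sigma> n)) (moment \<nu>)) \<longlonglongrightarrow> 0"
      proof (rule tendsto_sandwich[of "\<lambda>_. 0" _ _ "\<lambda>n. 1 / Suc n"])
        show "(\<lambda>n. 1 / real (Suc n)) \<longlonglongrightarrow> 0"
          by (rule LIMSEQ_Suc[OF lim_const_over_n])
        show "\<forall>\<^sub>F n in sequentially. dist (moment (\<sigma> n)) (moment \<nu>) \<le> 1 / real (Suc n)"
          using \<sigma>(2) by (intro always_eventually) (metis dist_commute less_imp_le mem_ball)
      qed auto
      then have conv: "(\<lambda>n. moment (\<sigma> n)) \<longlonglongrightarrow> moment \<nu>"
        by (rule tendsto_dist_iff[THEN iffD2])
      have "(\<lambda>n. moment (\<sigma> n) k) \<longlonglongrightarrow> moment \<nu> k" for k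
        using continuous_on_tendsto_compose[OF continuous_on_product_coordinates[of k] conv]
        by simp
      then have "limitin moment_topology \<sigma> \<nu> sequentially"
        using \<sigma> \<nu> by (intro limitin_moment_topology)
      then have "\<forall>\<^sub>F n in sequentially. \<sigma> n \<in> U"
        using assms \<open>\<nu> \<in> U\<close> by (simp add: limitin_def)
      then show False using \<sigma> by simp
    qed
    then obtain n :: nat where "\<forall>\<rho>\<in>M_md. moment \<rho> \<in> ball (moment \<nu>) (1 / Suc n) \<longrightarrow> \<rho> \<in> U"
      by blast
    then show "moment \<nu> \<in> ?V"
      by (intro UnionI[of "ball (moment \<nu>) (1 / Suc n)"]) auto
  qed (use \<nu> in auto)
qed

lemma measurable_moment_topology:
  assumes M_md: "\<And>\<omega>. \<omega> \<in> space P \<Longrightarrow> Y \<omega> \<in> M_md"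
    and meas: "\<And>k. (\<lambda>\<omega>. moment (Y \<omega>) k) \<in> borel_measurable P"
  shows "Y \<in> measurable P (sigma (topspace moment_topology) {U. openin moment_topology U})"
proof (rule measurable_measure_of)
  fix U
  assume "U \<in> {U. openin moment_topology U}"
  then obtain V where V: "open V" "\<And>\<nu>. \<nu> \<in> M_md \<Longrightarrow> \<nu> \<in> U \<longleftrightarrow> moment \<nu> \<in> V"
    using openin_moment_topology_imp_preimage[of U] by auto
  have "(\<lambda>\<omega>. moment (Y \<omega>)) \<in> borel_measurable P"
    using meas by (rule measurable_coordinatewise_then_product)
  then have "(\<lambda>\<omega>. moment (Y \<omega>)) -` V \<inter> space P \<in> sets P"
    using V(1) by (intro measurable_sets) auto
  also have "(\<lambda>\<omega>. moment (Y \<omega>)) -` V \<inter> space P = Y -` U \<inter> space P"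
    using V(2) M_md by auto
  finally show "Y -` U \<inter> space P \<in> sets P" .
qed (use M_md in \<open>auto simp: openin_subset dest!: openin_subset\<close>)

section \<open>Jacobi matrices and orthogonal polynomials\<close>

text \<open>
  \<open>jacobi_power a b r i\<close> is the entry \<open>i\<close> of \<open>A\<^sup>r e\<^sub>0\<close>, for the Jacobi matrix \<open>A\<close> with off-diagonal \<open>a\<close> and
  diagonal \<open>b\<close>. All entries, not only the entry \<open>0\<close> that is a moment, are needed for the inductions.
\<close>

definition jacobi_power :: "(nat \<Rightarrow> real) \<Rightarrow> (nat \<Rightarrow> real) \<Rightarrow> nat \<Rightarrow> nat \<Rightarrow> real" where
  "jacobi_power a b r = (tridiag_apply (tridiag a b) ^^ r) (\<lambda>i. if i = 0 then 1 else 0)"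

lemma tridiag_moment_eq: "tridiag_moment (tridiag a b) r = jacobi_power a b r 0"
  by (simp add: tridiag_moment_def jacobi_power_def)

lemma tridiag_apply_0: "tridiag_apply (tridiag a b) v 0 = b 0 * v 0 + a 0 * v 1"
  by (simp add: tridiag_apply_def tridiag_def)

lemma tridiag_apply_Suc:
  "tridiag_apply (tridiag a b) v (Suc i) = a i * v i + b (Suc i) * v (Suc i) + a (Suc i) * v (Suc (Suc i))"
proof -
  have "(\<Sum>j<i. tridiag a b (Suc i) j * v j) = 0"
    by (intro sum.neutral) (auto simp: tridiag_def)
  then show ?thesis
    by (simp add: tridiag_apply_def tridiag_def lessThan_Suc_atMost[symmetric])
qed

lemma jacobi_power_0: "jacobi_power a b 0 i = (if i = 0 then 1 else 0)"
  by (simp add: jacobi_power_def)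

lemma jacobi_power_Suc_0:
  "jacobi_power a b (Suc r) 0 = b 0 * jacobi_power a b r 0 + a 0 * jacobi_power a b r 1"
  by (simp add: jacobi_power_def tridiag_apply_0)

lemma jacobi_power_Suc_Suc:
  "jacobi_power a b (Suc r) (Suc i) = a i * jacobi_power a b r i +
     b (Suc i) * jacobi_power a b r (Suc i) + a (Suc i) * jacobi_power a b r (Suc (Suc i))"
  by (simp add: jacobi_power_def tridiag_apply_Suc)

lemma tendsto_jacobi_power:
  assumes "\<And>k. ((\<lambda>n. a n k) \<longlongrightarrow> a' k) F" "\<And>k. ((\<lambda>n. b n k) \<longlongrightarrow> b' k) F"
  shows "((\<lambda>n. jacobi_power (a n) (b n) r i) \<longlongrightarrow> jacobi_power a' b' r i) F"
proof (induction r arbitrary: i)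
  case (Suc r)
  then show ?case
    by (cases i) (auto simp: jacobi_power_Suc_0 jacobi_power_Suc_Suc intro!: tendsto_intros assms)
qed (simp add: jacobi_power_0)

lemma measurable_jacobi_power:
  assumes [measurable]: "\<And>k. (\<lambda>\<omega>. a \<omega> k) \<in> borel_measurable P" "\<And>k. (\<lambda>\<omega>. b \<omega> k) \<in> borel_measurable P"
  shows "(\<lambda>\<omega>. jacobi_power (a \<omega>) (b \<omega>) r i) \<in> borel_measurable P"
proof (induction r arbitrary: i)
  case (Suc r)
  note [measurable] = Suc
  show ?case
    by (cases i) (auto simp: jacobi_power_Suc_0 jacobi_power_Suc_Suc)
qed (simp add: jacobi_power_0)

lemma abs_jacobi_power_le:
  assumes "\<And>k. \<bar>a k\<bar> \<le> K" "\<And>k. \<bar>b k\<bar> \<le> K"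
  shows "\<bar>jacobi_power a b r i\<bar> \<le> (3 * K) ^ r"
proof (induction r arbitrary: i)
  case (Suc r)
  have K: "K \<ge> 0" using assms(1)[of 0] by linarith
  have bnd: "\<bar>c * jacobi_power a b r j\<bar> \<le> K * (3 * K) ^ r" if "\<bar>c\<bar> \<le> K" for c j
    unfolding abs_mult using that Suc K by (intro mult_mono) auto
  have eq: "(3 * K) ^ Suc r = 3 * (K * (3 * K) ^ r)" by simp
  show ?case
  proof (cases i)
    case 0
    show ?thesis
      unfolding 0 jacobi_power_Suc_0 eq
      using bnd[OF assms(2), of 0 0] bnd[OF assms(1), of 0 1] by linarith
  next
    case (Suc j)
    show ?thesis
      unfolding Suc jacobi_power_Suc_Suc eq
      using bnd[OF assms(1), of j j] bnd[OF assms(2), of "Suc j" "Suc j"]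
        bnd[OF assms(1), of "Suc j" "Suc (Suc j)"] by linarith
  qed
qed (simp add: jacobi_power_0)

text \<open>
  The orthonormal polynomials of the Jacobi matrix with off-diagonal \<open>a\<close> and diagonal \<open>b\<close>.
\<close>

fun orth_poly :: "(nat \<Rightarrow> real) \<Rightarrow> (nat \<Rightarrow> real) \<Rightarrow> nat \<Rightarrow> real poly" where
  "orth_poly a b 0 = 1"
| "orth_poly a b (Suc 0) = Polynomial.smult (1 / a 0) [:- b 0, 1:]"
| "orth_poly a b (Suc (Suc k)) = Polynomial.smult (1 / a (Suc k))
     ([:- b (Suc k), 1:] * orth_poly a b (Suc k) - Polynomial.smult (a k) (orth_poly a b k))"

text \<open>
  The part of \<open>x p\<^sub>k\<close> that is orthogonal to \<open>p\<^sub>0, \<dots>, p\<^sub>k\<close>. It equals \<open>a\<^sub>k p\<^sub>k\<^sub>+\<^sub>1\<close>, but it does not mention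
  \<open>a\<^sub>k\<close>, which can therefore be recovered as its norm.
\<close>

definition orth_residual :: "(nat \<Rightarrow> real) \<Rightarrow> (nat \<Rightarrow> real) \<Rightarrow> nat \<Rightarrow> real poly" where
  "orth_residual a b k = [:- b k, 1:] * orth_poly a b k -
     (case k of 0 \<Rightarrow> 0 | Suc j \<Rightarrow> Polynomial.smult (a j) (orth_poly a b j))"

lemma orth_poly_Suc: "orth_poly a b (Suc k) = Polynomial.smult (1 / a k) (orth_residual a b k)"
  by (cases k) (simp_all add: orth_residual_def one_pCons)

locale jacobi_measure =
  fixes \<nu> :: "real measure" and a b :: "nat \<Rightarrow> real"
  assumes prob: "borel_prob \<nu>" and finite: "moments_finite \<nu>"
    and a_pos: "\<And>k. a k > 0"
    and moments: "\<And>r. moment \<nu> r = jacobi_power a b r 0"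
begin

abbreviation p :: "nat \<Rightarrow> real poly" where "p \<equiv> orth_poly a b"

definition L :: "real poly \<Rightarrow> real" where "L q = (\<integral>x. poly q x \<partial>\<nu>)"

lemma integrable_poly: "integrable \<nu> (poly q)"
proof -
  have "integrable \<nu> (\<lambda>x. \<Sum>i\<le>Polynomial.degree q. Polynomial.coeff q i * x ^ i)"
    using finite by (intro Bochner_Integration.integrable_sum integrable_mult_right) (auto simp: moments_finite_def)
  also have "(\<lambda>x. \<Sum>i\<le>Polynomial.degree q. Polynomial.coeff q i * x ^ i) = poly q"
    by (simp add: fun_eq_iff poly_altdef)
  finally show ?thesis .
qed

lemma L_add: "L (q + q') = L q + L q'"
  using integrable_poly by (simp add: L_def)

lemma L_diff: "L (q - q') = L q - L q'"
  using integrable_poly by (simp add: L_def)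

lemma L_smult: "L (Polynomial.smult c q) = c * L q"
  by (simp add: L_def)

lemma L_0: "L 0 = 0"
  by (simp add: L_def)

lemma L_sum: "L (sum f A) = (\<Sum>i\<in>A. L (f i))"
  by (induction A rule: infinite_finite_induct) (auto simp: L_add L_0)

lemmas L_linear = L_add L_diff L_smult

lemma L_X_power: "L ([:0, 1:] ^ r) = jacobi_power a b r 0"
  using moments[of r] by (simp add: L_def moment_def poly_power)

lemma X_mult_p_0: "[:0, 1:] * p 0 = Polynomial.smult (b 0) (p 0) + Polynomial.smult (a 0) (p 1)"
  using a_pos[of 0] by (simp add: one_pCons)

lemma X_mult_p_Suc: "[:0, 1:] * p (Suc k) =
    Polynomial.smult (a k) (p k) + Polynomial.smult (b (Suc k)) (p (Suc k)) + Polynomial.smult (a (Suc k)) (p (Suc (Suc k)))"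
  using a_pos[of "Suc k"] by simp

text \<open>
  The polynomial \<open>p\<^sub>k\<close> satisfies \<open>p\<^sub>k(A) e\<^sub>0 = e\<^sub>k\<close>, so the integral of \<open>x ^ r\<close> times \<open>p\<^sub>k\<close> is the entry \<open>k\<close> of
  \<open>A\<^sup>r e\<^sub>0\<close>; formally, both sides obey the same recurrence in \<open>k\<close>.
\<close>

lemma L_X_power_p: "L ([:0, 1:] ^ r * p k) = jacobi_power a b r k"
proof (induction k arbitrary: r rule: less_induct)
  case (less k)
  consider "k = 0" | "k = 1" | j where "k = Suc (Suc j)"
    by (cases k rule: orth_poly.cases[of "(a, b, k)" for k, simplified]) auto
  then show ?case
  proof cases
    case 1
    then show ?thesis by (simp add: L_X_power)
  next
    case 2
    have "L ([:0, 1:] ^ Suc r * p 0) = L ([:0, 1:] ^ r * ([:0, 1:] * p 0))"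
      by (simp only: power_Suc2 mult.assoc)
    also have "\<dots> = b 0 * L ([:0, 1:] ^ r * p 0) + a 0 * L ([:0, 1:] ^ r * p 1)"
      unfolding X_mult_p_0 distrib_left mult_smult_right L_linear ..
    finally show ?thesis
      using less.IH[of 0] 2 a_pos[of 0] by (simp add: jacobi_power_Suc_0 del: power_Suc)
  next
    case 3
    have "L ([:0, 1:] ^ Suc r * p (Suc j)) = L ([:0, 1:] ^ r * ([:0, 1:] * p (Suc j)))"
      by (simp only: power_Suc2 mult.assoc)
    also have "\<dots> = a j * L ([:0, 1:] ^ r * p j) + b (Suc j) * L ([:0, 1:] ^ r * p (Suc j)) +
        a (Suc j) * L ([:0, 1:] ^ r * p (Suc (Suc j)))"
      unfolding X_mult_p_Suc distrib_left mult_smult_right L_linear ..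
    finally show ?thesis
      using less.IH[of j] less.IH[of "Suc j"] 3 a_pos[of "Suc j"]
      by (simp add: jacobi_power_Suc_Suc del: power_Suc orth_poly.simps)
  qed
qed

text \<open>
  Orthonormality. The multiplication by \<open>x\<close> may be expanded in either factor by the three-term
  recurrence; comparing the two expansions determines row \<open>j + 1\<close> of the Gram matrix from the rows
  before it.
\<close>

lemma L_p_p: "L (p j * p k) = (if j = k then 1 else 0)"
proof (induction j arbitrary: k rule: less_induct)
  case (less j)
  have three_term: "L (([:0, 1:] * p i) * p k) = (case k of 0 \<Rightarrow> 0 | Suc l \<Rightarrow> a l * L (p i * p l)) +
      b k * L (p i * p k) + a k * L (p i * p (Suc k))" for i k
  proof -
    have "([:0, 1:] * p i) * p k = p i * ([:0, 1:] * p k)"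
      by (simp only: mult_ac)
    then show ?thesis
    proof (cases k)
      case 0
      show ?thesis
        unfolding 0 \<open>_ = p i * _\<close>[unfolded 0] X_mult_p_0 distrib_left mult_smult_right L_linear by simp
    next
      case (Suc l)
      show ?thesis
        unfolding Suc \<open>_ = p i * _\<close>[unfolded Suc] X_mult_p_Suc distrib_left mult_smult_right L_linear by simp
    qed
  qed
  consider "j = 0" | "j = 1" | i where "j = Suc (Suc i)"
    by (metis One_nat_def not0_implies_Suc)
  then show ?case
  proof cases
    case 1
    then show ?thesis
      using L_X_power_p[of 0 k] by (simp add: jacobi_power_0)
  next
    case 2
    have "L (([:0, 1:] * p 0) * p k) = b 0 * L (p 0 * p k) + a 0 * L (p 1 * p k)"
      unfolding X_mult_p_0 distrib_right mult_smult_left L_linear ..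
    then show ?thesis
      using three_term[of 0 k] less.IH[of 0] 2 a_pos[of 0]
      by (cases k) (auto split: if_splits simp del: orth_poly.simps)
  next
    case 3
    have "L (([:0, 1:] * p (Suc i)) * p k) =
        a i * L (p i * p k) + b (Suc i) * L (p (Suc i) * p k) + a (Suc i) * L (p (Suc (Suc i)) * p k)"
      unfolding X_mult_p_Suc distrib_right mult_smult_left L_linear ..
    then show ?thesis
      using three_term[of "Suc i" k] less.IH[of i] less.IH[of "Suc i"] 3 a_pos[of "Suc i"]
      by (cases k) (auto split: if_splits simp del: orth_poly.simps)
  qed
qed

lemma b_eq: "b k = L ([:0, 1:] * p k * p k)"
proof (cases k)
  case 0
  show ?thesis
    unfolding 0 X_mult_p_0 distrib_right mult_smult_left L_linear L_p_p by simp
next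
  case (Suc l)
  show ?thesis
    unfolding Suc X_mult_p_Suc distrib_right mult_smult_left L_linear L_p_p by simp
qed

lemma a_eq: "a k = sqrt (L (orth_residual a b k * orth_residual a b k))"
proof -
  have "orth_residual a b k = Polynomial.smult (a k) (p (Suc k))"
    using a_pos[of k] by (simp add: orth_poly_Suc)
  then have "L (orth_residual a b k * orth_residual a b k) = a k * a k"
    by (simp only: mult_smult_left mult_smult_right L_smult L_p_p) simp
  then show ?thesis using a_pos[of k] by simp
qed

text \<open>
  The Christoffel bound for the mass at \<open>0\<close>: the polynomial \<open>q = \<Sum>k<n. p\<^sub>k(0) p\<^sub>k\<close> has both squared norm and
  value at \<open>0\<close> equal to \<open>S = \<Sum>k<n. p\<^sub>k(0)\<^sup>2\<close>, and the atom contributes \<open>S\<^sup>2\<close> times its mass to the squared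
  norm.
\<close>

lemma measure_atom_le:
  assumes "n > 0"
  shows "measure \<nu> {0} * (\<Sum>k<n. (poly (p k) 0)\<^sup>2) \<le> 1"
proof -
  interpret prob_space \<nu> using prob by (simp add: borel_prob_def)
  define S where "S = (\<Sum>k<n. (poly (p k) 0)\<^sup>2)"
  define q where "q = (\<Sum>k<n. Polynomial.smult (poly (p k) 0) (p k))"
  have S: "S > 0"
  proof -
    have "(poly (p 0) 0)\<^sup>2 \<le> S"
      unfolding S_def using assms by (intro member_le_sum) auto
    then show ?thesis by simp
  qed
  have q0: "poly q 0 = S"
    by (simp add: q_def S_def poly_sum power2_eq_square)
  have "L (q * q) = (\<Sum>i<n. \<Sum>j<n. poly (p i) 0 * (poly (p j) 0 * L (p i * p j)))"
    unfolding q_def sum_product L_sum by (intro sum.cong refl) (simp add: L_smult mult_ac)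
  also have "\<dots> = S"
    by (simp add: L_p_p S_def power2_eq_square if_distrib[of "(*) _"] sum.delta cong: if_cong)
  finally have qq: "L (q * q) = S" .
  have "measure \<nu> {0} * S\<^sup>2 = (\<integral>x. indicator {0} x * S\<^sup>2 \<partial>\<nu>)"
    using prob by (simp add: borel_prob_def)
  also have "\<dots> \<le> (\<integral>x. poly (q * q) x \<partial>\<nu>)"
  proof (rule integral_mono)
    show "integrable \<nu> (\<lambda>x. indicator {0} x * S\<^sup>2)"
      using prob by (intro integrable_mult_left integrable_real_indicator) (auto simp: borel_prob_def emeasure_eq_measure)
    show "indicator {0} x * S\<^sup>2 \<le> poly (q * q) x" for x
      by (auto simp: indicator_def q0 power2_eq_square)
  qed (rule integrable_poly)
  also have "\<dots> = S" using qq by (simp add: L_def)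
  finally have "(measure \<nu> {0} * S) * S \<le> 1 * S"
    by (simp add: power2_eq_square mult.assoc)
  then show ?thesis
    using S unfolding S_def[symmetric] by (rule mult_right_le_imp_le)
qed

end

text \<open>
  Each \<open>b\<^sub>k\<close> and each \<open>a\<^sub>k\<^sup>2\<close> is the integral of a polynomial that is built from the coefficients before
  it, and the measure fixes these integrals.
\<close>

theorem jacobi_coefficients_unique:
  assumes "jacobi_measure \<nu> a b" "jacobi_measure \<nu> a' b'"
  shows "a = a' \<and> b = b'"
proof -
  interpret J: jacobi_measure \<nu> a b by fact
  interpret J': jacobi_measure \<nu> a' b' by fact
  have same_L: "J.L = J'.L"
    by (simp add: fun_eq_iff J.L_def J'.L_def)
  have "a k = a' k \<and> b k = b' k \<and> orth_poly a b k = orth_poly a' b' k" for k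
  proof (induction k rule: less_induct)
    case (less k)
    have p: "orth_poly a b k = orth_poly a' b' k"
    proof (cases k)
      case (Suc l)
      have "orth_residual a b l = orth_residual a' b' l"
        using less.IH[of l] less.IH[of "l - 1"] Suc
        by (cases l) (auto simp: orth_residual_def)
      then show ?thesis
        using less.IH[of l] Suc by (simp only: orth_poly_Suc)
    qed simp
    then have b: "b k = b' k"
      using J.b_eq[of k] J'.b_eq[of k] same_L by simp
    have "orth_residual a b k = orth_residual a' b' k"
      using p b less.IH[of "k - 1"] by (cases k) (auto simp: orth_residual_def)
    then have "a k = a' k"
      using J.a_eq[of k] J'.a_eq[of k] same_L by simp
    with p b show ?case by simp
  qed
  then show ?thesis by auto
qed

text \<open>
  For \<open>A = B B\<^sup>T\<close> the vector of values at \<open>0\<close> solves \<open>B\<^sup>T v = 0\<close>, which is a first-order recurrence.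
\<close>

lemma orth_poly_laguerre_at_0:
  assumes "\<And>k. d (Suc k) > 0" "\<And>k. s (Suc k) > 0"
  shows "poly (orth_poly (offdiag_coeff d s) (diag_coeff d s) k) 0 =
           (-1) ^ k * (\<Prod>j<k. d (Suc j) / s (Suc j))"
proof (induction k rule: less_induct)
  case (less k)
  consider "k = 0" | "k = 1" | i where "k = Suc (Suc i)"
    by (metis One_nat_def not0_implies_Suc)
  then show ?case
  proof cases
    case 2
    then show ?thesis
      using assms(1)[of 0] assms(2)[of 0]
      by (simp add: offdiag_coeff_def diag_coeff_def power2_eq_square)
  next
    case 3
    define Q where "Q = (-1) ^ i * (\<Prod>j<i. d (Suc j) / s (Suc j))"
    have Q: "poly (orth_poly (offdiag_coeff d s) (diag_coeff d s) i) 0 = Q"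
        "poly (orth_poly (offdiag_coeff d s) (diag_coeff d s) (Suc i)) 0 = - Q * (d (Suc i) / s (Suc i))"
      using less.IH[of i] less.IH[of "Suc i"] 3 by (auto simp: Q_def)
    have "poly (orth_poly (offdiag_coeff d s) (diag_coeff d s) k) 0 =
        Q * (d (Suc i) / s (Suc i)) * (d (Suc (Suc i)) / s (Suc (Suc i)))"
      unfolding 3 orth_poly.simps
      using assms[of i] assms[of "Suc i"]
      by (simp add: Q offdiag_coeff_def diag_coeff_def power2_eq_square field_simps)
    then show ?thesis by (simp add: 3 Q_def)
  qed simp
qed

text \<open>
  If eventually \<open>s\<^sub>k \<le> d\<^sub>k\<close>, then the values \<open>p\<^sub>k(0)\<^sup>2\<close> stay away from \<open>0\<close> and their sum diverges.
\<close>

lemma laguerre_no_atom_at_0: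
  assumes J: "jacobi_measure \<nu> (offdiag_coeff d s) (diag_coeff d s)"
    and pos: "\<And>k. d (Suc k) > 0" "\<And>k. s (Suc k) > 0"
    and ge: "\<forall>\<^sub>F k in sequentially. s (Suc k) \<le> d (Suc k)"
  shows "measure \<nu> {0} = 0"
proof -
  interpret jacobi_measure \<nu> "offdiag_coeff d s" "diag_coeff d s" by fact
  obtain K where K: "\<And>k. k \<ge> K \<Longrightarrow> s (Suc k) \<le> d (Suc k)"
    using ge by (auto simp: eventually_sequentially)
  \<comment> \<open>From \<open>K\<close> on all factors \<open>d / s\<close> are at least \<open>1\<close>.\<close>
  define c where "c = (\<Prod>j<K. d (Suc j) / s (Suc j))"
  have c: "c > 0" unfolding c_def using pos by (intro prod_pos) auto
  have ge_c: "c\<^sup>2 \<le> (poly (p k) 0)\<^sup>2" if "k \<ge> K" for k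
  proof -
    have "c * 1 \<le> c * (\<Prod>j=K..<k. d (Suc j) / s (Suc j))"
      using c K pos by (intro mult_left_mono prod_ge_1) (auto simp: divide_simps less_imp_le)
    also have "\<dots> = (\<Prod>j<k. d (Suc j) / s (Suc j))"
      unfolding c_def using that
      by (subst prod.union_disjoint[symmetric]) (auto intro!: prod.cong)
    finally have "c\<^sup>2 \<le> (\<Prod>j<k. d (Suc j) / s (Suc j))\<^sup>2"
      using c by (intro power_mono) auto
    then show ?thesis
      by (simp add: orth_poly_laguerre_at_0[of d s, OF pos] power_mult_distrib power_even_eq[symmetric] 
            flip: power_mult)
  qed
  have "measure \<nu> {0} * (real n * c\<^sup>2) \<le> 1" for n
  proof -
    have "real n * c\<^sup>2 = (\<Sum>k=K..<K+n. c\<^sup>2)" by simp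
    also have "\<dots> \<le> (\<Sum>k=K..<K+n. (poly (p k) 0)\<^sup>2)"
      by (intro sum_mono ge_c) auto
    also have "\<dots> \<le> (\<Sum>k<Suc (K+n). (poly (p k) 0)\<^sup>2)"
      by (intro sum_mono2) auto
    finally have "measure \<nu> {0} * (real n * c\<^sup>2) \<le> measure \<nu> {0} * (\<Sum>k<Suc (K+n). (poly (p k) 0)\<^sup>2)"
      by (intro mult_left_mono) auto
    also have "\<dots> \<le> 1" by (rule measure_atom_le) simp
    finally show ?thesis .
  qed
  then have "real n * (measure \<nu> {0} * c\<^sup>2) \<le> 1" for n
    by (simp add: mult_ac)
  then have "\<not> measure \<nu> {0} * c\<^sup>2 > 0"
    using reals_Archimedean3[of "measure \<nu> {0} * c\<^sup>2"] by (metis linorder_not_less)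
  then show ?thesis
    using c by (simp add: zero_less_mult_iff less_le)
qed

section \<open>Spectral measures of finite Laguerre matrices\<close>

lemma laguerre_matrix_carrier: "laguerre_matrix m d s \<in> carrier_mat m m"
  by (intro carrier_matI) (simp_all add: laguerre_matrix_def lower_bidiagonal_def)

lemma laguerre_matrix_index:
  assumes "i < m" "j < m"
  shows "laguerre_matrix m d s $$ (i, j) = tridiag (offdiag_coeff d s) (diag_coeff d s) i j"
proof -
  define B where "B i l = (if i = l then d (Suc l) else if i = Suc l then s (Suc l) else 0)" for i l
  have row_sum: "(\<Sum>l\<in>{0..<m}. B i l * f l) =
      d (Suc i) * f i + (case i of 0 \<Rightarrow> 0 | Suc k \<Rightarrow> s i * f k)" if "i < m" for i f
  proof -
    have "(\<Sum>l\<in>{0..<m}. B i l * f l) =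
        (\<Sum>l\<in>{0..<m}. (if l = i then d (Suc l) * f l else 0) + (if Suc l = i then s (Suc l) * f l else 0))"
      by (intro sum.cong refl) (simp add: B_def)
    also have "\<dots> = (\<Sum>l\<in>{0..<m}. if l = i then d (Suc l) * f l else 0) +
        (\<Sum>l\<in>{0..<m}. if Suc l = i then s (Suc l) * f l else 0)"
      by (rule sum.distrib)
    also have "(\<Sum>l\<in>{0..<m}. if l = i then d (Suc l) * f l else 0) = d (Suc i) * f i"
      using that by simp
    also have "(\<Sum>l\<in>{0..<m}. if Suc l = i then s (Suc l) * f l else 0) =
        (case i of 0 \<Rightarrow> 0 | Suc k \<Rightarrow> s i * f k)"
    proof (cases i)
      case (Suc k)
      then show ?thesis using that by simp
    qed simp
    finally show ?thesis .
  qed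
  define M where "M = lower_bidiagonal m d s"
  have M: "M \<in> carrier_mat m m" and M_index: "\<And>i l. i < m \<Longrightarrow> l < m \<Longrightarrow> M $$ (i, l) = B i l"
    by (simp_all add: M_def lower_bidiagonal_def B_def)
  have "laguerre_matrix m d s $$ (i, j) = scalar_prod (Matrix.row M i) (Matrix.row M j)"
    using assms M by (simp add: laguerre_matrix_def M_def[symmetric])
  also have "\<dots> = (\<Sum>l\<in>{0..<m}. B i l * B j l)"
    unfolding scalar_prod_def using assms M by (intro sum.cong) (simp_all add: M_index)
  also have "\<dots> = d (Suc i) * B j i + (case i of 0 \<Rightarrow> 0 | Suc k \<Rightarrow> s i * B j k)"
    using row_sum[OF assms(1), of "B j"] .
  also have "\<dots> = tridiag (offdiag_coeff d s) (diag_coeff d s) i j"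
  proof -
    consider "j = i" | "j = Suc i" | "i = Suc j" | "j \<noteq> i" "j \<noteq> Suc i" "i \<noteq> Suc j" by blast
    then show ?thesis
      by cases (cases i; simp add: B_def tridiag_def offdiag_coeff_def diag_coeff_def power2_eq_square)+
  qed
  finally show ?thesis .
qed

text \<open>
  For an eigenvector \<open>\<psi>\<close> of \<open>B B\<^sup>T\<close>, the number \<open>x \<psi> \<bullet> \<psi>\<close> is the squared norm of \<open>B\<^sup>T \<psi>\<close>, and \<open>B\<^sup>T\<close> is
  invertible as a triangular matrix with positive diagonal.
\<close>

lemma laguerre_eigenvalue_pos:
  assumes ev: "eigenvector (laguerre_matrix m d s) \<psi> x" and pos: "\<And>j. j \<in> {1..m} \<Longrightarrow> d j > 0"
  shows "x > 0"
proof -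
  define B where "B = lower_bidiagonal m d s"
  have B: "B \<in> carrier_mat m m"
    by (simp add: B_def lower_bidiagonal_def)
  have BT: "transpose_mat B \<in> carrier_mat m m" using B by simp
  have \<psi>: "\<psi> \<in> carrier_vec m" "\<psi> \<noteq> 0\<^sub>v m" "B * transpose_mat B *\<^sub>v \<psi> = x \<cdot>\<^sub>v \<psi>"
    using ev laguerre_matrix_carrier[of m d s]
    by (auto simp: eigenvector_def laguerre_matrix_def B_def)
  define w where "w = transpose_mat B *\<^sub>v \<psi>"
  have w: "w \<in> carrier_vec m" using BT \<psi> by (simp add: w_def)
  have "Determinant.det (transpose_mat B) \<noteq> 0"
  proof -
    have "Determinant.det (transpose_mat B) = Determinant.det B"
      using B by (rule det_transpose)
    also have "\<dots> = prod_list (diag_mat B)"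
      by (rule det_lower_triangular[OF _ B]) (auto simp: B_def lower_bidiagonal_def)
    also have "\<dots> \<noteq> 0"
    proof -
      have "y \<noteq> 0" if "y \<in> set (diag_mat B)" for y
        using that pos by (auto simp: diag_mat_def B_def lower_bidiagonal_def less_imp_neq[symmetric])
      then show ?thesis by (auto simp: prod_list_zero_iff)
    qed
    finally show ?thesis .
  qed
  then have "w \<noteq> 0\<^sub>v m"
    using det_0_iff_vec_prod_zero_field[OF BT] \<psi> by (auto simp: w_def)
  have sq_pos: "scalar_prod v v > 0" if v: "v \<in> carrier_vec m" "v \<noteq> 0\<^sub>v m" for v :: "real vec"
  proof -
    have "v = 0\<^sub>v m" if "\<forall>i<m. vec_index v i = 0"
      using v(1) that by (intro eq_vecI) auto
    then obtain i where i: "i < m" "vec_index v i \<noteq> 0"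
      using v(2) by blast
    have "0 < vec_index v i * vec_index v i" using i by (auto simp: zero_less_mult_iff)
    also have "\<dots> \<le> scalar_prod v v"
      unfolding scalar_prod_def using i v
      by (intro member_le_sum[of i _ "\<lambda>i. vec_index v i * vec_index v i"]) auto
    finally show ?thesis .
  qed
  have "scalar_prod w w = scalar_prod \<psi> (B *\<^sub>v w)"
    unfolding w_def by (rule transpose_vec_mult_scalar[OF B]) (use BT \<psi> in auto)
  also have "B *\<^sub>v w = x \<cdot>\<^sub>v \<psi>"
    using \<psi> B BT by (simp add: w_def)
  also have "scalar_prod \<psi> (x \<cdot>\<^sub>v \<psi>) = x * scalar_prod \<psi> \<psi>"
    using \<psi> by simp
  finally have "x * scalar_prod \<psi> \<psi> > 0"
    using sq_pos[OF w \<open>w \<noteq> 0\<^sub>v m\<close>] by simp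
  then show ?thesis
    using sq_pos[OF \<psi>(1,2)] by (simp add: zero_less_mult_iff)
qed

text \<open>
  A zero off-diagonal entry decouples the first \<open>m\<close> coordinates from the others. This is
  how a finite matrix is treated as an infinite one, for powers \<open>r\<close> of any size.
\<close>

lemma jacobi_power_vanishes:
  assumes "m \<ge> 1" "a (m - 1) = 0" "i \<ge> m"
    and "\<And>k. k \<ge> m \<Longrightarrow> a k = 0"
  shows "jacobi_power a b r i = 0"
  using assms(3)
proof (induction r arbitrary: i)
  case (Suc r)
  obtain j where j: "i = Suc j" using Suc.prems assms(1) by (cases i) auto
  have "a j = 0" using assms Suc.prems j by (cases "j \<ge> m") (auto simp: not_le less_Suc_eq_le dest: le_antisym)
  then show ?case
    using Suc by (simp add: j jacobi_power_Suc_Suc)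
qed (use assms(1) in \<open>simp add: jacobi_power_0\<close>)

lemma orthonormal_parseval:
  fixes \<psi> :: "nat \<Rightarrow> real vec"
  assumes \<psi>: "\<And>k. k < m \<Longrightarrow> \<psi> k \<in> carrier_vec m"
    and orth: "\<And>j k. j < m \<Longrightarrow> k < m \<Longrightarrow> scalar_prod (\<psi> j) (\<psi> k) = (if j = k then 1 else 0)"
    and uv: "u \<in> carrier_vec m" "v \<in> carrier_vec m"
  shows "(\<Sum>k<m. scalar_prod (\<psi> k) u * scalar_prod (\<psi> k) v) = scalar_prod u v"
proof -
  define \<Psi> where "\<Psi> = mat m m (\<lambda>(k, i). vec_index (\<psi> k) i)"
  have \<Psi>: "\<Psi> \<in> carrier_mat m m" by (simp add: \<Psi>_def)
  have row: "Matrix.row \<Psi> k = \<psi> k" if "k < m" for k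
    using \<psi>[OF that] that by (intro eq_vecI) (auto simp: \<Psi>_def)
  have "\<Psi> * transpose_mat \<Psi> = 1\<^sub>m m"
    using \<Psi> by (intro eq_matI) (auto simp: row orth)
  then have inv: "transpose_mat \<Psi> * \<Psi> = 1\<^sub>m m"
    using \<Psi> by (intro mat_mult_left_right_inverse[of \<Psi>]) auto
  have prod: "vec_index (\<Psi> *\<^sub>v w) k = scalar_prod (\<psi> k) w" if "k < m" for k w
    using \<Psi> that by (simp add: row)
  have "scalar_prod u v = scalar_prod (transpose_mat \<Psi> *\<^sub>v (\<Psi> *\<^sub>v u)) v"
    using \<Psi> uv inv by (subst assoc_mult_mat_vec[symmetric, of _ m m _ m]) auto
  also have "\<dots> = scalar_prod (\<Psi> *\<^sub>v u) (\<Psi> *\<^sub>v v)"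
    using \<Psi> uv by (intro transpose_vec_mult_scalar) auto
  also have "\<dots> = (\<Sum>k<m. scalar_prod (\<psi> k) u * scalar_prod (\<psi> k) v)"
    using \<Psi> by (subst scalar_prod_def) (auto simp: row atLeast0LessThan intro!: sum.cong)
  finally show ?thesis by simp
qed

lemma laguerre_matrix_mult_jacobi_power:
  fixes d s :: "nat \<Rightarrow> real"
  assumes m: "m \<ge> 1" and s0: "\<And>j. j \<ge> m \<Longrightarrow> s j = 0"
  defines "J \<equiv> jacobi_power (offdiag_coeff d s) (diag_coeff d s)"
  shows "laguerre_matrix m d s *\<^sub>v Matrix.vec m (J r) = Matrix.vec m (J (Suc r))"
proof (rule eq_vecI)
  let ?A = "tridiag (offdiag_coeff d s) (diag_coeff d s)"
  fix i
  assume "i < dim_vec (Matrix.vec m (J (Suc r)))"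
  then have i: "i < m" by simp
  have J0: "J r j = 0" if "j \<ge> m" for j
    unfolding J_def using m s0 that by (intro jacobi_power_vanishes[of m]) (auto simp: offdiag_coeff_def)
  have "vec_index (laguerre_matrix m d s *\<^sub>v Matrix.vec m (J r)) i = (\<Sum>j\<in>{0..<m}. ?A i j * J r j)"
    using i laguerre_matrix_carrier[of m d s] by (auto simp: scalar_prod_def laguerre_matrix_index intro!: sum.cong)
  also have "\<dots> = (\<Sum>j\<le>m + Suc i. ?A i j * J r j)"
    using J0 by (intro sum.mono_neutral_left) auto
  also have "\<dots> = (\<Sum>j\<le>Suc i. ?A i j * J r j)"
    by (intro sum.mono_neutral_right) (auto simp: tridiag_def)
  also have "\<dots> = J (Suc r) i"
    by (simp add: J_def jacobi_power_def tridiag_apply_def)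
  finally show "vec_index (laguerre_matrix m d s *\<^sub>v Matrix.vec m (J r)) i = vec_index (Matrix.vec m (J (Suc r))) i"
    using i by simp
qed (use laguerre_matrix_carrier[of m d s] in auto)

text \<open>
  The entries \<open>s\<^sub>j\<close> with \<open>j \<ge> m\<close> do not occur in the matrix; setting them to zero makes the infinite
  Jacobi matrix a padding of the finite one. The moment formula is then Parseval's identity in the
  eigenbasis.
\<close>

theorem laguerre_spectral_measure:
  assumes m: "m \<ge> 1"
    and spec: "is_spectral_measure (laguerre_matrix m d s) (unit_vec m 0) \<mu>"
    and pos: "\<And>j. j \<in> {1..m} \<Longrightarrow> d j > 0" and s0: "\<And>j. j \<ge> m \<Longrightarrow> s j = 0"
  shows "\<mu> \<in> M_md" "moment \<mu> r = jacobi_power (offdiag_coeff d s) (diag_coeff d s) r 0"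
proof -
  define L where "L = laguerre_matrix m d s"
  define J where "J = jacobi_power (offdiag_coeff d s) (diag_coeff d s)"
  have L: "L \<in> carrier_mat m m" unfolding L_def by (rule laguerre_matrix_carrier)
  have dim: "dim_row L = m" using L by simp
  obtain ev \<psi> where sets: "sets \<mu> = sets borel"
    and eig': "\<forall>k<m. eigenvector L (\<psi> k) (ev k)"
    and orth': "\<forall>j<m. \<forall>k<m. scalar_prod (\<psi> j) (\<psi> k) = (if j = k then 1 else 0)"
    and emeasure': "\<forall>A\<in>sets borel. emeasure \<mu> A =
           (\<Sum>k<m. ennreal ((scalar_prod (\<psi> k) (unit_vec m 0))\<^sup>2) * indicator A (ev k))"
    using spec unfolding is_spectral_measure_def L_def[symmetric] dim
    by (elim conjE exE) (rule that)
  note eig = eig'[rule_format] and orth = orth'[rule_format] and emeasure = emeasure'[rule_format]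
  have \<psi>: "\<psi> k \<in> carrier_vec m" if "k < m" for k
    using eig[OF that] L by (auto simp: eigenvector_def)
  have ev_pos: "ev k > 0" if "k < m" for k
    using eig[OF that] pos unfolding L_def by (rule laguerre_eigenvalue_pos)
  define w where "w k = (scalar_prod (\<psi> k) (unit_vec m 0))\<^sup>2" for k
  have u0: "Matrix.vec m (J 0) = unit_vec m 0"
    by (intro eq_vecI) (auto simp: J_def jacobi_power_0 unit_vec_def)
  have sym: "transpose_mat L = L"
    using L by (intro eq_matI) (auto simp: L_def laguerre_matrix_index tridiag_def)
  have coord: "scalar_prod (\<psi> k) (Matrix.vec m (J r)) = ev k ^ r * scalar_prod (\<psi> k) (unit_vec m 0)"
    if k: "k < m" for k r
  proof (induction r)
    case 0
    then show ?case by (simp add: u0)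
  next
    case (Suc r)
    have "scalar_prod (\<psi> k) (Matrix.vec m (J (Suc r))) = scalar_prod (\<psi> k) (L *\<^sub>v Matrix.vec m (J r))"
      unfolding L_def J_def using laguerre_matrix_mult_jacobi_power[of m s d r] m s0 by simp
    also have "\<dots> = scalar_prod (transpose_mat L *\<^sub>v \<psi> k) (Matrix.vec m (J r))"
      using L \<psi>[OF k] by (intro transpose_vec_mult_scalar[symmetric]) auto
    also have "transpose_mat L *\<^sub>v \<psi> k = ev k \<cdot>\<^sub>v \<psi> k"
      using eig[OF k] by (simp add: sym eigenvector_def)
    also have "scalar_prod (ev k \<cdot>\<^sub>v \<psi> k) (Matrix.vec m (J r)) = ev k * scalar_prod (\<psi> k) (Matrix.vec m (J r))"
      using \<psi>[OF k] by (intro smult_scalar_prod_distrib) auto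
    finally show ?case using Suc by simp
  qed
  have weights: "(\<Sum>k<m. w k * ev k ^ r) = J r 0" for r
  proof -
    have "(\<Sum>k<m. w k * ev k ^ r) =
        (\<Sum>k<m. scalar_prod (\<psi> k) (Matrix.vec m (J r)) * scalar_prod (\<psi> k) (unit_vec m 0))"
      by (intro sum.cong refl) (simp add: coord w_def power2_eq_square)
    also have "\<dots> = scalar_prod (Matrix.vec m (J r)) (unit_vec m 0)"
      using \<psi> orth by (intro orthonormal_parseval) auto
    also have "\<dots> = J r 0"
      using m by (simp add: scalar_prod_right_unit)
    finally show ?thesis .
  qed
  have w_nonneg: "w k \<ge> 0" for k by (simp add: w_def)
  have w_sum: "(\<Sum>k<m. w k) = 1"
    using weights[of 0] by (simp add: J_def jacobi_power_0)
  \<comment> \<open>Integrals against \<open>\<mu>\<close> become finite sums once \<open>\<mu>\<close> is an image of a measure on the index set.\<close>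
  let ?Q = "point_measure {..<m} (\<lambda>k. ennreal (w k))"
  have \<mu>_eq: "\<mu> = distr ?Q borel ev"
  proof (rule measure_eqI)
    fix A
    assume "A \<in> sets \<mu>"
    then have A: "A \<in> sets borel" using sets by simp
    have "emeasure (distr ?Q borel ev) A = (\<Sum>k\<in>ev -` A \<inter> {..<m}. ennreal (w k))"
      using A by (subst emeasure_distr) (auto simp: space_point_measure emeasure_point_measure_finite)
    also have "\<dots> = (\<Sum>k<m. ennreal (w k) * indicator A (ev k))"
      by (intro sum.mono_neutral_cong_left) (auto simp: indicator_def)
    finally show "emeasure \<mu> A = emeasure (distr ?Q borel ev) A"
      using emeasure[OF A] by (simp add: w_def)
  qed (simp add: sets)
  have \<mu>_prob: "borel_prob \<mu>"
  proof -
    have "emeasure \<mu> (space \<mu>) = (\<Sum>k<m. ennreal (w k))"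
      using emeasure[of UNIV] sets_eq_imp_space_eq[OF sets] by (simp add: w_def)
    also have "\<dots> = 1" using w_sum w_nonneg by (simp add: sum_ennreal)
    finally show ?thesis using sets by (simp add: borel_prob_def prob_spaceI)
  qed
  have mom: "moment \<mu> r = J r 0" for r
  proof -
    have "moment \<mu> r = (\<Sum>k<m. w k * ev k ^ r)"
    proof -
      have "moment \<mu> r = (\<integral>i. ev i ^ r \<partial>?Q)"
        unfolding moment_def \<mu>_eq by (rule integral_distr) simp_all
      also have "\<dots> = (\<Sum>k<m. w k *\<^sub>R ev k ^ r)"
        by (rule lebesgue_integral_point_measure_finite) (simp_all add: w_nonneg)
      finally show ?thesis by simp
    qed
    then show ?thesis by (simp add: weights)
  qed
  then show "moment \<mu> r = jacobi_power (offdiag_coeff d s) (diag_coeff d s) r 0"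
    by (simp add: J_def)
  have fin: "moments_finite \<mu>"
    unfolding moments_finite_def
  proof
    fix k
    have "integrable ?Q (\<lambda>i. ev i ^ k)"
      by (rule integrable_point_measure_finite) (simp_all add: w_nonneg)
    then show "integrable \<mu> (\<lambda>x. x ^ k)"
      unfolding \<mu>_eq by (subst integrable_distr_eq) auto
  qed
  have "moment \<mu> (2 * j) \<le> (\<Sum>k<m. ev k) ^ (2 * j)" for j
  proof -
    have "moment \<mu> (2 * j) = (\<Sum>k<m. w k * ev k ^ (2 * j))"
      by (simp add: mom weights)
    also have "\<dots> \<le> (\<Sum>k<m. w k * (\<Sum>k<m. ev k) ^ (2 * j))"
    proof (intro sum_mono mult_left_mono power_mono w_nonneg)
      fix k
      assume k: "k \<in> {..<m}"
      show "ev k \<le> (\<Sum>k<m. ev k)"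
        by (rule member_le_sum[OF k]) (auto intro: less_imp_le ev_pos)
      show "0 \<le> ev k" using k ev_pos[of k] by simp
    qed
    also have "\<dots> = (\<Sum>k<m. ev k) ^ (2 * j)"
      by (simp add: sum_distrib_right[symmetric] w_sum)
    finally show ?thesis .
  qed
  with \<mu>_prob fin have det: "moment_determinate \<mu>"
    by (rule moment_determinate_if_moments_le_power)
  have "emeasure \<mu> {0<..} = (\<Sum>k<m. ennreal (w k))"
    using ev_pos by (subst emeasure) (auto simp: w_def intro!: sum.cong)
  also have "\<dots> = 1" using w_sum w_nonneg by (simp add: sum_ennreal)
  finally have "measure \<mu> {0<..} = 1" by (simp add: measure_def)
  with \<mu>_prob fin det show "\<mu> \<in> M_md" by (simp add: M_md_def)
qed

section \<open>The cost of a coordinate sequence\<close>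

lemma gamma_rate_self: "\<kappa> > 0 \<Longrightarrow> gamma_rate \<kappa> \<kappa> = 0"
  by (simp add: gamma_rate_def)

lemma gamma_rate_nonneg:
  assumes "\<kappa> > 0" "y > 0"
  shows "gamma_rate \<kappa> y \<ge> 0"
proof -
  have "\<kappa> * ln (y / \<kappa>) \<le> \<kappa> * (y / \<kappa> - 1)"
    using assms by (intro mult_left_mono ln_le_minus_one) auto
  then show ?thesis using assms by (simp add: gamma_rate_def right_diff_distrib)
qed

lemma gamma_rate_pos:
  assumes "\<kappa> > 0" "y > 0" "y \<noteq> \<kappa>"
  shows "gamma_rate \<kappa> y > 0"
proof -
  have "ln (y / \<kappa>) \<noteq> y / \<kappa> - 1"
    using assms ln_eq_minus_one[of "y / \<kappa>"] by auto
  then have "ln (y / \<kappa>) < y / \<kappa> - 1"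
    using assms ln_le_minus_one[of "y / \<kappa>"] by (simp add: less_le)
  then have "\<kappa> * ln (y / \<kappa>) < \<kappa> * (y / \<kappa> - 1)"
    using assms by (intro mult_strict_left_mono) auto
  then show ?thesis using assms by (simp add: gamma_rate_def right_diff_distrib)
qed

text \<open>
  The hypothesis says that \<open>y\<close> lies beyond \<open>t\<close> as seen from the minimiser \<open>\<kappa>\<close>. The bound comes from
  \<open>ln z \<le> z - 1\<close> at \<open>z = y / t\<close>.
\<close>

lemma gamma_rate_mono_away:
  assumes "\<kappa> > 0" "t > 0" "y > 0" and away: "(y - t) * (t - \<kappa>) \<ge> 0"
  shows "gamma_rate \<kappa> t \<le> gamma_rate \<kappa> y"
proof -
  have "ln (y / t) \<le> y / t - 1"
    using assms by (intro ln_le_minus_one) auto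
  then have "\<kappa> * ln (y / t) \<le> \<kappa> * (y / t - 1)"
    using assms by (intro mult_left_mono) auto
  moreover have "(y - t) - \<kappa> * (y / t - 1) = (y - t) * (t - \<kappa>) / t"
    using assms by (simp add: field_simps)
  moreover have "(y - t) * (t - \<kappa>) / t \<ge> 0"
    using assms by simp
  moreover have "gamma_rate \<kappa> y - gamma_rate \<kappa> t = (y - t) - \<kappa> * ln (y / t)"
    using assms by (simp add: gamma_rate_def ln_div algebra_simps)
  ultimately show ?thesis by linarith
qed

text \<open>
  Sublevel sets of the rate are compact in \<open>(0, \<infinity>)\<close>.
\<close>

lemma gamma_rate_le_imp_bounds:
  assumes "\<kappa> > 0" "y > 0" "gamma_rate \<kappa> y \<le> c"
  shows "\<kappa> * exp (- (\<kappa> + c) / \<kappa>) \<le> y" "y \<le> 2 * (c + \<kappa>)"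
proof -
  have "- (\<kappa> + c) \<le> \<kappa> * ln (y / \<kappa>)"
    using assms by (simp add: gamma_rate_def)
  then have "- (\<kappa> + c) / \<kappa> \<le> ln (y / \<kappa>)"
    using assms by (simp add: pos_divide_le_eq mult.commute)
  then have "exp (- (\<kappa> + c) / \<kappa>) \<le> y / \<kappa>"
    using assms by (metis divide_pos_pos exp_le_cancel_iff exp_ln)
  then show "\<kappa> * exp (- (\<kappa> + c) / \<kappa>) \<le> y"
    using assms by (simp add: field_simps)
  have "ln (y / \<kappa> / 2) \<le> y / \<kappa> / 2 - 1"
    using assms by (intro ln_le_minus_one) auto
  moreover have "ln (y / \<kappa> / 2) = ln (y / \<kappa>) - ln 2"
    using assms by (intro ln_divide_pos) auto
  moreover have "ln 2 \<le> (1::real)"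
    using ln_le_minus_one[of "2::real"] by simp
  ultimately have "ln (y / \<kappa>) \<le> y / \<kappa> / 2" by linarith
  then have "\<kappa> * ln (y / \<kappa>) \<le> \<kappa> * (y / \<kappa> / 2)"
    using assms by (intro mult_left_mono) auto
  then show "y \<le> 2 * (c + \<kappa>)"
    using assms by (simp add: gamma_rate_def)
qed

lemma continuous_gamma_rate:
  assumes "\<kappa> > 0" "y > 0"
  shows "isCont (gamma_rate \<kappa>) y"
  unfolding gamma_rate_def using assms by (intro continuous_intros) auto

text \<open>
  The entries \<open>d\<^sub>j\<close> and \<open>s\<^sub>j\<close> are the coordinates \<open>Inl j\<close> and \<open>Inr j\<close> of a single family, so that
  independence, compactness and cost are each expressed over one countable index set. The indices
  \<open>Inl 0\<close> and \<open>Inr 0\<close> carry no information.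
\<close>

type_synonym index = "nat + nat"

text \<open>
  The asymptotic shape parameter of a coordinate, divided by the speed.
\<close>

definition weight :: "real \<Rightarrow> index \<Rightarrow> real" where
  "weight \<tau> i = (case i of Inl _ \<Rightarrow> 1 | Inr _ \<Rightarrow> \<tau>)"

definition block :: "nat \<Rightarrow> index set" where
  "block n = {1..n} <+> {1..n}"

definition partial_cost :: "real \<Rightarrow> nat \<Rightarrow> (index \<Rightarrow> real) \<Rightarrow> real" where
  "partial_cost \<tau> n x = (\<Sum>i\<in>block n. gamma_rate (weight \<tau> i) ((x i)\<^sup>2))"

definition laguerre_moment :: "(index \<Rightarrow> real) \<Rightarrow> nat \<Rightarrow> real" where
  "laguerre_moment x r =
     jacobi_power (offdiag_coeff (x \<circ> Inl) (x \<circ> Inr)) (diag_coeff (x \<circ> Inl) (x \<circ> Inr)) r 0"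

lemma weight_pos: "\<tau> > 0 \<Longrightarrow> weight \<tau> i > 0"
  by (simp add: weight_def split: sum.split)

lemma coordinate_cost_nonneg: "\<tau> > 0 \<Longrightarrow> x i > 0 \<Longrightarrow> gamma_rate (weight \<tau> i) ((x i)\<^sup>2) \<ge> 0"
  by (intro gamma_rate_nonneg weight_pos) auto

lemma finite_block [simp]: "finite (block n)"
  by (simp add: block_def)

lemma block_mono: "n \<le> n' \<Longrightarrow> block n \<subseteq> block n'"
  by (auto simp: block_def)

lemma mem_block [simp]: "Inl k \<in> block n \<longleftrightarrow> 1 \<le> k \<and> k \<le> n" "Inr k \<in> block n \<longleftrightarrow> 1 \<le> k \<and> k \<le> n"
  by (auto simp: block_def)

lemma partial_cost_altdef:
  "partial_cost \<tau> n x = (\<Sum>k<n. gamma_rate 1 ((x (Inl (Suc k)))\<^sup>2) + gamma_rate \<tau> ((x (Inr (Suc k)))\<^sup>2))"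
proof -
  have "sum f {1..n} = (\<Sum>k<n. f (Suc k))" for f :: "nat \<Rightarrow> real"
    by (simp add: sum.atLeast1_atMost_eq)
  then show ?thesis
    by (simp add: partial_cost_def block_def sum.Plus weight_def sum.distrib)
qed

lemma partial_cost_mono:
  assumes "\<tau> > 0" "n \<le> n'" "\<And>i. i \<in> block n' \<Longrightarrow> x i > 0"
  shows "partial_cost \<tau> n x \<le> partial_cost \<tau> n' x"
  unfolding partial_cost_def using assms block_mono[of n n']
  by (intro sum_mono2 coordinate_cost_nonneg) auto

lemma gamma_rate_le_partial_cost:
  assumes "\<tau> > 0" "i \<in> block n" "\<And>i. i \<in> block n \<Longrightarrow> x i > 0"
  shows "gamma_rate (weight \<tau> i) ((x i)\<^sup>2) \<le> partial_cost \<tau> n x"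
  unfolding partial_cost_def
  by (rule member_le_sum[OF assms(2)]) (use assms in \<open>auto intro: coordinate_cost_nonneg\<close>)

lemma G_fun_eq: "d > 0 \<Longrightarrow> G_fun d = ereal (gamma_rate 1 (d\<^sup>2))"
  by (simp add: G_fun_def g_fun_def gamma_rate_def)

lemma weighted_G_fun_eq:
  assumes "s > 0" "\<tau> > 0"
  shows "ereal \<tau> * G_fun (s / sqrt \<tau>) = ereal (gamma_rate \<tau> (s\<^sup>2))"
proof -
  have "(s / sqrt \<tau>)\<^sup>2 = s\<^sup>2 / \<tau>"
    using assms by (simp add: power_divide)
  then show ?thesis
    using assms by (simp add: G_fun_def g_fun_def gamma_rate_def right_diff_distrib)
qed

lemma G_fun_nonneg: "G_fun x \<ge> 0"
proof (cases "x > 0")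
  case True
  then show ?thesis by (simp add: G_fun_eq gamma_rate_nonneg)
qed (simp add: G_fun_def)

lemma cost_eq_SUP:
  assumes "\<tau> > 0" and pos: "\<And>k. d (Suc k) > 0" "\<And>k. s (Suc k) > 0"
  shows "cost \<tau> d s = (SUP n. ereal (partial_cost \<tau> n (case_sum d s)))"
proof -
  have "cost \<tau> d s = (\<Sum>k. G_fun (d (Suc k))) + (\<Sum>k. ereal \<tau> * G_fun (s (Suc k) / sqrt \<tau>))"
    unfolding cost_def using assms G_fun_nonneg by (subst suminf_cmult_ereal) auto
  also have "\<dots> = (\<Sum>k. G_fun (d (Suc k)) + ereal \<tau> * G_fun (s (Suc k) / sqrt \<tau>))"
    using assms G_fun_nonneg by (intro suminf_add_ereal[symmetric] ereal_0_le_mult) auto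
  also have "\<dots> = (\<Sum>k. ereal (gamma_rate 1 ((d (Suc k))\<^sup>2) + gamma_rate \<tau> ((s (Suc k))\<^sup>2)))"
    by (simp only: G_fun_eq[OF pos(1)] weighted_G_fun_eq[OF pos(2) assms(1)] plus_ereal.simps)
  also have "\<dots> = (SUP n. \<Sum>k<n. ereal (gamma_rate 1 ((d (Suc k))\<^sup>2) + gamma_rate \<tau> ((s (Suc k))\<^sup>2)))"
  proof (intro suminf_ereal_eq_SUP)
    fix k
    have "0 \<le> gamma_rate 1 ((d (Suc k))\<^sup>2) + gamma_rate \<tau> ((s (Suc k))\<^sup>2)"
      by (intro add_nonneg_nonneg gamma_rate_nonneg zero_less_power assms) simp_all
    then show "0 \<le> ereal (gamma_rate 1 ((d (Suc k))\<^sup>2) + gamma_rate \<tau> ((s (Suc k))\<^sup>2))"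
      by simp
  qed
  also have "\<dots> = (SUP n. ereal (partial_cost \<tau> n (case_sum d s)))"
    by (simp add: partial_cost_altdef)
  finally show ?thesis .
qed

lemma cost_le_iff:
  assumes "\<tau> > 0" and pos: "\<And>k. d (Suc k) > 0" "\<And>k. s (Suc k) > 0"
  shows "cost \<tau> d s \<le> ereal c \<longleftrightarrow> (\<forall>n. partial_cost \<tau> n (case_sum d s) \<le> c)"
  by (simp add: cost_eq_SUP[of \<tau> d s, OF assms] SUP_le_iff)

lemma cost_nonneg: "\<tau> > 0 \<Longrightarrow> cost \<tau> d s \<ge> 0"
  unfolding cost_def by (intro add_nonneg_nonneg ereal_0_le_mult suminf_0_le G_fun_nonneg) auto

lemma cost_finite_imp_pos:
  assumes "\<tau> > 0" "cost \<tau> d s < \<infinity>"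
  shows "d (Suc k) > 0" "s (Suc k) > 0"
proof -
  have term_le: "f k \<le> suminf f" if "\<And>k. 0 \<le> f k" for f :: "nat \<Rightarrow> ereal"
  proof -
    have "f k \<le> (\<Sum>j<Suc k. f j)"
      using add_increasing[OF sum_nonneg[of "{..<k}" f] order_refl[of "f k"]] that by simp
    also have "\<dots> \<le> suminf f"
      by (rule suminf_upper) (rule that)
    finally show ?thesis .
  qed
  let ?A = "\<Sum>k. G_fun (d (Suc k))" and ?B = "\<Sum>k. G_fun (s (Suc k) / sqrt \<tau>)"
  have A: "?A \<ge> 0" and B: "?B \<ge> 0"
    by (auto intro!: suminf_0_le G_fun_nonneg)
  have "?A \<noteq> \<infinity>" "ereal \<tau> * ?B \<noteq> \<infinity>"
    using assms A B unfolding cost_def by auto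
  then have "?A \<noteq> \<infinity>" "?B \<noteq> \<infinity>"
    using assms by auto
  then have "G_fun (d (Suc k)) \<noteq> \<infinity>" "G_fun (s (Suc k) / sqrt \<tau>) \<noteq> \<infinity>"
    using term_le[of "\<lambda>k. G_fun (d (Suc k))"] term_le[of "\<lambda>k. G_fun (s (Suc k) / sqrt \<tau>)"] G_fun_nonneg
    by auto
  then show "d (Suc k) > 0" "s (Suc k) > 0"
    using assms by (auto simp: G_fun_def zero_less_divide_iff split: if_splits)
qed

lemma jacobi_measure_if_moments:
  assumes "\<nu> \<in> M_md" "\<And>r. r \<ge> 1 \<Longrightarrow> moment \<nu> r = tridiag_moment (tridiag (offdiag_coeff d s) (diag_coeff d s)) r"
    and "\<And>k. d (Suc k) > 0" "\<And>k. s (Suc k) > 0"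
  shows "jacobi_measure \<nu> (offdiag_coeff d s) (diag_coeff d s)"
proof
  show "moment \<nu> r = jacobi_power (offdiag_coeff d s) (diag_coeff d s) r 0" for r
    using assms by (cases r) (auto simp: tridiag_moment_eq jacobi_power_0 moment_0 M_md_def)
qed (use assms in \<open>auto simp: M_md_def offdiag_coeff_def\<close>)

text \<open>
  The moments determine the Jacobi coefficients, and from these the entries are obtained in the order
  \<open>d\<^sub>1, s\<^sub>1, d\<^sub>2, s\<^sub>2, \<dots>\<close>, using that they are positive.
\<close>

theorem encodes_unique:
  assumes "\<tau> > 0" "\<nu> \<in> M_md" "encodes \<tau> \<nu> d s" "encodes \<tau> \<nu> d' s'"
  shows "d = d' \<and> s = s'"
proof -
  have E: "d \<in> {1..} \<rightarrow>\<^sub>E {0..}" "s \<in> {1..} \<rightarrow>\<^sub>E {0..}" "d' \<in> {1..} \<rightarrow>\<^sub>E {0..}" "s' \<in> {1..} \<rightarrow>\<^sub>E {0..}"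
    "cost \<tau> d s < \<infinity>" "cost \<tau> d' s' < \<infinity>"
    using assms by (auto simp: encodes_def)
  note pos = cost_finite_imp_pos[OF assms(1) E(5)] and pos' = cost_finite_imp_pos[OF assms(1) E(6)]
  have "jacobi_measure \<nu> (offdiag_coeff d s) (diag_coeff d s)"
    "jacobi_measure \<nu> (offdiag_coeff d' s') (diag_coeff d' s')"
    using assms pos pos' by (auto intro!: jacobi_measure_if_moments simp: encodes_def)
  then have eq: "offdiag_coeff d s = offdiag_coeff d' s'" "diag_coeff d s = diag_coeff d' s'"
    using jacobi_coefficients_unique by auto
  have eq_s: "s (Suc k) = s' (Suc k)" if "d (Suc k) = d' (Suc k)" for k
    using fun_cong[OF eq(1), of k] that pos'[of k] by (simp add: offdiag_coeff_def)
  have eq_d: "d (Suc k) = d' (Suc k)" for k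
  proof (induction k)
    case 0
    show ?case
      using fun_cong[OF eq(2), of 0] pos(1)[of 0] pos'(1)[of 0]
      by (simp add: diag_coeff_def power2_eq_iff_nonneg)
  next
    case (Suc k)
    have "(d (Suc (Suc k)))\<^sup>2 = (d' (Suc (Suc k)))\<^sup>2"
      using fun_cong[OF eq(2), of "Suc k"] eq_s[OF Suc] by (simp add: diag_coeff_def)
    then show ?case
      using pos(1)[of "Suc k"] pos'(1)[of "Suc k"] by (simp add: power2_eq_iff_nonneg)
  qed
  have "d k = d' k" "s k = s' k" if "k \<in> {1..}" for k
    using eq_d[of "k - 1"] eq_s[of "k - 1"] that by auto
  then show ?thesis
    using E by (metis PiE_ext)
qed

lemma rate_w_eq_cost:
  assumes "\<tau> > 0" "\<nu> \<in> M_md" "encodes \<tau> \<nu> d s"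
  shows "rate_w \<tau> \<nu> = cost \<tau> d s"
proof -
  have "(THE c. \<exists>d s. encodes \<tau> \<nu> d s \<and> c = cost \<tau> d s) = cost \<tau> d s"
    using assms encodes_unique[OF assms(1,2)] by (intro the_equality) blast+
  then show ?thesis
    using assms unfolding rate_w_def by auto
qed

lemma rate_w_nonneg:
  assumes "\<tau> > 0" "\<nu> \<in> M_md"
  shows "rate_w \<tau> \<nu> \<ge> 0"
proof (cases "\<exists>d s. encodes \<tau> \<nu> d s")
  case True
  then show ?thesis using rate_w_eq_cost[OF assms] cost_nonneg[OF assms(1)] by auto
qed (simp add: rate_w_def)

text \<open>
  Describes the sublevel sets of the rate function by means of partial costs only, without reference
  to infinite sums or to the unique choice in the definition.
\<close>

lemma rate_w_le_iff:
  assumes "\<tau> > 0" "\<nu> \<in> M_md"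
  shows "rate_w \<tau> \<nu> \<le> ereal c \<longleftrightarrow>
    (\<exists>x. (\<forall>n. \<forall>i\<in>block n. x i > 0) \<and> (\<forall>r. moment \<nu> r = laguerre_moment x r) \<and>
         (\<forall>n. partial_cost \<tau> n x \<le> c))" (is "?L \<longleftrightarrow> ?R")
proof
  assume L: ?L
  then have "\<exists>d s. encodes \<tau> \<nu> d s"
    by (cases "\<exists>d s. encodes \<tau> \<nu> d s") (auto simp: rate_w_def)
  then obtain d s where ds: "encodes \<tau> \<nu> d s" by blast
  have fin: "cost \<tau> d s < \<infinity>" using ds by (simp add: encodes_def)
  note pos = cost_finite_imp_pos[OF assms(1) fin]
  have J: "jacobi_measure \<nu> (offdiag_coeff d s) (diag_coeff d s)"
    using assms pos ds by (auto intro!: jacobi_measure_if_moments simp: encodes_def)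
  show ?R
  proof (intro exI[of _ "case_sum d s"] conjI allI ballI)
    show "case_sum d s i > 0" if "i \<in> block n" for n i
      using pos(1)[of "projl i - 1"] pos(2)[of "projr i - 1"] that by (cases i) auto
    show "moment \<nu> r = laguerre_moment (case_sum d s) r" for r
      using jacobi_measure.moments[OF J] by (simp add: laguerre_moment_def case_sum_o_inj)
    show "partial_cost \<tau> n (case_sum d s) \<le> c" for n
      using L rate_w_eq_cost[OF assms ds] cost_le_iff[of \<tau> d s, OF assms(1) pos] by simp
  qed
next
  assume ?R
  then obtain x where x: "\<And>n i. i \<in> block n \<Longrightarrow> x i > 0" "\<And>r. moment \<nu> r = laguerre_moment x r"
      "\<And>n. partial_cost \<tau> n x \<le> c"
    by blast
  define d s where "d = restrict (x \<circ> Inl) {1..}" and "s = restrict (x \<circ> Inr) {1..}"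
  have pos: "d (Suc k) > 0" "s (Suc k) > 0" for k
    using x(1)[of "Inl (Suc k)" "Suc k"] x(1)[of "Inr (Suc k)" "Suc k"] by (auto simp: d_def s_def)
  have "partial_cost \<tau> n (case_sum d s) = partial_cost \<tau> n x" for n
    by (simp add: partial_cost_altdef d_def s_def)
  then have cost: "cost \<tau> d s \<le> ereal c"
    using cost_le_iff[of \<tau> d s, OF assms(1) pos] x(3) by simp
  have "offdiag_coeff d s = offdiag_coeff (x \<circ> Inl) (x \<circ> Inr)"
      "diag_coeff d s = diag_coeff (x \<circ> Inl) (x \<circ> Inr)"
    by (auto simp: fun_eq_iff offdiag_coeff_def diag_coeff_def d_def s_def)
  moreover have "d \<in> {1..} \<rightarrow>\<^sub>E {0..}" "s \<in> {1..} \<rightarrow>\<^sub>E {0..}"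
  proof -
    have "0 \<le> x (Inl k)" "0 \<le> x (Inr k)" if "k \<ge> 1" for k
      using x(1)[of "Inl k" k] x(1)[of "Inr k" k] that by auto
    then show "d \<in> {1..} \<rightarrow>\<^sub>E {0..}" "s \<in> {1..} \<rightarrow>\<^sub>E {0..}"
      by (auto simp: d_def s_def)
  qed
  moreover have "cost \<tau> d s < \<infinity>"
    using cost by (rule order.strict_trans1) simp
  ultimately have "encodes \<tau> \<nu> d s"
    using x(2) by (simp add: encodes_def tridiag_moment_eq laguerre_moment_def)
  then show ?L
    using rate_w_eq_cost[OF assms] cost by simp
qed

text \<open>
  Each coordinate is confined to a compact interval of positive numbers that depends only on \<open>c\<close>, so
  the sequence lies in a compact metrizable product. The hypothesis on \<open>X n\<close> concerns the first \<open>n\<close> pairs of coordinates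
  only, since an ensemble of finite size has finitely many entries.
\<close>

theorem sublevel_subsequence:
  fixes X :: "nat \<Rightarrow> index \<Rightarrow> real"
  assumes "\<tau> > 0" and pos: "\<And>n i. i \<in> block n \<Longrightarrow> X n i > 0"
    and le: "\<And>n. partial_cost \<tau> n (X n) \<le> c"
  obtains \<rho> :: "nat \<Rightarrow> nat" and x where "strict_mono \<rho>"
    "\<And>n i. i \<in> block n \<Longrightarrow> x i > 0" "\<And>n i. i \<in> block n \<Longrightarrow> (\<lambda>k. X (\<rho> k) i) \<longlonglongrightarrow> x i"
    "\<And>n. partial_cost \<tau> n x \<le> c"
proof -
  \<comment> \<open>Filling up with the minimisers, which cost nothing, extends the bound to all coordinates.\<close>
  define Y where "Y n i = (if i \<in> block n then X n i else sqrt (weight \<tau> i))" for n i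
  define S where "S i = {sqrt (weight \<tau> i * exp (- (weight \<tau> i + c) / weight \<tau> i)) .. sqrt (2 * (c + weight \<tau> i))}" for i
  have c: "c \<ge> 0"
    using le[of 0] by (simp add: partial_cost_altdef)
  have Y_pos: "Y n i > 0" for n i
    using pos[of i n] weight_pos[OF assms(1), of i] by (simp add: Y_def)
  have Y_S: "Y n i \<in> S i" for n i
  proof -
    have "gamma_rate (weight \<tau> i) ((Y n i)\<^sup>2) \<le> c"
    proof (cases "i \<in> block n")
      case True
      then show ?thesis
        using gamma_rate_le_partial_cost[of \<tau> i n "X n"] pos assms(1) le[of n] by (simp add: Y_def)
    next
      case False
      then show ?thesis using weight_pos[OF assms(1), of i] c by (simp add: Y_def gamma_rate_self)
    qed
    then have "weight \<tau> i * exp (- (weight \<tau> i + c) / weight \<tau> i) \<le> (Y n i)\<^sup>2" "(Y n i)\<^sup>2 \<le> 2 * (c + weight \<tau> i)"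
      using gamma_rate_le_imp_bounds[of "weight \<tau> i" "(Y n i)\<^sup>2" c] weight_pos[OF assms(1), of i] Y_pos[of n i]
      by auto
    then show ?thesis
      using Y_pos[of n i] by (auto simp: S_def intro: real_le_lsqrt real_le_rsqrt)
  qed
  have "compactin (product_topology (\<lambda>_. euclidean) UNIV) (PiE UNIV S)"
    by (simp add: compactin_PiE S_def)
  then have "compact (PiE UNIV S)"
    by (simp add: euclidean_product_topology)
  moreover have "Y n \<in> PiE UNIV S" for n
    using Y_S by (simp add: PiE_UNIV_domain)
  ultimately obtain x \<rho> where x: "x \<in> PiE UNIV S" and \<rho>: "strict_mono (\<rho> :: nat \<Rightarrow> nat)"
    and lim: "(Y \<circ> \<rho>) \<longlonglongrightarrow> x"
    unfolding compact_eq_seq_compact_metric seq_compact_def by metis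
  have lim_i: "(\<lambda>k. Y (\<rho> k) i) \<longlonglongrightarrow> x i" for i
    using continuous_on_tendsto_compose[OF continuous_on_product_coordinates[of i] lim] by simp
  have x_pos: "x i > 0" for i
  proof -
    have "0 < sqrt (weight \<tau> i * exp (- (weight \<tau> i + c) / weight \<tau> i))"
      using weight_pos[OF assms(1), of i] by simp
    also have "\<dots> \<le> x i" using x by (auto simp: S_def PiE_UNIV_domain)
    finally show ?thesis .
  qed
  then have x_nz: "x i \<noteq> 0" for i
    by (metis less_irrefl)
  have ev_block: "\<forall>\<^sub>F k in sequentially. i \<in> block (\<rho> k)" if "i \<in> block n" for n i
    using eventually_ge_at_top[of n]
  proof eventually_elim
    case (elim k)
    then show ?case
      using that block_mono[of n "\<rho> k"] seq_suble[OF \<rho>, of k] by auto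
  qed
  show ?thesis
  proof (rule that[OF \<rho>])
    show "x i > 0" if "i \<in> block n" for n i by (rule x_pos)
    show "(\<lambda>k. X (\<rho> k) i) \<longlonglongrightarrow> x i" if "i \<in> block n" for n i
      using lim_i[of i]
      by (rule Lim_transform_eventually) (use ev_block[OF that] in eventually_elim, simp add: Y_def)
    show "partial_cost \<tau> n x \<le> c" for n
    proof (rule LIMSEQ_le_const2)
      show "(\<lambda>k. partial_cost \<tau> n (Y (\<rho> k))) \<longlonglongrightarrow> partial_cost \<tau> n x"
        unfolding partial_cost_def
        using weight_pos[OF assms(1)] x_nz
        by (intro tendsto_sum isCont_tendsto_compose[OF continuous_gamma_rate] tendsto_power lim_i) auto
      show "\<exists>K. \<forall>k\<ge>K. partial_cost \<tau> n (Y (\<rho> k)) \<le> c"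
      proof (intro exI allI impI)
        fix k
        assume "n \<le> k"
        then have nk: "n \<le> \<rho> k" using seq_suble[OF \<rho>, of k] by simp
        have "partial_cost \<tau> n (Y (\<rho> k)) = partial_cost \<tau> n (X (\<rho> k))"
          unfolding partial_cost_def using block_mono[OF nk] by (intro sum.cong) (auto simp: Y_def)
        also have "\<dots> \<le> partial_cost \<tau> (\<rho> k) (X (\<rho> k))"
          using assms(1) nk pos by (rule partial_cost_mono)
        finally show "partial_cost \<tau> n (Y (\<rho> k)) \<le> c" using le[of "\<rho> k"] by simp
      qed
    qed
  qed
qed

lemma tendsto_laguerre_moment:
  assumes "\<And>n i. i \<in> block n \<Longrightarrow> ((\<lambda>k. X k i) \<longlongrightarrow> x i) F"
  shows "((\<lambda>k. laguerre_moment (X k) r) \<longlongrightarrow> laguerre_moment x r) F"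
proof -
  have "((\<lambda>n. X n (Inl (Suc k))) \<longlongrightarrow> x (Inl (Suc k))) F" "((\<lambda>n. X n (Inr (Suc k))) \<longlongrightarrow> x (Inr (Suc k))) F" for k
    by (auto intro: assms[of _ "Suc k"])
  note lim = this
  have "((\<lambda>n. X n (Inr k)) \<longlongrightarrow> x (Inr k)) F" if "k \<noteq> 0" for k
    using lim(2)[of "k - 1"] that by simp
  then show ?thesis
    unfolding laguerre_moment_def
    using lim by (intro tendsto_jacobi_power) (auto simp: offdiag_coeff_def diag_coeff_def intro!: tendsto_intros)
qed

text \<open>
  The costs of the coordinates form a convergent series and tend to \<open>0\<close>. A number \<open>t\<close> strictly between
  \<open>\<tau>\<close> and \<open>1\<close> then separates \<open>s\<^sub>k\<^sup>2\<close> from \<open>d\<^sub>k\<^sup>2\<close>: crossing it would cost a fixed positive amount.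
\<close>

lemma finite_cost_eventually_s_le_d:
  assumes \<tau>: "0 < \<tau>" "\<tau> < 1" and pos: "\<And>n i. i \<in> block n \<Longrightarrow> x i > 0"
    and le: "\<And>n. partial_cost \<tau> n x \<le> c"
  shows "\<forall>\<^sub>F k in sequentially. x (Inr (Suc k)) \<le> x (Inl (Suc k))"
proof -
  have p: "x (Inl (Suc k)) > 0" "x (Inr (Suc k)) > 0" for k
    by (auto intro: pos[of _ "Suc k"])
  define f where "f k = gamma_rate 1 ((x (Inl (Suc k)))\<^sup>2)" for k
  define h where "h k = gamma_rate \<tau> ((x (Inr (Suc k)))\<^sup>2)" for k
  have nonneg: "f k \<ge> 0" "h k \<ge> 0" for k
    using p \<tau> by (auto simp: f_def h_def intro!: gamma_rate_nonneg zero_less_power)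
  have "summable (\<lambda>k. f k + h k)"
    using nonneg le by (intro bounded_imp_summable[of _ c])
      (auto simp: partial_cost_altdef f_def h_def lessThan_Suc_atMost[symmetric] intro: add_nonneg_nonneg simp del: sum.lessThan_Suc)
  then have lim: "(\<lambda>k. f k + h k) \<longlonglongrightarrow> 0"
    by (rule summable_LIMSEQ_zero)
  define t where "t = (1 + \<tau>) / 2"
  have t: "0 < t" "\<tau> < t" "t < 1" using \<tau> by (auto simp: t_def)
  have "\<forall>\<^sub>F k in sequentially. f k + h k < gamma_rate 1 t" "\<forall>\<^sub>F k in sequentially. f k + h k < gamma_rate \<tau> t"
    using t \<tau> by (auto intro!: order_tendstoD(2)[OF lim] gamma_rate_pos)
  then show ?thesis
  proof eventually_elim
    case (elim k)
    have "t \<le> (x (Inl (Suc k)))\<^sup>2"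
    proof (rule ccontr)
      assume "\<not> ?thesis"
      then have "gamma_rate 1 t \<le> f k"
        unfolding f_def using t p(1)[of k] by (intro gamma_rate_mono_away mult_nonpos_nonpos) auto
      then show False using elim nonneg[of k] by simp
    qed
    moreover have "(x (Inr (Suc k)))\<^sup>2 \<le> t"
    proof (rule ccontr)
      assume "\<not> ?thesis"
      then have "gamma_rate \<tau> t \<le> h k"
        unfolding h_def using t \<tau> p(2)[of k] by (intro gamma_rate_mono_away mult_nonneg_nonneg) auto
      then show False using elim nonneg[of k] by simp
    qed
    ultimately have "(x (Inr (Suc k)))\<^sup>2 \<le> (x (Inl (Suc k)))\<^sup>2"
      by simp
    then show ?case
      using p(1)[of k] by (rule power2_le_imp_le[OF _ less_imp_le])
  qed
qed

text \<open>
  Provides limits in the space of measures. That space is not complete, and the finite cost is what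
  puts the limit into it: bounded entries make the measure determinate, and \<open>\<tau> < 1\<close> excludes an atom at
  \<open>0\<close>.
\<close>

theorem laguerre_limit_measure:
  assumes \<tau>: "0 < \<tau>" "\<tau> < 1"
    and \<mu>: "\<And>n. \<mu> n \<in> M_md" "\<And>n r. moment (\<mu> n) r = laguerre_moment (X n) r"
    and lim: "\<And>n i. i \<in> block n \<Longrightarrow> (\<lambda>k. X k i) \<longlonglongrightarrow> x i"
    and pos: "\<And>n i. i \<in> block n \<Longrightarrow> x i > 0"
    and le: "\<And>n. partial_cost \<tau> n x \<le> c"
  shows "\<exists>\<nu>\<in>M_md. rate_w \<tau> \<nu> \<le> ereal c \<and> limitin moment_topology \<mu> \<nu> sequentially"
proof -
  have mom_lim: "(\<lambda>n. moment (\<mu> n) r) \<longlonglongrightarrow> laguerre_moment x r" for r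
    unfolding \<mu>(2) using lim by (rule tendsto_laguerre_moment)
  have nonneg_AE: "AE y in \<mu> n. 0 \<le> y" for n
  proof -
    interpret real_distribution "\<mu> n"
      using \<mu>(1)[of n] by (intro borel_prob_real_distribution) (simp add: M_md_def)
    have "AE y in \<mu> n. y \<in> {0<..}"
      using \<mu>(1)[of n] by (intro AE_prob_1) (simp add: M_md_def)
    then show ?thesis by eventually_elim simp
  qed
  obtain \<nu> where \<nu>: "borel_prob \<nu>" "moments_finite \<nu>" "AE y in \<nu>. 0 \<le> y" and
      mom: "\<And>r. moment \<nu> r = laguerre_moment x r"
    using moment_sequence_limit[of \<mu> "laguerre_moment x"] \<mu>(1) nonneg_AE mom_lim
    by (auto simp: M_md_def)
  interpret real_distribution \<nu>
    using \<nu>(1) by (rule borel_prob_real_distribution)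
  let ?d = "x \<circ> Inl" and ?s = "x \<circ> Inr"
  have p: "?d (Suc k) > 0" "?s (Suc k) > 0" for k
    using pos[of "Inl (Suc k)" "Suc k"] pos[of "Inr (Suc k)" "Suc k"] by auto
  have c: "c \<ge> 0" using le[of 0] by (simp add: partial_cost_altdef)
  \<comment> \<open>Each squared entry is at most \<open>K / 2\<close>, as the weights are at most \<open>1\<close>; so \<open>K\<close> bounds the entries of the Jacobi matrix.\<close>
  define K where "K = 4 * (c + 1)"
  have sq: "(?d (Suc k))\<^sup>2 \<le> K / 2" "(?s (Suc k))\<^sup>2 \<le> K / 2" for k
  proof -
    have "(x i)\<^sup>2 \<le> 2 * (c + weight \<tau> i)" if "i \<in> block n" for i n
    proof (rule gamma_rate_le_imp_bounds(2))
      show "gamma_rate (weight \<tau> i) ((x i)\<^sup>2) \<le> c"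
        using gamma_rate_le_partial_cost[of \<tau> i n x, OF \<tau>(1) that] pos le[of n] by (meson order_trans)
      show "(x i)\<^sup>2 > 0" using pos[OF that] by simp
    qed (rule weight_pos[OF \<tau>(1)])
    from this[of "Inl (Suc k)" "Suc k"] this[of "Inr (Suc k)" "Suc k"]
    show "(?d (Suc k))\<^sup>2 \<le> K / 2" "(?s (Suc k))\<^sup>2 \<le> K / 2"
      using \<tau> by (auto simp: K_def weight_def)
  qed
  have "\<bar>offdiag_coeff ?d ?s k\<bar> \<le> K" for k
  proof -
    have "\<bar>offdiag_coeff ?d ?s k\<bar> = ?s (Suc k) * ?d (Suc k)"
      using p[of k] by (simp add: offdiag_coeff_def)
    also have "\<dots> \<le> (?s (Suc k))\<^sup>2 + (?d (Suc k))\<^sup>2"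
      using sum_squares_bound[of "?s (Suc k)" "?d (Suc k)"] p[of k] mult_pos_pos[OF p(2,1)[of k]]
      by linarith
    finally show ?thesis using sq[of k] by linarith
  qed
  moreover have "\<bar>diag_coeff ?d ?s k\<bar> \<le> K" for k
  proof (cases k)
    case 0
    then show ?thesis using sq(1)[of 0] c by (simp add: diag_coeff_def K_def)
  next
    case (Suc j)
    then show ?thesis using sq(1)[of k] sq(2)[of j] by (simp add: diag_coeff_def)
  qed
  ultimately have "\<bar>laguerre_moment x r\<bar> \<le> (3 * K) ^ r" for r
    unfolding laguerre_moment_def by (rule abs_jacobi_power_le)
  then have det: "moment_determinate \<nu>"
    by (intro moment_determinate_if_moments_le_power[where C = "3 * K"] \<nu>) (simp add: mom abs_le_iff)
  have J: "jacobi_measure \<nu> (offdiag_coeff ?d ?s) (diag_coeff ?d ?s)"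
    using \<nu> p mom by unfold_locales (auto simp: offdiag_coeff_def laguerre_moment_def)
  have "measure \<nu> {0} = 0"
    using J p by (rule laguerre_no_atom_at_0) (use finite_cost_eventually_s_le_d[OF \<tau> pos le] in simp)
  then have "AE y in \<nu>. y \<notin> {0}"
    by (subst AE_iff_measurable[of "{0}"]) (auto simp: emeasure_eq_measure)
  with \<nu>(3) have "AE y in \<nu>. y \<in> {0<..}" by eventually_elim auto
  then have "measure \<nu> {0<..} = 1" by (subst prob_eq_1) auto
  then have M: "\<nu> \<in> M_md" using \<nu> det by (simp add: M_md_def)
  have "rate_w \<tau> \<nu> \<le> ereal c"
    using rate_w_le_iff[OF \<tau>(1) M] pos mom le by blast
  moreover have "limitin moment_topology \<mu> \<nu> sequentially"
    using \<mu>(1) M mom_lim by (intro limitin_moment_topology) (simp_all add: mom)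
  ultimately show ?thesis
    using M by blast
qed

section \<open>The large deviation principle\<close>

lemma laguerre_matrix_cong:
  assumes "\<And>j. j \<in> {1..m} \<Longrightarrow> d j = d' j" "\<And>j. j \<in> {1..<m} \<Longrightarrow> s j = s' j"
  shows "laguerre_matrix m d s = laguerre_matrix m d' s'"
proof -
  have "lower_bidiagonal m d s = lower_bidiagonal m d' s'"
    using assms by (intro eq_matI) (auto simp: lower_bidiagonal_def)
  then show ?thesis by (simp add: laguerre_matrix_def)
qed

text \<open>
  Sequential compactness, from the compactness of the entries and the continuity of the passage from
  entries to measures.
\<close>

lemma compactin_rate_w_sublevel:
  assumes \<tau>: "0 < \<tau>" "\<tau> < 1"
  shows "compactin moment_topology {\<nu> \<in> M_md. rate_w \<tau> \<nu> \<le> ereal c}"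
  unfolding moment_topology_def M_md.compactin_sequentially
proof (intro conjI allI impI)
  fix \<sigma> :: "nat \<Rightarrow> real measure"
  assume range: "range \<sigma> \<subseteq> {\<nu> \<in> M_md. rate_w \<tau> \<nu> \<le> ereal c}"
  then have \<sigma>: "\<sigma> n \<in> M_md" "rate_w \<tau> (\<sigma> n) \<le> ereal c" for n by auto
  have "\<exists>X. (\<forall>k. \<forall>i\<in>block k. X i > 0) \<and> (\<forall>r. moment (\<sigma> n) r = laguerre_moment X r) \<and>
         (\<forall>k. partial_cost \<tau> k X \<le> c)" for n
    using rate_w_le_iff[OF \<tau>(1) \<sigma>(1)[of n]] \<sigma>(2)[of n] by blast
  then obtain X where X: "\<And>n k i. i \<in> block k \<Longrightarrow> X n i > 0"
      "\<And>n r. moment (\<sigma> n) r = laguerre_moment (X n) r" "\<And>n k. partial_cost \<tau> k (X n) \<le> c"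
    by metis
  obtain \<rho> x where \<rho>: "strict_mono (\<rho> :: nat \<Rightarrow> nat)"
    and x: "\<And>n i. i \<in> block n \<Longrightarrow> x i > 0" "\<And>n i. i \<in> block n \<Longrightarrow> (\<lambda>k. X (\<rho> k) i) \<longlonglongrightarrow> x i"
      "\<And>n. partial_cost \<tau> n x \<le> c"
    using sublevel_subsequence[of \<tau> X c] \<tau>(1) X(1,3) by blast
  have "\<exists>\<nu>\<in>M_md. rate_w \<tau> \<nu> \<le> ereal c \<and> limitin moment_topology (\<lambda>n. \<sigma> (\<rho> n)) \<nu> sequentially"
    by (rule laguerre_limit_measure[where X = "\<lambda>n. X (\<rho> n)" and x = x])
      (rule \<tau> \<sigma>(1) X(2) x | assumption)+
  then obtain \<nu> where "\<nu> \<in> M_md" "rate_w \<tau> \<nu> \<le> ereal c" "limitin moment_topology (\<lambda>n. \<sigma> (\<rho> n)) \<nu> sequentially"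
    by blast
  then show "\<exists>l r. l \<in> {\<nu> \<in> M_md. rate_w \<tau> \<nu> \<le> ereal c} \<and> strict_mono r \<and>
      limitin M_md.mtopology (\<sigma> \<circ> r) l sequentially"
    using \<rho> by (intro exI[of _ \<nu>] exI[of _ \<rho>]) (simp add: o_def moment_topology_def)
qed auto

lemma good_rate_function_rate_w:
  assumes \<tau>: "0 < \<tau>" "\<tau> < 1"
  shows "good_rate_function moment_topology (rate_w \<tau>)"
proof -
  have "closedin moment_topology {\<nu> \<in> M_md. rate_w \<tau> \<nu> \<le> ereal c}" for c
    using compactin_rate_w_sublevel[OF \<tau>, of c] M_md.Hausdorff_space_mtopology
    unfolding moment_topology_def by (intro compactin_imp_closedin)
  then show ?thesis
    using compactin_rate_w_sublevel[OF \<tau>] rate_w_nonneg[OF \<tau>(1)] by (simp add: good_rate_function_def)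
qed

lemma scaled_log_prob_le:
  assumes "n > 0" "p \<le> exp (- n * a)"
  shows "ereal (1 / n) * log_prob p \<le> ereal (- a)"
proof (cases "p > 0")
  case True
  then have "ln p \<le> - n * a"
    using assms by (metis ln_exp ln_le_cancel_iff exp_gt_zero)
  then have "ln p / n \<le> - a"
    using assms by (simp add: field_simps)
  then show ?thesis using True by (simp add: log_prob_def)
qed (use assms in \<open>simp add: log_prob_def\<close>)

lemma scaled_log_prob_ge:
  assumes "n > 0" "exp (- n * a) \<le> p"
  shows "ereal (- a) \<le> ereal (1 / n) * log_prob p"
proof -
  have "p > 0" using assms(2) exp_gt_zero[of "- n * a"] by linarith
  then have "- n * a \<le> ln p"
    using assms by (metis ln_exp ln_le_cancel_iff exp_gt_zero)
  then have "- a \<le> ln p / n"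
    using assms by (simp add: field_simps)
  then show ?thesis using \<open>p > 0\<close> by (simp add: log_prob_def)
qed

locale laguerre_ensemble =
  fixes \<beta> \<tau> :: real
    and m :: "nat \<Rightarrow> nat"
    and P :: "nat \<Rightarrow> 'a measure"
    and d s :: "nat \<Rightarrow> nat \<Rightarrow> 'a \<Rightarrow> real"
    and \<mu> :: "nat \<Rightarrow> 'a \<Rightarrow> real measure"
  assumes \<beta>: "\<beta> > 0" and \<tau>: "0 < \<tau>" "\<tau> < 1"
    and m_eq: "\<And>N. m N = nat \<lfloor>\<tau> * real N\<rfloor>"
    and entries: "\<And>N. laguerre_entries \<beta> N (m N) (P N) (d N) (s N)"
    and spectral: "\<And>N \<omega>. \<omega> \<in> space (P N) \<Longrightarrow>
           is_spectral_measure (laguerre_matrix (m N) (\<lambda>j. d N j \<omega>) (\<lambda>j. s N j \<omega>))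
             (unit_vec (m N) 0) (\<mu> N \<omega>)"
begin

definition speed :: "nat \<Rightarrow> real" where "speed N = \<beta> / 2 * real N"

definition used :: "nat \<Rightarrow> index set" where "used N = {1..m N} <+> {1..<m N}"

text \<open>
  Indices outside the ensemble get the value \<open>0\<close>. This makes the infinite Jacobi matrix of the entries
  split after \<open>m N\<close> coordinates.
\<close>

definition entry :: "nat \<Rightarrow> 'a \<Rightarrow> index \<Rightarrow> real" where
  "entry N \<omega> i = (if i \<in> used N then case_sum (d N) (s N) i \<omega> else 0)"

definition shape :: "nat \<Rightarrow> index \<Rightarrow> real" where
  "shape N i = (case i of Inl j \<Rightarrow> \<beta> / 2 * (real N + 1 - real j) | Inr j \<Rightarrow> \<beta> / 2 * (real (m N) - real j))"

lemma prob_space_P: "prob_space (P N)"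
  using entries[of N] by (simp add: laguerre_entries_def)

lemma mem_used [simp]: "Inl j \<in> used N \<longleftrightarrow> 1 \<le> j \<and> j \<le> m N" "Inr j \<in> used N \<longleftrightarrow> 1 \<le> j \<and> j < m N"
  by (auto simp: used_def)

lemma block_subset_used: "k < m N \<Longrightarrow> block k \<subseteq> used N"
  by (auto simp: used_def block_def)

lemma entry_pos: "\<omega> \<in> space (P N) \<Longrightarrow> i \<in> used N \<Longrightarrow> entry N \<omega> i > 0"
  using entries[of N] by (cases i) (auto simp: entry_def laguerre_entries_def)

lemma indep_entries:
  "J \<subseteq> used N \<Longrightarrow> prob_space.indep_vars (P N) (\<lambda>_. borel) (\<lambda>i \<omega>. entry N \<omega> i) J"
proof -
  interpret prob_space "P N" by (rule prob_space_P)
  assume "J \<subseteq> used N"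
  moreover have "indep_vars (\<lambda>_. borel) (case_sum (d N) (s N)) (used N)"
    using entries[of N] by (simp add: laguerre_entries_def used_def)
  ultimately have "indep_vars (\<lambda>_. borel) (case_sum (d N) (s N)) J"
    by (meson indep_vars_subset)
  moreover have "indep_vars (\<lambda>_. borel) (case_sum (d N) (s N)) J \<longleftrightarrow>
      indep_vars (\<lambda>_. borel) (\<lambda>i \<omega>. entry N \<omega> i) J"
    using \<open>J \<subseteq> used N\<close> by (intro indep_vars_cong) (auto simp: entry_def fun_eq_iff)
  ultimately show ?thesis by simp
qed

lemma measurable_entry [measurable]: "(\<lambda>\<omega>. entry N \<omega> i) \<in> borel_measurable (P N)"
proof (cases "i \<in> used N")
  case True
  interpret prob_space "P N" by (rule prob_space_P)
  show ?thesis using indep_entries[of "used N" N] True by (simp add: indep_vars_def)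
qed (simp add: entry_def)

lemma measurable_partial_cost [measurable]:
  "(\<lambda>\<omega>. partial_cost \<tau> k (entry N \<omega>)) \<in> borel_measurable (P N)"
  unfolding partial_cost_def by measurable

lemma moment_spectral:
  assumes "m N \<ge> 1" "\<omega> \<in> space (P N)"
  shows "\<mu> N \<omega> \<in> M_md" "moment (\<mu> N \<omega>) r = laguerre_moment (entry N \<omega>) r"
proof -
  have "laguerre_matrix (m N) (\<lambda>j. d N j \<omega>) (\<lambda>j. s N j \<omega>) =
      laguerre_matrix (m N) (entry N \<omega> \<circ> Inl) (entry N \<omega> \<circ> Inr)"
    by (rule laguerre_matrix_cong) (auto simp: entry_def)
  then have spec: "is_spectral_measure (laguerre_matrix (m N) (entry N \<omega> \<circ> Inl) (entry N \<omega> \<circ> Inr))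
      (unit_vec (m N) 0) (\<mu> N \<omega>)"
    using spectral[OF assms(2)] by simp
  have d: "(entry N \<omega> \<circ> Inl) j > 0" if "j \<in> {1..m N}" for j
    using entry_pos[OF assms(2), of "Inl j"] that by simp
  have s: "(entry N \<omega> \<circ> Inr) j = 0" if "m N \<le> j" for j
    using that by (simp add: entry_def)
  show "\<mu> N \<omega> \<in> M_md"
    by (rule laguerre_spectral_measure(1)[OF assms(1) spec d s])
  show "moment (\<mu> N \<omega>) r = laguerre_moment (entry N \<omega>) r"
    unfolding laguerre_moment_def by (rule laguerre_spectral_measure(2)[OF assms(1) spec d s])
qed

lemma filterlim_speed: "filterlim speed at_top sequentially"
  unfolding speed_def using \<beta>
  by (intro filterlim_tendsto_pos_mult_at_top[OF tendsto_const] filterlim_real_sequentially) auto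

lemma m_ratio: "(\<lambda>N. real (m N) / real N) \<longlonglongrightarrow> \<tau>"
proof (rule tendsto_sandwich)
  show "(\<lambda>N. \<tau> - 1 / real N) \<longlonglongrightarrow> \<tau>"
    using tendsto_diff[OF tendsto_const lim_const_over_n[of 1], of \<tau>] by simp
  have "real (m N) \<le> \<tau> * N" "\<tau> * N - 1 \<le> real (m N)" for N
    using \<tau> by (simp_all add: m_eq) 
  then show "\<forall>\<^sub>F N in sequentially. \<tau> - 1 / real N \<le> real (m N) / real N"
    "\<forall>\<^sub>F N in sequentially. real (m N) / real N \<le> \<tau>"
    by (auto intro!: eventually_mono[OF eventually_gt_at_top[of 0]] simp: field_simps)
qed simp

lemma eventually_m_gt: "\<forall>\<^sub>F N in sequentially. k < m N"
proof -
  have "filterlim (\<lambda>N. real (m N) / real N * real N) at_top sequentially"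
    using filterlim_tendsto_pos_mult_at_top[OF m_ratio \<tau>(1) filterlim_real_sequentially] .
  then have "\<forall>\<^sub>F N in sequentially. real k < real (m N) / real N * real N"
    by (simp add: filterlim_at_top_dense)
  then show ?thesis
    using eventually_gt_at_top[of 0] by eventually_elim simp
qed

lemma shape_ratio: "(\<lambda>N. shape N i / speed N) \<longlonglongrightarrow> weight \<tau> i"
proof (cases i)
  case (Inl j)
  have "(\<lambda>N. 1 + (1 - real j) / real N) \<longlonglongrightarrow> 1 + 0"
    by (intro tendsto_intros)
  then have "(\<lambda>N. 1 + (1 - real j) / real N) \<longlonglongrightarrow> 1" by simp
  then show ?thesis
    unfolding Inl weight_def sum.case
    by (rule Lim_transform_eventually)
      (use eventually_gt_at_top[of "0::nat"] in \<open>eventually_elim, insert \<beta>, simp add: shape_def speed_def field_simps\<close>)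
next
  case (Inr j)
  have "(\<lambda>N. real (m N) / real N - real j / real N) \<longlonglongrightarrow> \<tau> - 0"
    by (intro tendsto_intros m_ratio)
  then have "(\<lambda>N. real (m N) / real N - real j / real N) \<longlonglongrightarrow> \<tau>" by simp
  then show ?thesis
    unfolding Inr weight_def sum.case
    by (rule Lim_transform_eventually)
      (use eventually_gt_at_top[of "0::nat"] in \<open>eventually_elim, insert \<beta>, simp add: shape_def speed_def field_simps\<close>)
qed

lemma distributed_entry:
  assumes "i \<in> used N"
  shows "distributed (P N) lborel (\<lambda>\<omega>. (entry N \<omega> i)\<^sup>2)
     (\<lambda>y. ennreal (gamma_density (shape N i) (inverse (speed N)) y))"
  using entries[of N] assms
  by (cases i) (auto simp: entry_def laguerre_entries_def shape_def speed_def)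

lemma eventually_distributed_entry:
  assumes "i \<in> block k"
  shows "\<forall>\<^sub>F N in sequentially. distributed (P N) lborel (\<lambda>\<omega>. (entry N \<omega> i)\<^sup>2)
     (\<lambda>y. ennreal (gamma_density (shape N i) (inverse (speed N)) y))"
  using eventually_m_gt[of k]
  by eventually_elim (use assms block_subset_used in \<open>auto intro: distributed_entry\<close>)

lemma entry_near_prob_ge:
  assumes i: "i \<in> block k" and x: "x > 0" and "\<delta> > 0" "\<epsilon> > 0"
  shows "\<forall>\<^sub>F N in sequentially. exp (- speed N * (gamma_rate (weight \<tau> i) (x\<^sup>2) + \<epsilon>)) \<le>
           measure (P N) {\<omega> \<in> space (P N). \<bar>entry N \<omega> i - x\<bar> < \<delta>}"
proof -
  \<comment> \<open>The first bound on \<open>q\<close> keeps the entry within \<open>\<delta>\<close> of \<open>x\<close>, the second bounds the loss in the exponent.\<close>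
  define q where "q = min ((x + \<delta> / 2)\<^sup>2) (x\<^sup>2 + \<epsilon> / 2)"
  have "x\<^sup>2 < (x + \<delta> / 2)\<^sup>2"
    using x \<open>\<delta> > 0\<close> by (intro power_strict_mono) auto
  then have q: "x\<^sup>2 < q" "q \<le> (x + \<delta> / 2)\<^sup>2" "q - x\<^sup>2 \<le> \<epsilon> / 2"
    using \<open>\<epsilon> > 0\<close> min.cobounded2[of "(x + \<delta> / 2)\<^sup>2" "x\<^sup>2 + \<epsilon> / 2"]
    unfolding q_def by (simp, simp, linarith)
  have "\<forall>\<^sub>F N in sequentially.
      exp (- speed N * (gamma_rate (weight \<tau> i) (x\<^sup>2) + (q - x\<^sup>2) + \<epsilon> / 2)) \<le>
           measure (P N) {\<omega> \<in> space (P N). x\<^sup>2 \<le> (entry N \<omega> i)\<^sup>2 \<and> (entry N \<omega> i)\<^sup>2 \<le> q}"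
    using x q \<open>\<epsilon> > 0\<close>
    by (intro gamma_interval_prob_exp_ge[OF prob_space_P eventually_distributed_entry[OF i]
          filterlim_speed shape_ratio weight_pos[OF \<tau>(1)]]) auto
  then show ?thesis
    using eventually_m_gt[of k] filterlim_at_top_dense[THEN iffD1, rule_format, OF filterlim_speed, of 0]
  proof eventually_elim
    case (elim N)
    interpret prob_space "P N" by (rule prob_space_P)
    have "exp (- speed N * (gamma_rate (weight \<tau> i) (x\<^sup>2) + \<epsilon>)) \<le>
        exp (- speed N * (gamma_rate (weight \<tau> i) (x\<^sup>2) + (q - x\<^sup>2) + \<epsilon> / 2))"
      using elim q by (auto intro!: mult_left_mono)
    also note elim(1)
    also have "prob {\<omega> \<in> space (P N). x\<^sup>2 \<le> (entry N \<omega> i)\<^sup>2 \<and> (entry N \<omega> i)\<^sup>2 \<le> q} \<le>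
        prob {\<omega> \<in> space (P N). \<bar>entry N \<omega> i - x\<bar> < \<delta>}"
    proof (rule finite_measure_mono)
      show "{\<omega> \<in> space (P N). x\<^sup>2 \<le> (entry N \<omega> i)\<^sup>2 \<and> (entry N \<omega> i)\<^sup>2 \<le> q} \<subseteq>
        {\<omega> \<in> space (P N). \<bar>entry N \<omega> i - x\<bar> < \<delta>}"
      proof safe
        fix \<omega>
        assume \<omega>: "\<omega> \<in> space (P N)" "x\<^sup>2 \<le> (entry N \<omega> i)\<^sup>2" "(entry N \<omega> i)\<^sup>2 \<le> q"
        have e: "entry N \<omega> i > 0"
          using elim(2) i block_subset_used by (intro entry_pos \<omega>) auto
        have "x \<le> entry N \<omega> i"
          using \<omega>(2) less_imp_le[OF e] by (rule power2_le_imp_le)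
        moreover have "entry N \<omega> i \<le> x + \<delta> / 2"
          by (rule power2_le_imp_le) (use \<omega>(3) q x \<open>\<delta> > 0\<close> in auto)
        ultimately show "\<bar>entry N \<omega> i - x\<bar> < \<delta>"
          using \<open>\<delta> > 0\<close> by linarith
      qed
    qed measurable
    finally show ?case .
  qed
qed

text \<open>
  By independence the probabilities of the single coordinates multiply, so their rates add up to the
  partial cost.
\<close>

lemma entries_near_prob_ge:
  assumes k: "k \<ge> 1" and x: "\<And>i. i \<in> block k \<Longrightarrow> x i > 0" and "\<delta> > 0" "\<epsilon> > 0"
  shows "\<forall>\<^sub>F N in sequentially. exp (- speed N * (partial_cost \<tau> k x + \<epsilon>)) \<le>
           measure (P N) {\<omega> \<in> space (P N). \<forall>i\<in>block k. \<bar>entry N \<omega> i - x i\<bar> < \<delta>}"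
proof -
  have ne: "block k \<noteq> {}" using k by (simp add: block_def)
  define \<epsilon>' where "\<epsilon>' = \<epsilon> / card (block k)"
  have \<epsilon>': "\<epsilon>' > 0" using ne \<open>\<epsilon> > 0\<close> by (simp add: \<epsilon>'_def card_gt_0_iff)
  have "\<forall>\<^sub>F N in sequentially. \<forall>i\<in>block k.
      exp (- speed N * (gamma_rate (weight \<tau> i) ((x i)\<^sup>2) + \<epsilon>')) \<le>
           measure (P N) {\<omega> \<in> space (P N). \<bar>entry N \<omega> i - x i\<bar> < \<delta>}"
    using \<epsilon>' \<open>\<delta> > 0\<close> x by (intro eventually_ball_finite ballI entry_near_prob_ge) auto
  then show ?thesis
    using eventually_m_gt[of k]
  proof eventually_elim
    case (elim N)
    interpret prob_space "P N" by (rule prob_space_P)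
    have "(\<Sum>i\<in>block k. \<epsilon>') = \<epsilon>"
      using ne by (simp add: \<epsilon>'_def)
    then have "exp (- speed N * (partial_cost \<tau> k x + \<epsilon>)) =
        exp (\<Sum>i\<in>block k. - speed N * (gamma_rate (weight \<tau> i) ((x i)\<^sup>2) + \<epsilon>'))"
      by (simp only: partial_cost_def sum_distrib_left[symmetric] sum.distrib)
    also have "\<dots> = (\<Prod>i\<in>block k. exp (- speed N * (gamma_rate (weight \<tau> i) ((x i)\<^sup>2) + \<epsilon>')))"
      by (rule exp_sum) simp
    also have "\<dots> \<le> (\<Prod>i\<in>block k. prob {\<omega> \<in> space (P N). \<bar>entry N \<omega> i - x i\<bar> < \<delta>})"
      using elim(1) by (intro prod_mono) auto
    also have "\<dots> = (\<Prod>i\<in>block k. prob ((\<lambda>\<omega>. entry N \<omega> i) -` {y. \<bar>y - x i\<bar> < \<delta>} \<inter> space (P N)))"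
      by (intro prod.cong refl arg_cong[where f = prob]) auto
    also have "\<dots> = prob (\<Inter>i\<in>block k. (\<lambda>\<omega>. entry N \<omega> i) -` {y. \<bar>y - x i\<bar> < \<delta>} \<inter> space (P N))"
      using ne elim(2)
      by (intro indep_varsD_finite[symmetric, OF indep_entries] block_subset_used) auto
    also have "(\<Inter>i\<in>block k. (\<lambda>\<omega>. entry N \<omega> i) -` {y. \<bar>y - x i\<bar> < \<delta>} \<inter> space (P N)) =
        {\<omega> \<in> space (P N). \<forall>i\<in>block k. \<bar>entry N \<omega> i - x i\<bar> < \<delta>}"
      using ne by auto
    finally show ?case .
  qed
qed

text \<open>
  Markov's inequality for the exponential of \<open>\<theta> n\<close> times the partial cost; by independence its
  expectation is the product of the exponential moments of the coordinates.
\<close>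

lemma partial_cost_tail_le:
  assumes k: "k \<ge> 1" and \<theta>: "0 \<le> \<theta>" "\<theta> < 1" and "\<epsilon> > 0"
  shows "\<forall>\<^sub>F N in sequentially.
      measure (P N) {\<omega> \<in> space (P N). partial_cost \<tau> k (entry N \<omega>) > \<alpha>} \<le> exp (- speed N * (\<theta> * \<alpha> - \<epsilon>))"
proof -
  have ne: "block k \<noteq> {}" using k by (simp add: block_def)
  define \<epsilon>' where "\<epsilon>' = \<epsilon> / card (block k)"
  have \<epsilon>': "\<epsilon>' > 0" using ne \<open>\<epsilon> > 0\<close> by (simp add: \<epsilon>'_def card_gt_0_iff)
  define Z where "Z N i \<omega> = ennreal (exp (\<theta> * speed N * gamma_rate (weight \<tau> i) ((entry N \<omega> i)\<^sup>2)))" for N i \<omega>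
  have "\<forall>\<^sub>F N in sequentially. \<forall>i\<in>block k. (\<integral>\<^sup>+\<omega>. Z N i \<omega> \<partial>P N) \<le> ennreal (exp (speed N * \<epsilon>'))"
    unfolding Z_def
    by (intro eventually_ball_finite ballI finite_block
        gamma_exp_rate_subexponential[OF eventually_distributed_entry filterlim_speed shape_ratio
          weight_pos[OF \<tau>(1)] \<theta>(2) \<epsilon>'])
  then show ?thesis
    using eventually_m_gt[of k] filterlim_at_top_dense[THEN iffD1, rule_format, OF filterlim_speed, of 0]
  proof eventually_elim
    case (elim N)
    interpret prob_space "P N" by (rule prob_space_P)
    have [measurable]: "(\<lambda>\<omega>. Z N i \<omega>) \<in> borel_measurable (P N)" for i
      unfolding Z_def by measurable
    let ?A = "{\<omega> \<in> space (P N). partial_cost \<tau> k (entry N \<omega>) > \<alpha>}"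
    have A [measurable]: "?A \<in> events" by measurable
    have prodZ: "(\<Prod>i\<in>block k. Z N i \<omega>) = ennreal (exp (\<theta> * speed N * partial_cost \<tau> k (entry N \<omega>)))" for \<omega>
      by (simp add: Z_def prod_ennreal exp_sum[symmetric] partial_cost_def sum_distrib_left)
    have "indep_vars (\<lambda>_. borel) (\<lambda>i \<omega>. entry N \<omega> i) (block k)"
      using elim(2) by (intro indep_entries block_subset_used)
    then have "indep_vars (\<lambda>_. borel)
        (\<lambda>i \<omega>. (\<lambda>y. ennreal (exp (\<theta> * speed N * gamma_rate (weight \<tau> i) (y\<^sup>2)))) (entry N \<omega> i)) (block k)"
      by (rule indep_vars_compose2) measurable
    then have "(\<integral>\<^sup>+\<omega>. (\<Prod>i\<in>block k. Z N i \<omega>) \<partial>P N) = (\<Prod>i\<in>block k. \<integral>\<^sup>+\<omega>. Z N i \<omega> \<partial>P N)"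
      unfolding Z_def by (intro indep_vars_nn_integral) auto
    also have "\<dots> \<le> (\<Prod>i\<in>block k. ennreal (exp (speed N * \<epsilon>')))"
      using elim(1) by (intro prod_mono_ennreal) auto
    also have "\<dots> = ennreal (exp (speed N * \<epsilon>))"
      using ne by (simp add: \<epsilon>'_def ennreal_power exp_of_nat_mult[symmetric])
    finally have moment_gen: "(\<integral>\<^sup>+\<omega>. (\<Prod>i\<in>block k. Z N i \<omega>) \<partial>P N) \<le> ennreal (exp (speed N * \<epsilon>))" .
    have "emeasure (P N) ?A = (\<integral>\<^sup>+\<omega>. indicator ?A \<omega> \<partial>P N)"
      by simp
    also have "\<dots> \<le> (\<integral>\<^sup>+\<omega>. ennreal (exp (- (\<theta> * speed N * \<alpha>))) * (\<Prod>i\<in>block k. Z N i \<omega>) \<partial>P N)"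
    proof (intro nn_integral_mono)
      fix \<omega>
      have "1 \<le> exp (- (\<theta> * speed N * \<alpha>)) * exp (\<theta> * speed N * partial_cost \<tau> k (entry N \<omega>))"
        if "\<alpha> < partial_cost \<tau> k (entry N \<omega>)"
      proof -
        have "\<theta> * speed N * \<alpha> \<le> \<theta> * speed N * partial_cost \<tau> k (entry N \<omega>)"
          using that \<theta> elim(3) by (intro mult_left_mono) auto
        then show ?thesis by (simp add: exp_add[symmetric])
      qed
      then show "indicator ?A \<omega> \<le> ennreal (exp (- (\<theta> * speed N * \<alpha>))) * (\<Prod>i\<in>block k. Z N i \<omega>)"
        unfolding prodZ by (auto simp: indicator_def ennreal_mult[symmetric] simp flip: ennreal_1 intro!: ennreal_leI)
    qed
    also have "\<dots> = ennreal (exp (- (\<theta> * speed N * \<alpha>))) * (\<integral>\<^sup>+\<omega>. (\<Prod>i\<in>block k. Z N i \<omega>) \<partial>P N)"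
      by (rule nn_integral_cmult) measurable
    also have "\<dots> \<le> ennreal (exp (- (\<theta> * speed N * \<alpha>))) * ennreal (exp (speed N * \<epsilon>))"
      using moment_gen by (intro mult_left_mono) auto
    also have "\<dots> = ennreal (exp (- speed N * (\<theta> * \<alpha> - \<epsilon>)))"
      by (simp add: ennreal_mult[symmetric] exp_add[symmetric] algebra_simps)
    finally show ?case
      by (simp add: emeasure_eq_measure)
  qed
qed

lemma measurable_spectral:
  assumes "m N \<ge> 1"
  shows "\<mu> N \<in> measurable (P N) (sigma (topspace moment_topology) {U. openin moment_topology U})"
proof (rule measurable_moment_topology)
  show "\<mu> N \<omega> \<in> M_md" if "\<omega> \<in> space (P N)" for \<omega>
    using moment_spectral(1)[OF assms that] .
  show "(\<lambda>\<omega>. moment (\<mu> N \<omega>) r) \<in> borel_measurable (P N)" for r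
  proof -
    have "(\<lambda>\<omega>. laguerre_moment (entry N \<omega>) r) \<in> borel_measurable (P N)"
      unfolding laguerre_moment_def offdiag_coeff_def diag_coeff_def comp_def
    proof (rule measurable_jacobi_power)
      show "(\<lambda>\<omega>. if k = 0 then (entry N \<omega> (Inl 1))\<^sup>2
          else (entry N \<omega> (Inr k))\<^sup>2 + (entry N \<omega> (Inl (Suc k)))\<^sup>2) \<in> borel_measurable (P N)" for k
        by (cases "k = 0") simp_all
    qed simp
    then show ?thesis
      by (rule measurable_cong[THEN iffD2, rotated]) (rule moment_spectral(2)[OF assms])
  qed
qed

text \<open>
  Otherwise there are spectral measures in \<open>F\<close> whose first \<open>k\<close> pairs of entries cost at most \<open>\<alpha>\<close>, for
  every \<open>k\<close>. A subsequence of them converges to a measure of rate at most \<open>\<alpha>\<close>, which lies in the closed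
  set \<open>F\<close>.
\<close>

lemma closedin_imp_partial_cost_gt:
  assumes F: "closedin moment_topology F" and \<alpha>: "ereal \<alpha> < (INF \<nu>\<in>F. rate_w \<tau> \<nu>)"
  obtains k where "k \<ge> 1" "\<And>N \<omega>. k < m N \<Longrightarrow> \<omega> \<in> space (P N) \<Longrightarrow> \<mu> N \<omega> \<in> F \<Longrightarrow>
      \<alpha> < partial_cost \<tau> k (entry N \<omega>)"
proof -
  have "\<exists>k. \<forall>N \<omega>. Suc k < m N \<longrightarrow> \<omega> \<in> space (P N) \<longrightarrow> \<mu> N \<omega> \<in> F \<longrightarrow>
      \<alpha> < partial_cost \<tau> (Suc k) (entry N \<omega>)"
  proof (rule ccontr)
    assume "\<not> ?thesis"
    then obtain N \<omega> where N: "\<And>k. Suc k < m (N k)" "\<And>k. \<omega> k \<in> space (P (N k))"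
        "\<And>k. \<mu> (N k) (\<omega> k) \<in> F" "\<And>k. partial_cost \<tau> (Suc k) (entry (N k) (\<omega> k)) \<le> \<alpha>"
      by (metis not_less)
    define X where "X k = entry (N k) (\<omega> k)" for k
    have X_pos: "X k i > 0" if "i \<in> block (Suc k)" for k i
      unfolding X_def using that block_subset_used[OF N(1)] by (intro entry_pos N) auto
    have X_pos': "X k i > 0" if "i \<in> block k" for k i
      using X_pos[of i k] that block_mono[of k "Suc k"] by auto
    have "partial_cost \<tau> k (X k) \<le> \<alpha>" for k
      using partial_cost_mono[OF \<tau>(1), of k "Suc k" "X k"] X_pos N(4)[of k] unfolding X_def[symmetric]
      by fastforce
    then obtain \<rho> x where \<rho>: "strict_mono (\<rho> :: nat \<Rightarrow> nat)"
      and x: "\<And>n i. i \<in> block n \<Longrightarrow> x i > 0" "\<And>n i. i \<in> block n \<Longrightarrow> (\<lambda>k. X (\<rho> k) i) \<longlonglongrightarrow> x i"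
        "\<And>n. partial_cost \<tau> n x \<le> \<alpha>"
      using sublevel_subsequence[of \<tau> X \<alpha>] \<tau>(1) X_pos' by blast
    have m1: "m (N k) \<ge> 1" for k using N(1)[of k] by simp
    have \<sigma>: "\<mu> (N k) (\<omega> k) \<in> M_md" "moment (\<mu> (N k) (\<omega> k)) r = laguerre_moment (X k) r" for k r
      unfolding X_def using moment_spectral[OF m1 N(2)] by auto
    have "\<exists>\<nu>\<in>M_md. rate_w \<tau> \<nu> \<le> ereal \<alpha> \<and>
        limitin moment_topology (\<lambda>k. \<mu> (N (\<rho> k)) (\<omega> (\<rho> k))) \<nu> sequentially"
      by (rule laguerre_limit_measure[where X = "\<lambda>k. X (\<rho> k)" and x = x])
        (rule \<tau> \<sigma> x | assumption)+
    then obtain \<nu> where \<nu>: "rate_w \<tau> \<nu> \<le> ereal \<alpha>"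
        "limitin moment_topology (\<lambda>k. \<mu> (N (\<rho> k)) (\<omega> (\<rho> k))) \<nu> sequentially"
      by blast
    have "\<nu> \<in> F"
      by (rule limitin_closedin[OF \<nu>(2) F]) (use N(3) in auto)
    then have "(INF \<nu>\<in>F. rate_w \<tau> \<nu>) \<le> ereal \<alpha>"
      using \<nu>(1) by (rule INF_lower2)
    then show False using \<alpha> by simp
  qed
  then show ?thesis using that[of "Suc _"] by auto
qed

lemma upper_bound_at:
  assumes F: "closedin moment_topology F" and \<alpha>: "ereal \<alpha> < (INF \<nu>\<in>F. rate_w \<tau> \<nu>)" "\<alpha> \<ge> 0"
  shows "limsup (\<lambda>N. ereal (1 / speed N) * log_prob (measure (P N) {\<omega> \<in> space (P N). \<mu> N \<omega> \<in> F})) \<le> - ereal \<alpha>"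
    (is "limsup ?L \<le> _")
proof (rule ereal_le_epsilon2)
  fix e :: real
  assume e: "e > 0"
  obtain k where k: "k \<ge> 1" "\<And>N \<omega>. k < m N \<Longrightarrow> \<omega> \<in> space (P N) \<Longrightarrow> \<mu> N \<omega> \<in> F \<Longrightarrow>
      \<alpha> < partial_cost \<tau> k (entry N \<omega>)"
    using closedin_imp_partial_cost_gt[OF F \<alpha>(1)] by blast
  \<comment> \<open>Chosen so that \<open>(1 - \<theta>) \<alpha> \<le> e / 2\<close>, while \<open>\<theta> \<ge> 0\<close> is needed for Markov's inequality.\<close>
  define \<theta> where "\<theta> = 1 - min 1 (e / (2 * (\<alpha> + 1)))"
  have \<theta>: "0 \<le> \<theta>" "\<theta> < 1"
    using e \<alpha>(2) by (auto simp: \<theta>_def)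
  have "(1 - \<theta>) * \<alpha> \<le> e / (2 * (\<alpha> + 1)) * \<alpha>"
    using \<alpha>(2) by (intro mult_right_mono) (auto simp: \<theta>_def)
  also have "\<dots> \<le> e / 2"
    using e \<alpha>(2) by (simp add: field_simps)
  finally have \<theta>\<alpha>: "\<alpha> - e \<le> \<theta> * \<alpha> - e / 2"
    by (simp add: algebra_simps)
  have "\<forall>\<^sub>F N in sequentially. ?L N \<le> ereal (- (\<theta> * \<alpha> - e / 2))"
    using partial_cost_tail_le[OF k(1) \<theta> half_gt_zero[OF e], of \<alpha>] eventually_m_gt[of k]
      filterlim_at_top_dense[THEN iffD1, rule_format, OF filterlim_speed, of 0]
  proof eventually_elim
    case (elim N)
    interpret prob_space "P N" by (rule prob_space_P)
    have "prob {\<omega> \<in> space (P N). \<mu> N \<omega> \<in> F} \<le> prob {\<omega> \<in> space (P N). partial_cost \<tau> k (entry N \<omega>) > \<alpha>}"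
      using k(2) elim by (intro finite_measure_mono) auto
    also have "\<dots> \<le> exp (- speed N * (\<theta> * \<alpha> - e / 2))"
      using elim e by simp
    finally show ?case using elim by (intro scaled_log_prob_le)
  qed
  then have "limsup ?L \<le> ereal (- (\<theta> * \<alpha> - e / 2))"
    by (rule Limsup_bounded)
  also have "\<dots> \<le> - ereal \<alpha> + ereal e"
    using \<theta>\<alpha> by simp
  finally show "limsup ?L \<le> - ereal \<alpha> + ereal e" .
qed

lemma upper_bound:
  assumes F: "closedin moment_topology F"
  shows "limsup (\<lambda>N. ereal (1 / speed N) * log_prob (measure (P N) {\<omega> \<in> space (P N). \<mu> N \<omega> \<in> F}))
      \<le> - (INF \<nu>\<in>F. rate_w \<tau> \<nu>)" (is "limsup ?L \<le> - ?I")
proof -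
  have trivial: "limsup ?L \<le> 0"
  proof (rule Limsup_bounded)
    show "\<forall>\<^sub>F N in sequentially. ?L N \<le> 0"
      using filterlim_at_top_dense[THEN iffD1, rule_format, OF filterlim_speed, of 0]
    proof eventually_elim
      case (elim N)
      interpret prob_space "P N" by (rule prob_space_P)
      show ?case
        using scaled_log_prob_le[OF elim, of "measure (P N) {\<omega> \<in> space (P N). \<mu> N \<omega> \<in> F}" 0] prob_le_1
        by (simp add: zero_ereal_def)
    qed
  qed
  have "?I \<le> - limsup ?L"
  proof (rule dense_le)
    fix y
    assume y: "y < ?I"
    show "y \<le> - limsup ?L"
    proof (cases "y \<le> 0")
      case True
      then show ?thesis using trivial by (meson ereal_0_le_uminus_iff order_trans)
    next
      case False
      then obtain \<alpha> where \<alpha>: "y = ereal \<alpha>" "\<alpha> \<ge> 0"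
        using y by (cases y) auto
      have "limsup ?L \<le> - y"
        using upper_bound_at[OF F, of \<alpha>] y \<alpha> by (simp only:)
      then have "- (- y) \<le> - limsup ?L"
        by (simp only: ereal_minus_le_minus)
      then show ?thesis by (simp only: ereal_uminus_uminus)
    qed
  qed
  then have "- (- limsup ?L) \<le> - ?I"
    by (simp only: ereal_minus_le_minus)
  then show ?thesis by (simp only: ereal_uminus_uminus)
qed

text \<open>
  Otherwise there are spectral measures outside \<open>U\<close> whose entries converge coordinatewise to those of
  \<open>\<nu>\<close>, and they converge to \<open>\<nu>\<close>.
\<close>

lemma openin_imp_near_entries:
  assumes U: "openin moment_topology U" "\<nu> \<in> U"
    and x: "\<And>r. moment \<nu> r = laguerre_moment x r"
  obtains k \<delta> where "k \<ge> 1" "\<delta> > 0" "\<And>N \<omega>. k < m N \<Longrightarrow> \<omega> \<in> space (P N) \<Longrightarrow>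
      (\<forall>i\<in>block k. \<bar>entry N \<omega> i - x i\<bar> < \<delta>) \<Longrightarrow> \<mu> N \<omega> \<in> U"
proof -
  have \<nu>: "\<nu> \<in> M_md" using openin_subset[OF U(1)] U(2) by auto
  have "\<exists>k. \<forall>N \<omega>. Suc k < m N \<longrightarrow> \<omega> \<in> space (P N) \<longrightarrow>
      (\<forall>i\<in>block (Suc k). \<bar>entry N \<omega> i - x i\<bar> < 1 / real (Suc k)) \<longrightarrow> \<mu> N \<omega> \<in> U"
  proof (rule ccontr)
    assume "\<not> ?thesis"
    then obtain N \<omega> where N: "\<And>k. Suc k < m (N k)" "\<And>k. \<omega> k \<in> space (P (N k))"
        "\<And>k i. i \<in> block (Suc k) \<Longrightarrow> \<bar>entry (N k) (\<omega> k) i - x i\<bar> < 1 / real (Suc k)"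
        "\<And>k. \<mu> (N k) (\<omega> k) \<notin> U"
      by metis
    have "(\<lambda>k. entry (N k) (\<omega> k) i) \<longlonglongrightarrow> x i" if "i \<in> block n" for n i
    proof -
      have "(\<lambda>k. \<bar>entry (N k) (\<omega> k) i - x i\<bar>) \<longlonglongrightarrow> 0"
      proof (rule tendsto_sandwich[of "\<lambda>_. 0" _ _ "\<lambda>k. 1 / real (Suc k)"])
        show "(\<lambda>k. 1 / real (Suc k)) \<longlonglongrightarrow> 0"
          by (rule LIMSEQ_Suc[OF lim_const_over_n])
        show "\<forall>\<^sub>F k in sequentially. \<bar>entry (N k) (\<omega> k) i - x i\<bar> \<le> 1 / real (Suc k)"
          using eventually_ge_at_top[of n]
        proof eventually_elim
          case (elim k)
          have "i \<in> block (Suc k)" using that block_mono[of n "Suc k"] elim by auto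
          then show ?case using N(3) by (meson less_imp_le)
        qed
      qed auto
      then show ?thesis by (simp add: tendsto_rabs_zero_iff LIM_zero_iff)
    qed
    then have lim: "(\<lambda>k. laguerre_moment (entry (N k) (\<omega> k)) r) \<longlonglongrightarrow> laguerre_moment x r" for r
      by (rule tendsto_laguerre_moment)
    have m1: "m (N k) \<ge> 1" for k using N(1)[of k] by simp
    have "limitin moment_topology (\<lambda>k. \<mu> (N k) (\<omega> k)) \<nu> sequentially"
      using moment_spectral[OF m1 N(2)] \<nu> lim x by (intro limitin_moment_topology) auto
    then have "\<forall>\<^sub>F k in sequentially. \<mu> (N k) (\<omega> k) \<in> U"
      using U by (simp add: limitin_def)
    then show False using N(4) by simp
  qed
  then obtain k where "\<forall>N \<omega>. Suc k < m N \<longrightarrow> \<omega> \<in> space (P N) \<longrightarrow>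
      (\<forall>i\<in>block (Suc k). \<bar>entry N \<omega> i - x i\<bar> < 1 / real (Suc k)) \<longrightarrow> \<mu> N \<omega> \<in> U"
    by blast
  then show ?thesis using that[of "Suc k" "1 / real (Suc k)"] by auto
qed

lemma lower_bound:
  assumes U: "openin moment_topology U"
  shows "- (INF \<nu>\<in>U. rate_w \<tau> \<nu>) \<le>
      liminf (\<lambda>N. ereal (1 / speed N) * log_prob (measure (P N) {\<omega> \<in> space (P N). \<mu> N \<omega> \<in> U}))"
    (is "- ?I \<le> liminf ?L")
proof -
  have U_sub: "U \<subseteq> M_md"
    using openin_subset[OF U] by simp
  have "{U. openin moment_topology U} \<subseteq> Pow (topspace moment_topology)"
    using openin_subset by blast
  then have U_sets: "U \<in> sets (sigma (topspace moment_topology) {U. openin moment_topology U})"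
    using U by (simp add: sets_measure_of sigma_sets.Basic del: topspace_moment_topology)
  have "- liminf ?L \<le> rate_w \<tau> \<nu>" if \<nu>: "\<nu> \<in> U" for \<nu>
  proof (cases "rate_w \<tau> \<nu>")
    case (real c)
    have "\<nu> \<in> M_md" using \<nu> U_sub by auto
    then obtain x where x: "\<And>n i. i \<in> block n \<Longrightarrow> x i > 0" "\<And>r. moment \<nu> r = laguerre_moment x r"
        "\<And>n. partial_cost \<tau> n x \<le> c"
      using rate_w_le_iff[OF \<tau>(1), of \<nu> c] real by auto
    obtain k \<delta> where k: "k \<ge> 1" "\<delta> > 0" "\<And>N \<omega>. k < m N \<Longrightarrow> \<omega> \<in> space (P N) \<Longrightarrow>
        (\<forall>i\<in>block k. \<bar>entry N \<omega> i - x i\<bar> < \<delta>) \<Longrightarrow> \<mu> N \<omega> \<in> U"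
      using openin_imp_near_entries[OF U \<nu> x(2)] by blast
    have "- ereal c \<le> liminf ?L"
    proof (rule ereal_le_epsilon2)
      fix e :: real
      assume e: "e > 0"
      have "\<forall>\<^sub>F N in sequentially. exp (- speed N * (partial_cost \<tau> k x + e)) \<le>
           measure (P N) {\<omega> \<in> space (P N). \<forall>i\<in>block k. \<bar>entry N \<omega> i - x i\<bar> < \<delta>}"
        by (rule entries_near_prob_ge[OF k(1) _ k(2) e]) (rule x(1))
      then have "\<forall>\<^sub>F N in sequentially. ereal (- (c + e)) \<le> ?L N"
        using eventually_m_gt[of k]
          filterlim_at_top_dense[THEN iffD1, rule_format, OF filterlim_speed, of 0]
      proof eventually_elim
        case (elim N)
        interpret prob_space "P N" by (rule prob_space_P)
        have "\<mu> N -` U \<inter> space (P N) \<in> events"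
          by (rule measurable_sets[OF measurable_spectral U_sets]) (use elim in simp)
        also have "\<mu> N -` U \<inter> space (P N) = {\<omega> \<in> space (P N). \<mu> N \<omega> \<in> U}" by auto
        finally have meas: "{\<omega> \<in> space (P N). \<mu> N \<omega> \<in> U} \<in> events" .
        have "exp (- speed N * (c + e)) \<le> exp (- speed N * (partial_cost \<tau> k x + e))"
          using elim x(3)[of k] by (auto intro!: mult_left_mono)
        also have "\<dots> \<le> prob {\<omega> \<in> space (P N). \<forall>i\<in>block k. \<bar>entry N \<omega> i - x i\<bar> < \<delta>}"
          using elim(1) .
        also have "\<dots> \<le> prob {\<omega> \<in> space (P N). \<mu> N \<omega> \<in> U}"
          using k(3) elim meas by (intro finite_measure_mono) auto
        finally show ?case using elim by (intro scaled_log_prob_ge)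
      qed
      then have "ereal (- (c + e)) \<le> liminf ?L" by (rule Liminf_bounded)
      then have "ereal (- (c + e)) + ereal e \<le> liminf ?L + ereal e" by (rule add_right_mono)
      then show "- ereal c \<le> liminf ?L + ereal e" by simp
    qed
    then show ?thesis using real by (simp add: ereal_uminus_le_reorder)
  next
    case MInf
    then show ?thesis using rate_w_nonneg[OF \<tau>(1), of \<nu>] \<nu> U_sub by auto
  qed simp
  then have "- liminf ?L \<le> ?I" by (rule INF_greatest)
  then show ?thesis by (simp add: ereal_uminus_le_reorder)
qed

theorem LDP_spectral_measure: "LDP_good moment_topology speed P \<mu> (rate_w \<tau>)"
proof -
  have "\<forall>\<^sub>F N in sequentially. \<mu> N \<in> measurable (P N) (sigma (topspace moment_topology) {U. openin moment_topology U})"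
    using eventually_m_gt[of 0] by eventually_elim (rule measurable_spectral, simp)
  then show ?thesis
    using good_rate_function_rate_w[OF \<tau>] upper_bound lower_bound unfolding LDP_good_def by blast
qed

end

theorem theorem5p2:
  fixes \<beta> \<tau> :: real
    and m :: "nat \<Rightarrow> nat"
    and P :: "nat \<Rightarrow> 'a measure"
    and d s :: "nat \<Rightarrow> nat \<Rightarrow> 'a \<Rightarrow> real"
    and \<mu> :: "nat \<Rightarrow> 'a \<Rightarrow> real measure"
  assumes "\<beta> > 0" and "0 < \<tau>" and "\<tau> < 1"
    and "\<And>N. m N = nat \<lfloor>\<tau> * real N\<rfloor>"
    and "\<And>N. laguerre_entries \<beta> N (m N) (P N) (d N) (s N)"
    and "\<And>N \<omega>. \<omega> \<in> space (P N) \<Longrightarrow>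
           is_spectral_measure (laguerre_matrix (m N) (\<lambda>j. d N j \<omega>) (\<lambda>j. s N j \<omega>))
             (unit_vec (m N) 0) (\<mu> N \<omega>)"
  shows "(\<forall>\<nu>\<in>M_md. \<forall>x y x' y'. encodes \<tau> \<nu> x y \<and> encodes \<tau> \<nu> x' y' \<longrightarrow> x = x' \<and> y = y') \<and>
         LDP_good moment_topology (\<lambda>N. \<beta> / 2 * real N) P \<mu> (rate_w \<tau>)"
proof
  show "\<forall>\<nu>\<in>M_md. \<forall>x y x' y'. encodes \<tau> \<nu> x y \<and> encodes \<tau> \<nu> x' y' \<longrightarrow> x = x' \<and> y = y'"
    using encodes_unique[OF assms(2)] by blast
  interpret laguerre_ensemble \<beta> \<tau> m P d s \<mu>
    using assms by unfold_locales
  show "LDP_good moment_topology (\<lambda>N. \<beta> / 2 * real N) P \<mu> (rate_w \<tau>)"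
    using LDP_spectral_measure unfolding speed_def .
qed

end
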